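(* If $\exists$Dominance-OMv can be solved in time $O(n^{3-\varepsilon})$ for some $\varepsilon>0$, then Min-Max-OMv can be solved in time $O(n^{3-\varepsilon/2})$.
   Context: Both problems are online: an $n\times n$ integer matrix $M\in\mathbb{Z}^{n\times n}$ is given for preprocessing, then $n$ query column vectors $v_1,\dots,v_n\in\mathbb{Z}^n$ arrive one at a time and the answer to query $j$ must be output before $v_{j+1}$ is received; running time counts preprocessing and all queries. $\exists$Dominance-OMv: output $u\in\{0,1\}^n$ with $u[i]=1$ iff $\exists k\in[n]$: $M[i,k]\le v_j[k]$. Min-Max-OMv: output $u\in\mathbb{Z}^n$ with $u[i]=\min_{k\in[n]}\max\{M[i,k],v_j[k]\}$. *)

theory Defs
  imports Complex_Main "HOL-Library.Landau_Symbols"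
begin

text \<open>
  Algorithms are programs of a word RAM: finitely many registers (those mentioned in the program),
  a memory with indirect addressing, and unit-cost word operations. Control flow is structured,
  which agrees with jumps up to a constant factor in the running time.
\<close>

datatype binop =
  OpAdd | OpSub | OpMul | OpDiv | OpMod | OpAnd | OpOr | OpXor | OpShl | OpShr | OpLess | OpEq

fun apply_op :: "binop \<Rightarrow> int \<Rightarrow> int \<Rightarrow> int" where
  "apply_op OpAdd x y = x + y"
| "apply_op OpSub x y = x - y"
| "apply_op OpMul x y = x * y"
| "apply_op OpDiv x y = x div y"
| "apply_op OpMod x y = x mod y"
| "apply_op OpAnd x y = Bit_Operations.and x y"
| "apply_op OpOr x y = Bit_Operations.or x y"
| "apply_op OpXor x y = Bit_Operations.xor x y"
| "apply_op OpShl x y = push_bit (nat y) x"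
| "apply_op OpShr x y = drop_bit (nat y) x"
| "apply_op OpLess x y = of_bool (x < y)"
| "apply_op OpEq x y = of_bool (x = y)"

type_synonym reg = nat

datatype com =
    Skip
  | Const reg int
  | Op binop reg reg reg
  | Load reg reg
  | Store reg reg
  | Seq com com
  | If reg com com
  | While reg com

text \<open>Register contents and memory contents.\<close>
type_synonym state = "(reg \<Rightarrow> int) \<times> (int \<Rightarrow> int)"

text \<open>
  \<open>exec W c s t s'\<close>: program \<open>c\<close> started in \<open>s\<close> halts in \<open>s'\<close> after \<open>t\<close> steps.
  Words are the integers of absolute value at most \<open>W\<close>; a program producing a
  larger value is stuck, hence has no halting execution.
\<close>
inductive exec :: "int \<Rightarrow> com \<Rightarrow> state \<Rightarrow> nat \<Rightarrow> state \<Rightarrow> bool" for W :: int where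
  Skip: "exec W Skip s 1 s"
| Const: "\<bar>k\<bar> \<le> W \<Longrightarrow> exec W (Const r k) (R, H) 1 (R(r := k), H)"
| Op: "x = apply_op f (R a) (R b) \<Longrightarrow> \<bar>x\<bar> \<le> W \<Longrightarrow>
       exec W (Op f r a b) (R, H) 1 (R(r := x), H)"
| Load: "exec W (Load r a) (R, H) 1 (R(r := H (R a)), H)"
| Store: "exec W (Store a r) (R, H) 1 (R, H(R a := R r))"
| Seq: "exec W c1 s1 t1 s2 \<Longrightarrow> exec W c2 s2 t2 s3 \<Longrightarrow> exec W (Seq c1 c2) s1 (t1 + t2) s3"
| IfTrue: "fst s r \<noteq> 0 \<Longrightarrow> exec W c1 s t s' \<Longrightarrow> exec W (If r c1 c2) s (Suc t) s'"
| IfFalse: "fst s r = 0 \<Longrightarrow> exec W c2 s t s' \<Longrightarrow> exec W (If r c1 c2) s (Suc t) s'"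
| WhileFalse: "fst s r = 0 \<Longrightarrow> exec W (While r c) s 1 s"
| WhileTrue: "fst s1 r \<noteq> 0 \<Longrightarrow> exec W c s1 t1 s2 \<Longrightarrow> exec W (While r c) s2 t2 s3 \<Longrightarrow>
       exec W (While r c) s1 (Suc (t1 + t2)) s3"

lemma exec_deterministic:
  "exec W c s t s' \<Longrightarrow> exec W c s u s'' \<Longrightarrow> u = t \<and> s'' = s'"
proof (induction arbitrary: u s'' rule: exec.induct)
  case (Seq c1 s1 t1 s2 c2 t2 s3)
  from Seq.prems obtain u1 u2 z where "exec W c1 s1 u1 z" "exec W c2 z u2 s''" "u = u1 + u2"
    by cases auto
  with Seq.IH show ?case by metis
next
  case (WhileTrue s1 r c t1 s2 t2 s3)
  from WhileTrue.prems WhileTrue.hyps(1) obtain u1 u2 z where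
    "exec W c s1 u1 z" "exec W (While r c) z u2 s''" "u = Suc (u1 + u2)"
    by cases auto
  with WhileTrue.IH show ?case by metis
next
  case (IfTrue s r c1 t s' c2)
  from IfTrue.prems IfTrue.hyps(1) show ?case by cases (auto dest: IfTrue.IH)
next
  case (IfFalse s r c2 t s' c1)
  from IfFalse.prems IfFalse.hyps(1) show ?case by cases (auto dest: IfFalse.IH)
qed (erule exec.cases; simp)+

text \<open>
  Matrices and vectors of dimension \<open>n\<close> are functions on the indices below \<open>n\<close>.
  Memory layout: \<open>n\<close> is in register 0, the matrix is stored row by row from address 0,
  the current query from address \<open>n\<^sup>2\<close>, and the answer is expected from address \<open>n\<^sup>2 + n\<close>.
  Everything else is initially 0.
\<close>

type_synonym matrix = "nat \<Rightarrow> nat \<Rightarrow> int"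
type_synonym vector = "nat \<Rightarrow> int"

definition initial_state :: "nat \<Rightarrow> matrix \<Rightarrow> state" where
  "initial_state n M =
     ((\<lambda>_. 0)(0 := int n),
      \<lambda>a. if 0 \<le> a \<and> a < int (n * n) then M (nat a div n) (nat a mod n) else 0)"

definition receive_query :: "nat \<Rightarrow> vector \<Rightarrow> state \<Rightarrow> state" where
  "receive_query n v s =
     (fst s,
      \<lambda>a. if int (n * n) \<le> a \<and> a < int (n * n + n) then v (nat a - n * n) else snd s a)"

definition answer :: "nat \<Rightarrow> state \<Rightarrow> vector" where
  "answer n s i = snd s (int (n * n + n + i))"

text \<open>An online matrix-vector problem maps \<open>n\<close>, \<open>M\<close> and a query to the correct answer.\<close>
type_synonym omv_problem = "nat \<Rightarrow> matrix \<Rightarrow> vector \<Rightarrow> vector"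

definition exists_dominance_OMv :: omv_problem where
  "exists_dominance_OMv n M v = (\<lambda>i. of_bool (\<exists>k<n. M i k \<le> v k))"

definition min_max_OMv :: omv_problem where
  "min_max_OMv n M v = (\<lambda>i. Min ((\<lambda>k. max (M i k) (v k)) ` {..<n}))"

text \<open>
  An online algorithm is a preprocessing program and a query program sharing their state. The
  query program is run to completion on each query before the next query is placed in memory; as
  execution is deterministic, its answer to query \<open>j\<close> depends only on \<open>M\<close> and the
  queries up to \<open>j\<close>. Receiving an input word is charged one step.
\<close>
type_synonym online_algorithm = "com \<times> com"

definition solves_online ::
  "omv_problem \<Rightarrow> online_algorithm \<Rightarrow> int \<Rightarrow> nat \<Rightarrow> matrix \<Rightarrow> (nat \<Rightarrow> vector) \<Rightarrow> nat \<Rightarrow> bool" where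
  "solves_online prob alg W n M v T \<longleftrightarrow>
     (\<exists>s t\<^sub>0 t.
        exec W (fst alg) (initial_state n M) t\<^sub>0 (s 0) \<and>
        (\<forall>j<n. exec W (snd alg) (receive_query n (v j) (s j)) (t j) (s (Suc j)) \<and>
               (\<forall>i<n. answer n (s (Suc j)) i = prob n M (v j) i)) \<and>
        n * n + t\<^sub>0 + (\<Sum>j<n. n + t j) \<le> T)"

text \<open>
  The word length is \<open>O(log (n + U))\<close> bits, where \<open>U\<close> bounds the absolute values of the input
  integers; the running time is bounded in terms of \<open>n\<close> only, uniformly in \<open>U\<close>.
\<close>
definition solvable_in_time :: "omv_problem \<Rightarrow> (nat \<Rightarrow> real) \<Rightarrow> bool" where
  "solvable_in_time prob f \<longleftrightarrow>
     (\<exists>alg (c::nat) (T :: nat \<Rightarrow> nat).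
        (\<lambda>n. real (T n)) \<in> O(f) \<and>
        (\<forall>n>0. \<forall>(U::nat) (M :: matrix) (v :: nat \<Rightarrow> vector).
           (\<forall>i<n. \<forall>k<n. \<bar>M i k\<bar> \<le> int U) \<longrightarrow>
           (\<forall>j<n. \<forall>k<n. \<bar>v j k\<bar> \<le> int U) \<longrightarrow>
           solves_online prob alg (int ((n + U + 2) ^ c)) n M v (T n)))"

end

theory Submission
  imports Defs
begin

text \<open>
  Write \<open>u i = min\<^sub>k max (M i k) (v k)\<close>. If the minimum is attained at some \<open>k\<close> with
  \<open>M i k \<le> v k\<close>, then it is the least \<open>v k\<close> with \<open>M i k \<le> v k\<close>; otherwise it is the least
  \<open>M i k\<close> with \<open>v k \<le> M i k\<close>. Sort \<open>v\<close>, and every row of \<open>M\<close>, and cut the sorted orders into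
  groups of size \<open>s\<close>. For each group, an instance of existential dominance tells which rows have a
  witness inside the group; entries outside the group are masked by a sentinel. In the first group
  with a witness the answer is found by inspecting its \<open>s\<close> elements. With about \<open>n / s\<close>
  instances this costs \<open>n / s \<cdot> T + n\<^sup>2 s\<close>, which is balanced by \<open>s\<close> about \<open>sqrt (T / n)\<close>.

  The exponent \<open>\<epsilon>\<close> is an arbitrary real number, hence \<open>n powr (1 - \<epsilon> / 2)\<close> need not be
  computable. The program therefore finds \<open>s\<close> adaptively: it counts the simulated steps of the
  instances, and once they exceed \<open>n\<^sup>2 s\<close> it doubles \<open>s\<close> and continues with fresh instances. The
  costs of the abandoned levels form a geometric series, apart from an overshoot of at most \<open>T\<close> per
  level. Starting at \<open>s \<ge> sqrt n\<close> bounds the overhead of masking and of sorting.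
\<close>

subsection \<open>Expressions and structured commands compiled to the word RAM\<close>

text \<open>The assumed algorithm is an arbitrary pair of programs, and O(n / s) copies of it run
  interleaved, each keeping its own state from query to query. Its accesses may hit any word
  address, and the program knows neither U nor a word bound, so no contiguous block of memory can be
  set aside for a copy. A pairing function solves this: cell addresses are polynomial in the old
  word bound, which only changes the exponent \<open>c\<close>. A copy also relies on memory that is
  0 at the start, so the cells of an abandoned level are not recycled and the next level takes new
  ones.

  The budget is tested only between runs of instances; this is the source of the overshoot. There
  are O(log n) levels, and T log n is O(n powr (3 - epsilon / 2)), because the allowed loss of n
  powr (epsilon / 2) exceeds a logarithm.

  Receiving the input is charged n^2 steps, hence T is at least n^2. This makes the initial group
  size harmless: sqrt n is at most sqrt (T / n). The sentinels need a lower bound L of the matrix,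
  computed from the input, and raise the bound on the integers from U to U + 1.\<close>

datatype aexp = N int | V reg | B binop aexp aexp | D aexp

fun aval :: "aexp \<Rightarrow> state \<Rightarrow> int" where
  "aval (N k) s = k"
| "aval (V x) s = fst s x"
| "aval (B f a b) s = apply_op f (aval a s) (aval b s)"
| "aval (D a) s = snd s (aval a s)"

text \<open>The machine gets stuck only on constants and on results of operations, so a load needs
  no bound on its result. A variable needs one, as it is copied by an operation.\<close>

fun safe :: "int \<Rightarrow> aexp \<Rightarrow> state \<Rightarrow> bool" where
  "safe W (N k) s \<longleftrightarrow> \<bar>k\<bar> \<le> W"
| "safe W (V x) s \<longleftrightarrow> \<bar>fst s x\<bar> \<le> W"
| "safe W (B f a b) s \<longleftrightarrow> safe W a s \<and> safe W b s \<and> \<bar>apply_op f (aval a s) (aval b s)\<bar> \<le> W"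
| "safe W (D a) s \<longleftrightarrow> safe W a s"

fun acost :: "aexp \<Rightarrow> nat" where
  "acost (N k) = 1"
| "acost (V x) = 1"
| "acost (B f a b) = acost a + acost b + 1"
| "acost (D a) = acost a + 1"

fun avars :: "aexp \<Rightarrow> reg set" where
  "avars (N k) = {}"
| "avars (V x) = {x}"
| "avars (B f a b) = avars a \<union> avars b"
| "avars (D a) = avars a"

text \<open>Registers from \<open>d\<close> on serve as the evaluation stack. The machine has no
  move instruction, so a register is copied as the bitwise or of its content with itself.\<close>

fun acomp :: "reg \<Rightarrow> aexp \<Rightarrow> com" where
  "acomp d (N k) = Const d k"
| "acomp d (V x) = Op OpOr d x x"
| "acomp d (B f a b) = Seq (acomp d a) (Seq (acomp (Suc d) b) (Op f d d (Suc d)))"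
| "acomp d (D a) = Seq (acomp d a) (Load d d)"

definition agree :: "reg \<Rightarrow> (reg \<Rightarrow> int) \<Rightarrow> (reg \<Rightarrow> int) \<Rightarrow> bool" where
  "agree d R S \<longleftrightarrow> (\<forall>r<d. R r = S r)"

lemma aval_agree: "avars e \<subseteq> {..<d} \<Longrightarrow> agree d R S \<Longrightarrow> aval e (R, H) = aval e (S, H)"
  by (induction e) (auto simp: agree_def)

lemma safe_agree: "avars e \<subseteq> {..<d} \<Longrightarrow> agree d R S \<Longrightarrow> safe W e (R, H) = safe W e (S, H)"
  by (induction e) (auto simp: agree_def aval_agree[of _ d R S])

lemma acomp_exec:
  "avars e \<subseteq> {..<d} \<Longrightarrow> safe W e (R, H) \<Longrightarrow>
     \<exists>R'. exec W (acomp d e) (R, H) (acost e) (R', H) \<and> R' d = aval e (R, H) \<and> agree d R' R"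
proof (induction e arbitrary: d R)
  case (N k)
  then show ?case
    using exec.Const[of k W d R H]
    by (intro exI[of _ "R(d := k)"]) (simp_all add: agree_def fun_upd_def)
next
  case (V x)
  then show ?case
    using exec.Op[of "R x" OpOr R x x W d H]
    by (intro exI[of _ "R(d := R x)"]) (simp_all add: agree_def fun_upd_def)
next
  case (B f a b)
  obtain R1 where R1: "exec W (acomp d a) (R, H) (acost a) (R1, H)" "R1 d = aval a (R, H)" "agree d R1 R"
    using B.IH(1)[of d R] B.prems by auto
  have b: "aval b (R1, H) = aval b (R, H)" "safe W b (R1, H)"
    using aval_agree[of b d R1 R H] safe_agree[of b d R1 R W H] B.prems R1(3) by auto
  have "avars b \<subseteq> {..<Suc d}" using B.prems by auto
  then obtain R2 where R2: "exec W (acomp (Suc d) b) (R1, H) (acost b) (R2, H)"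
      "R2 (Suc d) = aval b (R1, H)" "agree (Suc d) R2 R1"
    using B.IH(2)[of "Suc d" R1] b by auto
  let ?x = "apply_op f (aval a (R, H)) (aval b (R, H))"
  have R2d: "R2 d = aval a (R, H)" using R2(3) R1(2) by (auto simp: agree_def)
  have "exec W (Op f d d (Suc d)) (R2, H) 1 (R2(d := ?x), H)"
    using R2d R2(2) b B.prems by (intro exec.Op) auto
  with R1(1) R2(1) have "exec W (acomp d (B f a b)) (R, H) (acost a + (acost b + 1)) (R2(d := ?x), H)"
    unfolding acomp.simps by (intro exec.Seq)
  moreover have "agree d (R2(d := ?x)) R"
    using R1(3) R2(3) by (auto simp: agree_def)
  ultimately show ?case by (intro exI[of _ "R2(d := ?x)"]) (simp add: add.assoc fun_upd_def)
next
  case (D a)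
  obtain R1 where R1: "exec W (acomp d a) (R, H) (acost a) (R1, H)" "R1 d = aval a (R, H)" "agree d R1 R"
    using D.IH[of d R] D.prems by auto
  have "exec W (Load d d) (R1, H) 1 (R1(d := H (R1 d)), H)" by (rule exec.Load)
  with R1(1) have "exec W (acomp d (D a)) (R, H) (acost a + 1) (R1(d := H (R1 d)), H)"
    unfolding acomp.simps by (rule exec.Seq)
  with R1 show ?case by (intro exI[of _ "R1(d := H (R1 d))"]) (auto simp: agree_def fun_upd_def)
qed

datatype hcom = HSkip | HSet reg aexp | HPut aexp aexp | HSeq hcom hcom (infixr \<open>;;\<close> 60)
  | HIf aexp hcom hcom | HWhile aexp hcom

text \<open>Each rule charges exactly the number of machine steps of the compiled code, so
  \<open>hcomp_exec\<close> transfers running times without a constant factor.\<close>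

inductive hexec :: "int \<Rightarrow> hcom \<Rightarrow> state \<Rightarrow> nat \<Rightarrow> state \<Rightarrow> bool" for W :: int where
  Skip: "hexec W HSkip s 1 s"
| Set: "safe W e s \<Longrightarrow> \<bar>aval e s\<bar> \<le> W \<Longrightarrow>
    hexec W (HSet x e) s (acost e + 1) ((fst s)(x := aval e s), snd s)"
| Put: "safe W a s \<Longrightarrow> safe W e s \<Longrightarrow>
    hexec W (HPut a e) s (acost a + acost e + 1) (fst s, (snd s)(aval a s := aval e s))"
| Seq: "hexec W c1 s1 t1 s2 \<Longrightarrow> hexec W c2 s2 t2 s3 \<Longrightarrow> hexec W (c1 ;; c2) s1 (t1 + t2) s3"
| IfTrue: "safe W e s \<Longrightarrow> aval e s \<noteq> 0 \<Longrightarrow> hexec W c1 s t s' \<Longrightarrow>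
    hexec W (HIf e c1 c2) s (acost e + Suc t) s'"
| IfFalse: "safe W e s \<Longrightarrow> aval e s = 0 \<Longrightarrow> hexec W c2 s t s' \<Longrightarrow>
    hexec W (HIf e c1 c2) s (acost e + Suc t) s'"
| WhileFalse: "safe W e s \<Longrightarrow> aval e s = 0 \<Longrightarrow> hexec W (HWhile e c) s (acost e + 1) s"
| WhileTrue: "safe W e s1 \<Longrightarrow> aval e s1 \<noteq> 0 \<Longrightarrow> hexec W c s1 t1 s2 \<Longrightarrow>
    hexec W (HWhile e c) s2 t2 s3 \<Longrightarrow> hexec W (HWhile e c) s1 (acost e + 1 + t1 + t2) s3"

fun hvars :: "hcom \<Rightarrow> reg set" where
  "hvars HSkip = {}"
| "hvars (HSet x e) = insert x (avars e)"
| "hvars (HPut a e) = avars a \<union> avars e"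
| "hvars (c1 ;; c2) = hvars c1 \<union> hvars c2"
| "hvars (HIf e c1 c2) = avars e \<union> hvars c1 \<union> hvars c2"
| "hvars (HWhile e c) = avars e \<union> hvars c"

text \<open>\<open>While\<close> tests a register and not an expression. The test is therefore
  compiled twice, before the loop and at the end of its body.\<close>

fun hcomp :: "reg \<Rightarrow> hcom \<Rightarrow> com" where
  "hcomp d HSkip = Skip"
| "hcomp d (HSet x e) = Seq (acomp d e) (Op OpOr x d d)"
| "hcomp d (HPut a e) = Seq (acomp d a) (Seq (acomp (Suc d) e) (Store d (Suc d)))"
| "hcomp d (c1 ;; c2) = Seq (hcomp d c1) (hcomp d c2)"
| "hcomp d (HIf e c1 c2) = Seq (acomp d e) (If d (hcomp d c1) (hcomp d c2))"
| "hcomp d (HWhile e c) = Seq (acomp d e) (While d (Seq (hcomp d c) (acomp d e)))"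

text \<open>\<open>agree d\<close> leaves the registers from \<open>d\<close> on open: they hold
  debris of evaluated expressions, and compiled code writes such a register before reading
  it.\<close>

lemma hcomp_exec:
  assumes "hexec W c s t s'" "hvars c \<subseteq> {..<d}" "agree d R (fst s)"
  shows "\<exists>R'. exec W (hcomp d c) (R, snd s) t (R', snd s') \<and> agree d R' (fst s')"
  using assms
proof (induction arbitrary: R rule: hexec.induct)
  case (Skip s)
  then show ?case using exec.Skip[of W "(R, snd s)"] by auto
next
  case (Set e s x)
  obtain S H where s: "s = (S, H)" by (cases s)
  have e: "avars e \<subseteq> {..<d}" and x: "x < d" using Set.prems by auto
  have ev: "aval e (R, H) = aval e (S, H)" "safe W e (R, H)"
    using aval_agree[OF e, of R S H] safe_agree[OF e, of R S W H] Set s by auto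
  obtain R1 where R1: "exec W (acomp d e) (R, H) (acost e) (R1, H)" "R1 d = aval e (R, H)" "agree d R1 R"
    using acomp_exec[OF e ev(2)] by auto
  have "exec W (Op OpOr x d d) (R1, H) 1 (R1(x := R1 d), H)"
    using Set.hyps s R1 ev by (intro exec.Op) auto
  with R1(1) have "exec W (hcomp d (HSet x e)) (R, H) (acost e + 1) (R1(x := R1 d), H)"
    unfolding hcomp.simps by (rule exec.Seq)
  moreover have "agree d (R1(x := R1 d)) (S(x := aval e (S, H)))"
    using R1 ev Set.prems s by (auto simp: agree_def)
  ultimately show ?case unfolding s fst_conv snd_conv by blast
next
  case (Put a s e)
  obtain S H where s: "s = (S, H)" by (cases s)
  have a: "avars a \<subseteq> {..<d}" and e: "avars e \<subseteq> {..<d}" and e': "avars e \<subseteq> {..<Suc d}"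
    using Put.prems by auto
  have av: "aval a (R, H) = aval a (S, H)" "safe W a (R, H)"
    using aval_agree[OF a, of R S H] safe_agree[OF a, of R S W H] Put s by auto
  obtain R1 where R1: "exec W (acomp d a) (R, H) (acost a) (R1, H)" "R1 d = aval a (R, H)" "agree d R1 R"
    using acomp_exec[OF a av(2)] by auto
  have R1S: "agree d R1 S" using R1 Put.prems s by (auto simp: agree_def)
  have ev: "aval e (R1, H) = aval e (S, H)" "safe W e (R1, H)"
    using aval_agree[OF e R1S, of H] safe_agree[OF e R1S, of W H] Put s by auto
  obtain R2 where R2: "exec W (acomp (Suc d) e) (R1, H) (acost e) (R2, H)"
      "R2 (Suc d) = aval e (R1, H)" "agree (Suc d) R2 R1"
    using acomp_exec[OF e' ev(2)] by auto
  have "R2 d = aval a (S, H)" using R2 R1 av by (auto simp: agree_def)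
  with R2(2) ev(1) have "exec W (Store d (Suc d)) (R2, H) 1 (R2, H(aval a (S, H) := aval e (S, H)))"
    using exec.Store[of W d "Suc d" R2 H] by simp
  with R1(1) R2(1) have "exec W (hcomp d (HPut a e)) (R, H) (acost a + (acost e + 1))
      (R2, H(aval a (S, H) := aval e (S, H)))"
    unfolding hcomp.simps by (intro exec.Seq)
  moreover have "agree d R2 S" using R2(3) R1S by (auto simp: agree_def)
  ultimately show ?case unfolding s fst_conv snd_conv add.assoc by blast
next
  case (Seq c1 s1 t1 s2 c2 t2 s3)
  then show ?case by (fastforce intro: exec.Seq)
next
  case (IfTrue e s c1 t s' c2)
  obtain S H where s: "s = (S, H)" by (cases s)
  have e: "avars e \<subseteq> {..<d}" using IfTrue.prems by auto
  have ev: "aval e (R, H) = aval e (S, H)" "safe W e (R, H)"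
    using aval_agree[OF e, of R S H] safe_agree[OF e, of R S W H] IfTrue s by auto
  obtain R1 where R1: "exec W (acomp d e) (R, H) (acost e) (R1, H)" "R1 d = aval e (R, H)" "agree d R1 R"
    using acomp_exec[OF e ev(2)] by auto
  have "agree d R1 S" using R1 IfTrue.prems s by (auto simp: agree_def)
  then obtain R' where "exec W (hcomp d c1) (R1, H) t (R', snd s')" "agree d R' (fst s')"
    using IfTrue.IH[of R1] IfTrue.prems s by auto
  moreover have "fst (R1, H) d = aval e s" using R1 ev s by simp
  ultimately show ?case
    using exec.Seq[OF R1(1) exec.IfTrue] IfTrue.hyps(2) unfolding s hcomp.simps fst_conv snd_conv by metis
next
  case (IfFalse e s c2 t s' c1)
  obtain S H where s: "s = (S, H)" by (cases s)
  have e: "avars e \<subseteq> {..<d}" using IfFalse.prems by auto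
  have ev: "aval e (R, H) = aval e (S, H)" "safe W e (R, H)"
    using aval_agree[OF e, of R S H] safe_agree[OF e, of R S W H] IfFalse s by auto
  obtain R1 where R1: "exec W (acomp d e) (R, H) (acost e) (R1, H)" "R1 d = aval e (R, H)" "agree d R1 R"
    using acomp_exec[OF e ev(2)] by auto
  have "agree d R1 S" using R1 IfFalse.prems s by (auto simp: agree_def)
  then obtain R' where "exec W (hcomp d c2) (R1, H) t (R', snd s')" "agree d R' (fst s')"
    using IfFalse.IH[of R1] IfFalse.prems s by auto
  moreover have "fst (R1, H) d = aval e s" using R1 ev s by simp
  ultimately show ?case
    using exec.Seq[OF R1(1) exec.IfFalse] IfFalse.hyps(2) unfolding s hcomp.simps fst_conv snd_conv by metis
next
  case (WhileFalse e s c)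
  obtain S H where s: "s = (S, H)" by (cases s)
  have e: "avars e \<subseteq> {..<d}" using WhileFalse.prems by auto
  have ev: "aval e (R, H) = aval e (S, H)" "safe W e (R, H)"
    using aval_agree[OF e, of R S H] safe_agree[OF e, of R S W H] WhileFalse s by auto
  obtain R1 where R1: "exec W (acomp d e) (R, H) (acost e) (R1, H)" "R1 d = aval e (R, H)" "agree d R1 R"
    using acomp_exec[OF e ev(2)] by auto
  have "exec W (While d (Seq (hcomp d c) (acomp d e))) (R1, H) 1 (R1, H)"
    using R1 ev WhileFalse s by (intro exec.WhileFalse) auto
  then have "exec W (hcomp d (HWhile e c)) (R, H) (acost e + 1) (R1, H)"
    using R1(1) unfolding hcomp.simps by (intro exec.Seq)
  moreover have "agree d R1 S" using R1 WhileFalse.prems s by (auto simp: agree_def)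
  ultimately show ?case using s by auto
next
  case (WhileTrue e s1 c t1 s2 t2 s3)
  obtain S H where s: "s1 = (S, H)" by (cases s1)
  have e: "avars e \<subseteq> {..<d}" using WhileTrue.prems by auto
  have ev: "aval e (R, H) = aval e (S, H)" "safe W e (R, H)"
    using aval_agree[OF e, of R S H] safe_agree[OF e, of R S W H] WhileTrue s by auto
  obtain R1 where R1: "exec W (acomp d e) (R, H) (acost e) (R1, H)" "R1 d = aval e (R, H)" "agree d R1 R"
    using acomp_exec[OF e ev(2)] by auto
  have "agree d R1 S" using R1 WhileTrue.prems s by (auto simp: agree_def)
  then obtain R2 where R2: "exec W (hcomp d c) (R1, H) t1 (R2, snd s2)" "agree d R2 (fst s2)"
    using WhileTrue.IH(1)[of R1] WhileTrue.prems s by auto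
  obtain R3 where R3: "exec W (hcomp d (HWhile e c)) (R2, snd s2) t2 (R3, snd s3)" "agree d R3 (fst s3)"
    using WhileTrue.IH(2)[of R2] WhileTrue.prems R2 by auto
  \<comment> \<open>The remaining iterations form a run of the whole compiled loop, which begins
    with an evaluation of the test. Cut off, this evaluation becomes the end of the body just
    executed.\<close>
  from R3(1) obtain u1 u2 z where u: "exec W (acomp d e) (R2, snd s2) u1 z"
      "exec W (While d (Seq (hcomp d c) (acomp d e))) z u2 (R3, snd s3)" "t2 = u1 + u2"
    by (auto elim: exec.cases)
  have "exec W (Seq (hcomp d c) (acomp d e)) (R1, H) (t1 + u1) z"
    using R2(1) u(1) by (rule exec.Seq)
  then have "exec W (While d (Seq (hcomp d c) (acomp d e))) (R1, H) (Suc (t1 + u1 + u2)) (R3, snd s3)"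
    using u(2) R1 ev WhileTrue.hyps s by (intro exec.WhileTrue) auto
  then have "exec W (hcomp d (HWhile e c)) (R, H) (acost e + Suc (t1 + u1 + u2)) (R3, snd s3)"
    using R1(1) unfolding hcomp.simps by (intro exec.Seq)
  with R3 u(3) s show ?case by (auto simp: add.assoc)
qed

section \<open>Weakest preconditions that also record the running time\<close>

definition wp :: "int \<Rightarrow> hcom \<Rightarrow> state \<Rightarrow> (nat \<Rightarrow> state \<Rightarrow> bool) \<Rightarrow> bool" where
  "wp W c s Q \<longleftrightarrow> (\<exists>t s'. hexec W c s t s' \<and> Q t s')"

lemma wpI: "hexec W c s t s' \<Longrightarrow> Q t s' \<Longrightarrow> wp W c s Q"
  unfolding wp_def by blast

lemma wpE:
  assumes "wp W c s Q"
  obtains t s' where "hexec W c s t s'" "Q t s'"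
  using assms unfolding wp_def by blast

lemma wp_mono: "wp W c s P \<Longrightarrow> (\<And>t s'. P t s' \<Longrightarrow> Q t s') \<Longrightarrow> wp W c s Q"
  by (blast elim: wpE intro: wpI)

lemma wp_Skip: "wp W HSkip s Q \<longleftrightarrow> Q 1 s"
proof
  assume "wp W HSkip s Q"
  then show "Q 1 s" by (rule wpE) (erule hexec.cases; simp)
qed (rule wpI[OF hexec.Skip])

lemma wp_Set: "wp W (HSet x e) s Q \<longleftrightarrow>
    safe W e s \<and> \<bar>aval e s\<bar> \<le> W \<and> Q (acost e + 1) ((fst s)(x := aval e s), snd s)"
  (is "_ \<longleftrightarrow> ?r")
proof
  assume "wp W (HSet x e) s Q"
  then show ?r by (rule wpE) (erule hexec.cases; simp)
qed (auto intro: wpI[OF hexec.Set] simp del: add.commute One_nat_def)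

lemma wp_Put: "wp W (HPut a e) s Q \<longleftrightarrow>
    safe W a s \<and> safe W e s \<and> Q (acost a + acost e + 1) (fst s, (snd s)(aval a s := aval e s))"
  (is "_ \<longleftrightarrow> ?r")
proof
  assume "wp W (HPut a e) s Q"
  then show ?r by (rule wpE) (erule hexec.cases; simp)
qed (auto intro: wpI[OF hexec.Put])

lemma wp_Seq: "wp W (c1 ;; c2) s Q \<longleftrightarrow> wp W c1 s (\<lambda>t1 s1. wp W c2 s1 (\<lambda>t2 s2. Q (t1 + t2) s2))"
  (is "_ \<longleftrightarrow> ?r")
proof
  assume "wp W (c1 ;; c2) s Q"
  then show ?r by (rule wpE) (erule hexec.cases; simp; blast intro: wpI)
qed (blast elim: wpE intro: wpI hexec.Seq)

lemma wp_If: "wp W (HIf e c1 c2) s Q \<longleftrightarrow> safe W e s \<and>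
    (aval e s \<noteq> 0 \<longrightarrow> wp W c1 s (\<lambda>t. Q (acost e + Suc t))) \<and>
    (aval e s = 0 \<longrightarrow> wp W c2 s (\<lambda>t. Q (acost e + Suc t)))" (is "_ \<longleftrightarrow> ?r")
proof
  assume "wp W (HIf e c1 c2) s Q"
  then show ?r by (rule wpE) (erule hexec.cases; simp; blast intro: wpI)
next
  assume ?r
  then show "wp W (HIf e c1 c2) s Q"
    by (cases "aval e s = 0") (blast elim: wpE intro: wpI hexec.IfTrue hexec.IfFalse)+
qed

lemma wp_While_unfold: "wp W (HWhile e c) s Q \<longleftrightarrow> safe W e s \<and>
    (aval e s = 0 \<longrightarrow> Q (acost e + 1) s) \<and> (aval e s \<noteq> 0 \<longrightarrow>
     wp W c s (\<lambda>t s'. wp W (HWhile e c) s' (\<lambda>t'. Q (acost e + 1 + t + t'))))"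
  (is "_ \<longleftrightarrow> ?r")
proof
  assume "wp W (HWhile e c) s Q"
  then obtain t s' where h: "hexec W (HWhile e c) s t s'" "Q t s'" by (rule wpE)
  from h(1) show ?r
  proof (cases rule: hexec.cases)
    case WhileFalse
    then show ?thesis using h(2) by simp
  next
    case (WhileTrue t1 s2 t2)
    then show ?thesis using h(2) by (auto intro!: wpI[OF WhileTrue(4)] wpI[OF WhileTrue(5)])
  qed
next
  assume ?r
  then show "wp W (HWhile e c) s Q"
    by (cases "aval e s = 0") (blast elim: wpE intro: wpI hexec.WhileTrue hexec.WhileFalse)+
qed

text \<open>For the loop over levels, whose number of iterations is not known in advance.
  \<open>T\<close> is the time spent so far, so the invariant can carry an amortized bound on
  it.\<close>

lemma wp_While_measure:
  assumes "Inv T s"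
    and "\<And>T s. Inv T s \<Longrightarrow> safe W e s"
    and "\<And>T s. Inv T s \<Longrightarrow> aval e s \<noteq> 0 \<Longrightarrow>
      wp W c s (\<lambda>t s'. Inv (T + acost e + 1 + t) s' \<and> (m s' :: nat) < m s)"
    and "\<And>T s. Inv T s \<Longrightarrow> aval e s = 0 \<Longrightarrow> Q (T + acost e + 1) s"
  shows "wp W (HWhile e c) s (\<lambda>t s'. Q (T + t) s')"
  using assms(1)
proof (induction "m s" arbitrary: T s rule: less_induct)
  case less
  show ?case
  proof (cases "aval e s = 0")
    case True
    then show ?thesis using assms(2,4)[OF less.prems] by (subst wp_While_unfold) (simp add: add.assoc)
  next
    case False
    from assms(3)[OF less.prems False]
    have "wp W c s (\<lambda>t s'. wp W (HWhile e c) s' (\<lambda>t' s''. Q (T + acost e + 1 + t + t') s''))"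
      by (rule wp_mono) (blast intro: less.hyps)
    then show ?thesis using assms(2)[OF less.prems] False
      by (subst wp_While_unfold) (simp add: add.assoc)
  qed
qed

text \<open>For a known number \<open>m\<close> of iterations of varying cost; the invariant sees
  the accumulated time.\<close>

lemma wp_While_count:
  assumes "Inv 0 0 s"
    and "\<And>i T s. i \<le> m \<Longrightarrow> Inv i T s \<Longrightarrow> safe W e s \<and> (aval e s \<noteq> 0 \<longleftrightarrow> i < m)"
    and "\<And>i T s. i < m \<Longrightarrow> Inv i T s \<Longrightarrow> wp W c s (\<lambda>t s'. Inv (Suc i) (T + acost e + 1 + t) s')"
    and "\<And>T s. Inv m T s \<Longrightarrow> Q (T + acost e + 1) s"
  shows "wp W (HWhile e c) s Q"
proof -
  have "wp W (HWhile e c) s (\<lambda>t. Q (T + t))" if "Inv i T s" "i \<le> m" for i T s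
    using that
  proof (induction "m - i" arbitrary: i T s)
    case 0
    then have "i = m" by simp
    then show ?case using assms(2)[of i T s] assms(4)[of T s] 0
      by (subst wp_While_unfold) (simp add: add.assoc)
  next
    case (Suc x)
    then have i: "i < m" by simp
    from assms(3)[OF i Suc.prems(1)]
    have "wp W c s (\<lambda>t s'. wp W (HWhile e c) s' (\<lambda>t' s''. Q (T + acost e + 1 + t + t') s''))"
    proof (rule wp_mono)
      show "wp W (HWhile e c) s' (\<lambda>t' s''. Q (T + acost e + 1 + t + t') s'')"
        if "Inv (Suc i) (T + acost e + 1 + t) s'" for t s'
        by (rule Suc.hyps(1)) (use Suc.hyps(2) i that in auto)
    qed
    then show ?case using assms(2)[of i T s] Suc.prems i
      by (subst wp_While_unfold) (simp add: add.assoc)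
  qed
  from this[OF assms(1)] show ?thesis by simp
qed

text \<open>With a uniform bound \<open>b\<close> per iteration the invariant need not mention time.
  The factor \<open>m + 1\<close> pays for the last, failing test.\<close>

lemma wp_While_for:
  assumes "Inv 0 s"
    and "\<And>i s. i \<le> m \<Longrightarrow> Inv i s \<Longrightarrow> safe W e s \<and> (aval e s \<noteq> 0 \<longleftrightarrow> i < m)"
    and "\<And>i s. i < m \<Longrightarrow> Inv i s \<Longrightarrow> wp W c s (\<lambda>t s'. t \<le> b \<and> Inv (Suc i) s')"
    and "\<And>t s. Inv m s \<Longrightarrow> t \<le> (m + 1) * (b + acost e + 1) \<Longrightarrow> Q t s"
  shows "wp W (HWhile e c) s Q"
proof (rule wp_While_count[where m = m and Inv = "\<lambda>i T s. Inv i s \<and> T \<le> i * (b + acost e + 1)"])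
  show "wp W c s (\<lambda>t s'. Inv (Suc i) s' \<and> T + acost e + 1 + t \<le> Suc i * (b + acost e + 1))"
    if "i < m" "Inv i s \<and> T \<le> i * (b + acost e + 1)" for i T s
    using assms(3)[of i s] that by (auto elim!: wp_mono)
qed (use assms in auto)

lemmas wp_simps = wp_Skip wp_Set wp_Put wp_Seq wp_If

subsection \<open>Simulating an instance in its own memory cells\<close>

text \<open>
  Instance \<open>y\<close> keeps its memory word \<open>a\<close> at address \<open>cell y a\<close> and its register \<open>r\<close> at
  \<open>cell (y + 1) r\<close>, for even \<open>y\<close>. The map \<open>hex\<close> embeds the integers into the natural numbers
  (hexagonal numbers) and \<open>(x, y) \<mapsto> (x + y)\<^sup>2 + y\<close> is a pairing function. All cells have
  negative addresses, so they do not meet the input, the output and the arrays of the main program.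
\<close>
definition hex :: "int \<Rightarrow> int" where
  "hex a = a * (2 * a + 1)"

definition cell :: "int \<Rightarrow> int \<Rightarrow> int" where
  "cell y a = - ((hex a + y) * (hex a + y) + y) - 1"

lemma hex_nonneg: "0 \<le> hex a"
  unfolding hex_def by (cases "0 \<le> a") (auto simp: zero_le_mult_iff)

text \<open>The difference of two values factors as \<open>(a - b) * (2 * (a + b) + 1)\<close>, and
  the second factor is odd.\<close>

lemma hex_inject: "hex a = hex b \<longleftrightarrow> a = b"
proof
  assume "hex a = hex b"
  then have "(a - b) * (2 * (a + b) + 1) = 0" by (simp add: hex_def algebra_simps)
  moreover have "2 * (a + b) + 1 \<noteq> 0" by presburger
  ultimately show "a = b" by simp
qed simp

lemma hex_le:
  assumes "\<bar>a\<bar> \<le> A"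
  shows "hex a \<le> 2 * A * A + A"
proof -
  have "a * a \<le> A * A" using mult_mono[of "\<bar>a\<bar>" A "\<bar>a\<bar>" A] assms by simp
  then show ?thesis using assms by (simp add: hex_def algebra_simps)
qed

text \<open>The next square after u^2 is 2u + 1 away, which leaves room for an offset of at most
  u.\<close>

lemma pair_less:
  fixes u u' y y' :: int
  assumes "u < u'" "0 \<le> y" "y \<le> u" "0 \<le> y'"
  shows "u * u + y < u' * u' + y'"
proof -
  have "(u + 1) * (u + 1) \<le> u' * u'" using assms by (intro mult_mono) auto
  then show ?thesis using assms by (simp add: algebra_simps)
qed

text \<open>With u = hex a + y the offset y is at most u. Hence u^2 + y determines u, then y, and
  then \<open>a\<close> by \<open>hex_inject\<close>.\<close>

lemma cell_inject:
  assumes "0 \<le> y" "0 \<le> y'"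
  shows "cell y a = cell y' a' \<longleftrightarrow> y = y' \<and> a = a'"
proof
  assume eq: "cell y a = cell y' a'"
  let ?u = "hex a + y" and ?u' = "hex a' + y'"
  have "?u = ?u'"
    using pair_less[of ?u ?u' y y'] pair_less[of ?u' ?u y' y] eq assms hex_nonneg[of a] hex_nonneg[of a']
    unfolding cell_def by (cases ?u ?u' rule: linorder_cases) linarith+
  with eq show "y = y' \<and> a = a'" by (simp add: cell_def hex_inject)
qed simp

lemma cell_neg: "0 \<le> y \<Longrightarrow> cell y a < 0"
  using zero_le_square[of "hex a + y"] unfolding cell_def by linarith

section \<open>Interpreting a machine program on the cells of one instance\<close>

abbreviation (input) "vN \<equiv> 0 :: reg"
abbreviation (input) "vI \<equiv> 4 :: reg"
abbreviation (input) "vC \<equiv> 2 :: reg"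
abbreviation (input) "vA \<equiv> 3 :: reg"

definition cellE :: "aexp \<Rightarrow> aexp \<Rightarrow> aexp" where
  "cellE h y = B OpSub (N 0) (B OpAdd (B OpMul (B OpAdd h y) (B OpAdd h y)) (B OpAdd y (N 1)))"

text \<open>A register number is known at compile time, so its \<open>hex\<close> is a constant of
  the program; only the instance number in \<open>vI\<close> is read at run time.\<close>

definition regE :: "reg \<Rightarrow> aexp" where
  "regE r = cellE (N (hex (int r))) (B OpAdd (V vI) (N 1))"

text \<open>The expression \<open>e\<close> is evaluated four times here. For this reason
  \<open>tr\<close> first moves a computed address to \<open>vA\<close>.\<close>

definition heapE :: "aexp \<Rightarrow> aexp" where
  "heapE e = cellE (B OpMul e (B OpAdd (B OpMul (N 2) e) (N 1))) (V vI)"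

definition tick :: hcom where
  "tick = HSet vC (B OpAdd (V vC) (N 1))"

text \<open>Every simulated step is counted in \<open>vC\<close> by exactly one \<open>tick\<close>.
  The one at the end of a loop body pays for the next test, so that together with the loop it forms
  the translated loop again.\<close>

fun tr :: "com \<Rightarrow> hcom" where
  "tr Skip = tick"
| "tr (Const r k) = tick ;; HPut (regE r) (N k)"
| "tr (Op f r a b) = tick ;; HPut (regE r) (B f (D (regE a)) (D (regE b)))"
| "tr (Load r a) = tick ;; HSet vA (D (regE a)) ;; HPut (regE r) (D (heapE (V vA)))"
| "tr (Store a r) = tick ;; HSet vA (D (regE a)) ;; HPut (heapE (V vA)) (D (regE r))"
| "tr (Seq c1 c2) = tr c1 ;; tr c2"
| "tr (If r c1 c2) = tick ;; HIf (D (regE r)) (tr c1) (tr c2)"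
| "tr (While r c) = tick ;; HWhile (D (regE r)) (tr c ;; tick)"

fun regs :: "com \<Rightarrow> reg set" where
  "regs Skip = {}"
| "regs (Const r k) = {r}"
| "regs (Op f r a b) = {r, a, b}"
| "regs (Load r a) = {r, a}"
| "regs (Store a r) = {r, a}"
| "regs (Seq c1 c2) = regs c1 \<union> regs c2"
| "regs (If r c1 c2) = insert r (regs c1 \<union> regs c2)"
| "regs (While r c) = insert r (regs c)"

lemma finite_regs: "finite (regs c)"
  by (induction c) auto

lemma avars_regE: "avars (regE r) = {vI}"
  by (simp add: regE_def cellE_def)

lemma avars_heapE: "avars (heapE e) = insert vI (avars e)"
  by (auto simp: heapE_def cellE_def)

lemma hvars_tr: "hvars (tr c) \<subseteq> {vI, vC, vA}"
  by (induction c) (auto simp: tick_def avars_regE avars_heapE)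

definition bdd :: "int \<Rightarrow> state \<Rightarrow> bool" where
  "bdd W s \<longleftrightarrow> (\<forall>r. \<bar>fst s r\<bar> \<le> W) \<and> (\<forall>a. \<bar>snd s a\<bar> \<le> W)"

text \<open>Constants and results are checked against \<open>W\<close>, while loads and stores only
  move words. This bounds the addresses that a simulated program can touch, hence the cells that it
  needs.\<close>

lemma exec_bdd: "exec W c s t s' \<Longrightarrow> bdd W s \<Longrightarrow> bdd W s'"
  by (induction rule: exec.induct) (auto simp: bdd_def)

text \<open>All registers and all addresses are related at once. The untouched ones agree because
  they are 0 on both sides at the start.\<close>

definition rel :: "int \<Rightarrow> state \<Rightarrow> (int \<Rightarrow> int) \<Rightarrow> bool" where
  "rel y s H \<longleftrightarrow> (\<forall>r. H (cell (y + 1) (int r)) = fst s r) \<and> (\<forall>a. H (cell y a) = snd s a)"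

definition foreign :: "int \<Rightarrow> int \<Rightarrow> bool" where
  "foreign y b \<longleftrightarrow> (\<forall>a. b \<noteq> cell y a) \<and> (\<forall>a. b \<noteq> cell (y + 1) a)"

lemma rel_put_reg: "0 \<le> y \<Longrightarrow> rel y (R, Hs) H \<Longrightarrow>
    rel y (R(r := x), Hs) (H(cell (y + 1) (int r) := x))"
  by (auto simp: rel_def cell_inject)

lemma rel_put_heap: "0 \<le> y \<Longrightarrow> rel y (R, Hs) H \<Longrightarrow> rel y (R, Hs(a := x)) (H(cell y a := x))"
  by (auto simp: rel_def cell_inject)

lemma not_foreign: "\<not> foreign y (cell y a)" "\<not> foreign y (cell (y + 1) a)"
  by (auto simp: foreign_def)

text \<open>\<open>W\<close> is the word bound of the simulated program and \<open>W'\<close> that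
  of the simulating one. \<open>A\<close> bounds addresses and register numbers, \<open>Y\<close>
  the instance numbers. The left side of \<open>cap\<close> is the absolute value of
  \<open>cell (Y + 1) A\<close>, the most distant cell.\<close>

locale cell_bounds =
  fixes W W' A Y :: int
  assumes WA: "0 \<le> W" "W \<le> A" and Y0: "0 \<le> Y"
    and cap: "(2 * A * A + A + Y + 1) * (2 * A * A + A + Y + 1) + Y + 2 \<le> W'"
begin

lemma A0: "0 \<le> A" using WA by simp

lemma Z_le: "2 * A * A + A + Y + 1 \<le> W'" "2 * A + 1 \<le> W'" "A \<le> W'" "Y + 2 \<le> W'" "W \<le> W'" "1 \<le> W'"
proof -
  have AA: "0 \<le> A * A" by simp
  let ?Z = "2 * A * A + A + Y + 1"
  have Z1: "1 \<le> ?Z" using AA A0 Y0 by simp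
  have "?Z * 1 \<le> ?Z * ?Z" using Z1 by (intro mult_left_mono) auto
  then show *: "?Z \<le> W'" using cap Y0 by simp
  have "A \<le> A * A"
  proof (cases "A = 0")
    case False
    then have "A * 1 \<le> A * A" using A0 by (intro mult_left_mono) auto
    then show ?thesis by simp
  qed simp
  then show "2 * A + 1 \<le> W'" using * A0 Y0 by simp
  then show "A \<le> W'" "W \<le> W'" using A0 WA by auto
  have "0 \<le> ?Z * ?Z" by simp
  then show "Y + 2 \<le> W'" using cap by linarith
  then show "1 \<le> W'" using Y0 by simp
qed

lemma cellE_ok:
  assumes "safe W' h s" "safe W' e s" "aval h s = hex a" "aval e s = y"
    and "\<bar>a\<bar> \<le> A" "0 \<le> y" "y \<le> Y + 1"
  shows "safe W' (cellE h e) s" "aval (cellE h e) s = cell y a"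
proof -
  let ?Z = "2 * A * A + A + Y + 1"
  let ?u = "hex a + y"
  have h: "0 \<le> hex a" "?u \<le> ?Z" using hex_nonneg[of a] hex_le[OF assms(5)] assms by auto
  have sq: "?u * ?u \<le> ?Z * ?Z" using h assms(6) by (intro mult_mono) auto
  have "0 \<le> ?u * ?u" by simp
  then have "\<bar>?u * ?u + (y + 1)\<bar> \<le> W'" "\<bar>?u * ?u\<bar> \<le> W'" "\<bar>0 - (?u * ?u + (y + 1))\<bar> \<le> W'"
    using sq cap assms(6,7) Y0 by linarith+
  moreover have "\<bar>hex a\<bar> \<le> W'" "\<bar>?u\<bar> \<le> W'" "\<bar>y + 1\<bar> \<le> W'" using h Z_le assms(6,7) Y0 by auto
  ultimately show "safe W' (cellE h e) s"
    using assms(1-4) Z_le unfolding cellE_def by (simp del: abs_of_nonneg)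
  show "aval (cellE h e) s = cell y a"
    using assms(3,4) by (simp add: cellE_def cell_def)
qed

lemma regE_ok:
  assumes "int r \<le> A" "R vI = y" "0 \<le> y" "y \<le> Y"
  shows "safe W' (regE r) (R, H)" "aval (regE r) (R, H) = cell (y + 1) (int r)"
  unfolding regE_def using assms Z_le hex_nonneg[of "int r"] hex_le[of "int r" A]
  by (auto intro!: cellE_ok[where a = "int r"])

lemma hexE_ok:
  assumes "\<bar>a\<bar> \<le> A"
  shows "\<bar>2 * a\<bar> \<le> W'" "\<bar>2 * a + 1\<bar> \<le> W'" "\<bar>a\<bar> \<le> W'"
  using assms Z_le by auto

lemma heapE_ok:
  assumes "safe W' e (R, H)" "\<bar>aval e (R, H)\<bar> \<le> A" "R vI = y" "0 \<le> y" "y \<le> Y"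
  shows "safe W' (heapE e) (R, H)" "aval (heapE e) (R, H) = cell y (aval e (R, H))"
proof -
  have "\<bar>hex (aval e (R, H))\<bar> \<le> W'"
    using Z_le Y0 hex_nonneg[of "aval e (R, H)"] hex_le[OF assms(2)] by auto
  then show "safe W' (heapE e) (R, H)" "aval (heapE e) (R, H) = cell y (aval e (R, H))"
    unfolding heapE_def using assms Z_le Y0 hexE_ok[OF assms(2)]
    by (auto intro!: cellE_ok[where a = "aval e (R, H)"] simp: hex_def)
qed

lemma acost_regE: "acost (regE r) = 19" by (simp add: regE_def cellE_def)
lemma acost_heapE: "acost (heapE (V x)) = 25" by (simp add: heapE_def cellE_def)

text \<open>The most expensive instructions, \<open>Load\<close> and \<open>Store\<close>, are
  simulated in 71 steps; 100 is a round bound.\<close>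

definition simpost :: "int \<Rightarrow> state \<Rightarrow> nat \<Rightarrow> state \<Rightarrow> nat \<Rightarrow> state \<Rightarrow> bool" where
  "simpost y s' t s0 \<tau> s1 \<longleftrightarrow> \<tau> \<le> 100 * t \<and> fst s1 vC = fst s0 vC + int t \<and>
     (\<forall>r. r \<notin> {vC, vA} \<longrightarrow> fst s1 r = fst s0 r) \<and> rel y s' (snd s1) \<and>
     (\<forall>b. foreign y b \<longrightarrow> snd s1 b = snd s0 b)"

text \<open>Induction on the simulated run. By \<open>exec_bdd\<close> all register contents stay
  below \<open>W\<close>, so every address in use has a cell whose address is an admissible
  word.\<close>

lemma tr_sim:
  assumes "exec W c s t s'" "bdd W s" "\<forall>r\<in>regs c. int r \<le> A" "0 \<le> y" "y \<le> Y"
    and "rel y s H" "R vI = y" "0 \<le> R vC" "R vC + int t \<le> W'"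
  shows "wp W' (tr c) (R, H) (simpost y s' t (R, H))"
  using assms(1-3,6-9)
proof (induction arbitrary: R H rule: exec.induct)
  case (Skip s)
  then show ?case using Z_le by (simp add: tick_def wp_simps simpost_def)
next
  case (Const k r R0 H0)
  have "int r \<le> A" "\<bar>k\<bar> \<le> W'" "\<bar>R vC\<bar> \<le> W'" "\<bar>R vC + 1\<bar> \<le> W'" "(R(vC := R vC + 1)) vI = y"
    using Const Z_le by auto
  moreover note rel_put_reg[OF \<open>0 \<le> y\<close> Const.prems(3), of r k]
    regE_ok[of r "R(vC := R vC + 1)" y H, OF this(1,5) \<open>0 \<le> y\<close> \<open>y \<le> Y\<close>]
  ultimately show ?case using Z_le(6)
    by (simp add: tick_def wp_simps simpost_def acost_regE not_foreign)
next
  case (Op x f R0 a b r H0)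
  let ?R = "R(vC := R vC + 1)"
  have "int r \<le> A" "int a \<le> A" "int b \<le> A" "\<bar>x\<bar> \<le> W'" "\<bar>R vC\<bar> \<le> W'" "\<bar>R vC + 1\<bar> \<le> W'" "?R vI = y"
    using Op Z_le by auto
  moreover note rel_put_reg[OF \<open>0 \<le> y\<close> Op.prems(3), of r x]
    regE_ok[of r ?R y H, OF this(1,7) \<open>0 \<le> y\<close> \<open>y \<le> Y\<close>]
    regE_ok[of a ?R y H, OF this(2,7) \<open>0 \<le> y\<close> \<open>y \<le> Y\<close>]
    regE_ok[of b ?R y H, OF this(3,7) \<open>0 \<le> y\<close> \<open>y \<le> Y\<close>]
  moreover have "H (cell (y + 1) (int a)) = R0 a" "H (cell (y + 1) (int b)) = R0 b"
    using Op.prems by (auto simp: rel_def)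
  ultimately show ?case using Z_le(6) Op.hyps(1)
    by (simp add: tick_def wp_simps simpost_def acost_regE not_foreign)
next
  case (Load r a R0 H0)
  let ?R = "R(vC := R vC + 1)" and ?R2 = "R(vC := R vC + 1, vA := R0 a)"
  have v: "H (cell (y + 1) (int a)) = R0 a" "H (cell y (R0 a)) = H0 (R0 a)" and b: "\<bar>R0 a\<bar> \<le> A"
    using Load.prems WA by (auto simp: rel_def bdd_def intro: order_trans)
  have "int r \<le> A" "int a \<le> A" "\<bar>R vC\<bar> \<le> W'" "\<bar>R vC + 1\<bar> \<le> W'" "?R vI = y" "?R2 vI = y"
      "safe W' (V vA) (?R2, H)" "\<bar>aval (V vA) (?R2, H)\<bar> \<le> A" "\<bar>R0 a\<bar> \<le> W'"
    using Load b Z_le by auto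
  moreover note rel_put_reg[OF \<open>0 \<le> y\<close> Load.prems(3), of r "H0 (R0 a)"]
    regE_ok[of a ?R y H, OF this(2,5) \<open>0 \<le> y\<close> \<open>y \<le> Y\<close>]
    regE_ok[of r ?R2 y H, OF this(1,6) \<open>0 \<le> y\<close> \<open>y \<le> Y\<close>]
    heapE_ok[of "V vA" ?R2 H y, OF this(7,8,6) \<open>0 \<le> y\<close> \<open>y \<le> Y\<close>]
  ultimately show ?case using Z_le(6) v
    by (simp add: tick_def wp_simps simpost_def acost_regE acost_heapE not_foreign)
next
  case (Store a r R0 H0)
  let ?R = "R(vC := R vC + 1)" and ?R2 = "R(vC := R vC + 1, vA := R0 a)"
  have v: "H (cell (y + 1) (int a)) = R0 a" "H (cell (y + 1) (int r)) = R0 r" and b: "\<bar>R0 a\<bar> \<le> A"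
    using Store.prems WA by (auto simp: rel_def bdd_def intro: order_trans)
  have "int r \<le> A" "int a \<le> A" "\<bar>R vC\<bar> \<le> W'" "\<bar>R vC + 1\<bar> \<le> W'" "?R vI = y" "?R2 vI = y"
      "safe W' (V vA) (?R2, H)" "\<bar>aval (V vA) (?R2, H)\<bar> \<le> A" "\<bar>R0 a\<bar> \<le> W'"
    using Store b Z_le by auto
  moreover note rel_put_heap[OF \<open>0 \<le> y\<close> Store.prems(3), of "R0 a" "R0 r"]
    regE_ok[of a ?R y H, OF this(2,5) \<open>0 \<le> y\<close> \<open>y \<le> Y\<close>]
    regE_ok[of r ?R2 y H, OF this(1,6) \<open>0 \<le> y\<close> \<open>y \<le> Y\<close>]
    heapE_ok[of "V vA" ?R2 H y, OF this(7,8,6) \<open>0 \<le> y\<close> \<open>y \<le> Y\<close>]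
  ultimately show ?case using Z_le(6) v
    by (simp add: tick_def wp_simps simpost_def acost_regE acost_heapE not_foreign)
next
  case (Seq c1 s1 t1 s2 c2 t2 s3)
  have 1: "wp W' (tr c1) (R, H) (simpost y s2 t1 (R, H))"
    using Seq.prems by (intro Seq.IH(1)) auto
  show ?case unfolding tr.simps wp_Seq
  proof (rule wp_mono[OF 1])
    fix \<tau>1 p assume p: "simpost y s2 t1 (R, H) \<tau>1 p"
    obtain R1 H1 where p': "p = (R1, H1)" by (cases p)
    have "wp W' (tr c2) (R1, H1) (simpost y s3 t2 (R1, H1))"
      using Seq.prems p p' exec_bdd[OF Seq.hyps(1)]
      by (intro Seq.IH(2)) (auto simp: simpost_def)
    then show "wp W' (tr c2) p (\<lambda>\<tau>2. simpost y s3 (t1 + t2) (R, H) (\<tau>1 + \<tau>2))"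
      unfolding p' by (rule wp_mono) (use p p' in \<open>auto simp: simpost_def\<close>)
  qed
next
  case (IfTrue s r c1 t s' c2)
  let ?R = "R(vC := R vC + 1)"
  note k = regE_ok[of r ?R y H]
  have v: "H (cell (y + 1) (int r)) \<noteq> 0"
    using IfTrue by (auto simp: rel_def)
  have "wp W' (tr c1) (?R, H) (simpost y s' t (?R, H))"
    using IfTrue.prems by (intro IfTrue.IH) auto
  then have "wp W' (tr c1) (?R, H) (\<lambda>\<tau>. simpost y s' (Suc t) (R, H) (4 + (20 + Suc \<tau>)))"
    by (rule wp_mono) (auto simp: simpost_def)
  then show ?case using IfTrue.prems k v Z_le \<open>0 \<le> y\<close> \<open>y \<le> Y\<close>
    by (simp add: tick_def wp_simps acost_regE)
next
  case (IfFalse s r c2 t s' c1)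
  let ?R = "R(vC := R vC + 1)"
  note k = regE_ok[of r ?R y H]
  have v: "H (cell (y + 1) (int r)) = 0"
    using IfFalse by (auto simp: rel_def)
  have "wp W' (tr c2) (?R, H) (simpost y s' t (?R, H))"
    using IfFalse.prems by (intro IfFalse.IH) auto
  then have "wp W' (tr c2) (?R, H) (\<lambda>\<tau>. simpost y s' (Suc t) (R, H) (4 + (20 + Suc \<tau>)))"
    by (rule wp_mono) (auto simp: simpost_def)
  then show ?case using IfFalse.prems k v Z_le \<open>0 \<le> y\<close> \<open>y \<le> Y\<close>
    by (simp add: tick_def wp_simps acost_regE)
next
  case (WhileFalse s r c)
  let ?R = "R(vC := R vC + 1)"
  note k = regE_ok[of r ?R y H]
  have v: "H (cell (y + 1) (int r)) = 0"
    using WhileFalse by (auto simp: rel_def)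
  show ?case using WhileFalse.prems k v Z_le \<open>0 \<le> y\<close> \<open>y \<le> Y\<close>
    by (simp add: tick_def wp_Seq wp_Set wp_While_unfold[of _ _ _ "(?R, H)"] acost_regE simpost_def)
next
  case (WhileTrue s1 r c t1 s2 t2 s3)
  let ?R = "R(vC := R vC + 1)" and ?w = "HWhile (D (regE r)) (tr c ;; tick)"
  note k = regE_ok[of r ?R y H]
  have v: "H (cell (y + 1) (int r)) \<noteq> 0"
    using WhileTrue by (auto simp: rel_def)
  have 1: "wp W' (tr c) (?R, H) (simpost y s2 t1 (?R, H))"
    using WhileTrue.prems by (intro WhileTrue.IH(1)) auto
  have "wp W' (tr c ;; tick) (?R, H)
      (\<lambda>t s'. wp W' ?w s' (\<lambda>t'. simpost y s3 (Suc (t1 + t2)) (R, H) (4 + (20 + 1 + t + t'))))"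
    unfolding wp_Seq
  proof (rule wp_mono[OF 1])
    fix \<tau>1 p assume p: "simpost y s2 t1 (?R, H) \<tau>1 p"
    obtain R1 H1 where p': "p = (R1, H1)" by (cases p)
    \<comment> \<open>The final \<open>tick\<close> of the body and the rest of the loop together
      are \<open>tr (While r c)\<close>, to which the second induction hypothesis applies.\<close>
    have "wp W' (tr (While r c)) (R1, H1) (simpost y s3 t2 (R1, H1))"
      using WhileTrue.prems p p' exec_bdd[OF WhileTrue.hyps(2)]
      by (intro WhileTrue.IH(2)) (auto simp: simpost_def)
    then have "wp W' tick (R1, H1) (\<lambda>t s'. wp W' ?w s' (\<lambda>t'. simpost y s3 t2 (R1, H1) (t + t')))"
      by (simp add: wp_Seq)
    then show "wp W' tick p (\<lambda>ta s2. wp W' ?w s2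
         (\<lambda>t'. simpost y s3 (Suc (t1 + t2)) (R, H) (4 + (20 + 1 + (\<tau>1 + ta) + t'))))"
      unfolding p' by (elim wp_mono) (use p p' in \<open>auto simp: simpost_def\<close>)
  qed
  then show ?case using WhileTrue.prems k v Z_le \<open>0 \<le> y\<close> \<open>y \<le> Y\<close>
    by (simp add: tick_def wp_Seq wp_Set wp_While_unfold[of _ _ _ "(?R, H)"] acost_regE)
qed

end

subsection \<open>Sorting in time \<open>n powr 1.5\<close>\<close>

text \<open>\<open>vNN\<close> holds n^2, \<open>vq\<close> the block length for sorting,
  \<open>vB\<close> the offset of the row being sorted, \<open>vL\<close> a lower bound of the
  matrix, \<open>vINF\<close> a bound above all keys. \<open>vO\<close>, \<open>vRK\<close>,
  \<open>vF\<close>, \<open>vKy\<close>, \<open>vBm\<close> are the base addresses of orders, ranks,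
  first groups, keys and block minima. \<open>vS\<close> is the group size, \<open>vG\<close> the
  number of instances of a level, \<open>vbase\<close> the number of the first of them,
  \<open>vFr\<close> the flag that they are still to be built.\<close>

abbreviation (input) "vNN \<equiv> 5 :: reg"
abbreviation (input) "vq \<equiv> 6 :: reg"
abbreviation (input) "vL \<equiv> 7 :: reg"
abbreviation (input) "vO \<equiv> 8 :: reg"
abbreviation (input) "vRK \<equiv> 9 :: reg"
abbreviation (input) "vF \<equiv> 10 :: reg"
abbreviation (input) "vKy \<equiv> 11 :: reg"
abbreviation (input) "vBm \<equiv> 12 :: reg"
abbreviation (input) "vINF \<equiv> 13 :: reg"
abbreviation (input) "vB \<equiv> 14 :: reg"
abbreviation (input) "vk \<equiv> 15 :: reg"
abbreviation (input) "vt \<equiv> 16 :: reg"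
abbreviation (input) "vm \<equiv> 17 :: reg"
abbreviation (input) "vj \<equiv> 18 :: reg"
abbreviation (input) "vp \<equiv> 19 :: reg"
abbreviation (input) "vlen \<equiv> 20 :: reg"
abbreviation (input) "vS \<equiv> 21 :: reg"
abbreviation (input) "vFr \<equiv> 22 :: reg"
abbreviation (input) "vbase \<equiv> 23 :: reg"
abbreviation (input) "vDone \<equiv> 24 :: reg"
abbreviation (input) "vx \<equiv> 25 :: reg"
abbreviation (input) "vi \<equiv> 26 :: reg"
abbreviation (input) "vbest \<equiv> 27 :: reg"
abbreviation (input) "vG \<equiv> 28 :: reg"
abbreviation (input) "vg \<equiv> 29 :: reg"
abbreviation (input) "vka \<equiv> 30 :: reg"
abbreviation (input) "vy \<equiv> 31 :: reg"

abbreviation plusE (infixl \<open>[+]\<close> 65) where "a [+] b \<equiv> B OpAdd a b"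
abbreviation minusE (infixl \<open>[-]\<close> 65) where "a [-] b \<equiv> B OpSub a b"
abbreviation timesE (infixl \<open>[*]\<close> 70) where "a [*] b \<equiv> B OpMul a b"
abbreviation divE (infixl \<open>[div]\<close> 70) where "a [div] b \<equiv> B OpDiv a b"
abbreviation modE (infixl \<open>[mod]\<close> 70) where "a [mod] b \<equiv> B OpMod a b"
abbreviation lessE (infix \<open>[<]\<close> 50) where "a [<] b \<equiv> B OpLess a b"
abbreviation eqE (infix \<open>[=]\<close> 50) where "a [=] b \<equiv> B OpEq a b"
abbreviation incr where "incr x \<equiv> HSet x (V x [+] N 1)"

text \<open>\<open>c\<close> is the minimum of the empty range; entries equal to \<open>c\<close>
  act as absent.\<close>

definition is_min :: "int \<Rightarrow> (nat \<Rightarrow> int) \<Rightarrow> nat \<Rightarrow> int \<Rightarrow> bool" where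
  "is_min c f len m \<longleftrightarrow> m \<le> c \<and> (\<forall>j<len. m \<le> f j) \<and> (m = c \<or> (\<exists>j<len. m = f j))"

lemma is_min_0: "is_min c f 0 c"
  by (simp add: is_min_def)

lemma is_min_Suc: "is_min c f len m \<Longrightarrow> is_min c f (Suc len) (if f len < m then f len else m)"
  by (auto simp: is_min_def less_Suc_eq)

lemma is_min_cong: "(\<And>j. j < len \<Longrightarrow> f j = g j) \<Longrightarrow> is_min c f len m = is_min c g len m"
  by (auto simp: is_min_def)

definition minrange :: hcom where
  "minrange = HSet vm (V vINF) ;; HSet vj (N 0) ;;
    HWhile (V vj [<] V vlen)
     (HIf (D (V vp [+] V vj) [<] V vm) (HSet vm (D (V vp [+] V vj))) HSkip ;; incr vj)"

lemma minrange:
  assumes "R vINF = c" "R vp = p" "R vlen = int len" "0 \<le> p" "p + int len \<le> W" "\<bar>c\<bar> \<le> W"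
    and "\<And>j. j < len \<Longrightarrow> \<bar>H (p + int j)\<bar> \<le> W" "1 \<le> W"
  shows "wp W minrange (R, H) (\<lambda>t s'. t \<le> 40 * (len + 1) \<and> snd s' = H \<and>
    is_min c (\<lambda>j. H (p + int j)) len (fst s' vm) \<and> (\<forall>r. r \<notin> {vm, vj} \<longrightarrow> fst s' r = R r))"
proof -
  define Inv where "Inv i s \<longleftrightarrow> snd s = H \<and> fst s vj = int i \<and> is_min c (\<lambda>j. H (p + int j)) i (fst s vm) \<and>
     \<bar>fst s vm\<bar> \<le> W \<and> (\<forall>r. r \<notin> {vm, vj} \<longrightarrow> fst s r = R r)" for i s
  have "wp W (HWhile (V vj [<] V vlen)
     (HIf (D (V vp [+] V vj) [<] V vm) (HSet vm (D (V vp [+] V vj))) HSkip ;; incr vj))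
     (R(vm := c, vj := 0), H)
     (\<lambda>t s'. t \<le> (len + 1) * 24 \<and> Inv len s')"
  proof (rule wp_While_for[where Inv = Inv and m = len and b = 20])
    show "Inv 0 (R(vm := c, vj := 0), H)"
      using assms by (simp add: Inv_def is_min_0)
    show "safe W (V vj [<] V vlen) s \<and> (aval (V vj [<] V vlen) s \<noteq> 0 \<longleftrightarrow> i < len)"
      if "i \<le> len" "Inv i s" for i s
      using that assms by (simp add: Inv_def)
    show "wp W (HIf (D (V vp [+] V vj) [<] V vm) (HSet vm (D (V vp [+] V vj))) HSkip ;; incr vj) s
        (\<lambda>t s'. t \<le> 20 \<and> Inv (Suc i) s')" if "i < len" "Inv i s" for i s
      using that assms is_min_Suc[of c "\<lambda>j. H (p + int j)" i "fst s vm"]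
      by (simp add: Inv_def wp_simps split: if_splits)
  qed auto
  then show ?thesis
    unfolding minrange_def using assms
    by (simp add: wp_simps) (erule wp_mono, auto simp: Inv_def)
qed

section \<open>The key array and its block minima\<close>

definition keys :: hcom where
  "keys = HSet vk (N 0) ;;
    HWhile (V vk [<] V vN)
     (HSet vy (D (V vB [+] V vk) [*] V vN [+] V vk) ;;
      HPut (V vKy [+] V vk) (V vy) ;;
      HIf (V vy [<] V vINF) HSkip (HSet vINF (V vy [+] N 1)) ;;
      incr vk)"

definition pad :: hcom where
  "pad = HWhile (V vk [<] V vq [*] V vq) (HPut (V vKy [+] V vk) (V vINF) ;; incr vk)"

definition blockmins :: hcom where
  "blockmins = HSet vlen (V vq) ;; HSet vt (N 0) ;;
    HWhile (V vt [<] V vq)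
     (HSet vp (V vKy [+] V vt [*] V vq) ;; minrange ;; HPut (V vBm [+] V vt) (V vm) ;; incr vt)"

text \<open>The arrays follow the input, the query and the answer. Orders and ranks have n^2 + n
  entries: the query is stored right behind the matrix, so it is sorted like one more row, at offset
  \<open>nn\<close>. \<open>top\<close> also leaves room for the keys, which are of size about U *
  n.\<close>

locale layout =
  fixes n q U :: nat and W nn od rk F ky bm :: int
  assumes n0: "0 < n" and q0: "0 < q" and nq: "n \<le> q * q"
    and nn: "nn = int n * int n" and od: "od = nn + 2 * int n" and rk: "rk = od + nn + int n"
    and F: "F = rk + nn + int n" and ky: "ky = F + 2 * int n" and bm: "bm = ky + int q * int q"
    and top: "bm + int q + int U * int n + int n + 9 \<le> W"
begin

definition regsok :: "(reg \<Rightarrow> int) \<Rightarrow> bool" where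
  "regsok R \<longleftrightarrow> R vN = int n \<and> R vq = int q \<and> R vNN = nn \<and> R vO = od \<and> R vRK = rk \<and> R vF = F \<and>
     R vKy = ky \<and> R vBm = bm"

lemma sizes: "0 \<le> nn" "int n \<le> nn" "int n \<le> int q * int q" "0 \<le> int U * int n" "int q \<le> int q * int q"
  "int U \<le> int U * int n" "0 < int n" "0 < int q"
proof -
  show "0 \<le> nn" "0 \<le> int U * int n" "0 < int n" "0 < int q" using nn n0 q0 by auto
  show "int n \<le> int q * int q" using nq by (metis of_nat_le_iff of_nat_mult)
  have "n * 1 \<le> n * n" using n0 by (intro mult_le_mono) auto
  then show "int n \<le> nn" using nn by (metis mult.right_neutral of_nat_le_iff of_nat_mult)
  have "q * 1 \<le> q * q" using q0 by (intro mult_le_mono) auto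
  then show "int q \<le> int q * int q" by (metis mult.right_neutral of_nat_le_iff of_nat_mult)
  have "U * 1 \<le> U * n" using n0 by (intro mult_le_mono) auto
  then show "int U \<le> int U * int n" by (metis mult.right_neutral of_nat_le_iff of_nat_mult)
qed

lemma order: "nn + 2 * int n \<le> od" "od + nn + int n \<le> rk" "rk + nn + int n \<le> F"
  "F + 2 * int n \<le> ky" "ky + int q * int q \<le> bm"
  using od rk F ky bm by auto

lemmas lay = sizes order top

definition cap :: int where "cap = int U * int n + int n + 1"

lemma key_bound:
  assumes "\<bar>x\<bar> \<le> int U" "k < n"
  shows "\<bar>x * int n\<bar> \<le> int U * int n" "\<bar>x * int n + int k\<bar> < cap"
proof -
  show *: "\<bar>x * int n\<bar> \<le> int U * int n" using assms by (auto simp: abs_mult intro: mult_right_mono)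
  show "\<bar>x * int n + int k\<bar> < cap" using * assms(2) by (simp add: cap_def)
qed

text \<open>In \<open>a k * n + k\<close> the index can be recovered as the remainder mod n, and no
  two keys coincide. U is unknown to the program, so \<open>vINF\<close> is raised above each key as
  it appears, and is never lowered again.\<close>

lemma keys:
  assumes R: "regsok R" "R vB = b" "0 \<le> b" "b \<le> nn" and INF: "0 \<le> R vINF" "R vINF \<le> cap"
    and a: "\<And>k. k < n \<Longrightarrow> H (b + int k) = a k" "\<And>k. k < n \<Longrightarrow> \<bar>a k\<bar> \<le> int U"
  shows "wp W keys (R, H) (\<lambda>t s'. t \<le> 60 * (n + 1) \<and> fst s' vk = int n \<and>
     0 \<le> fst s' vINF \<and> fst s' vINF \<le> cap \<and> (\<forall>k<n. a k * int n + int k < fst s' vINF) \<and>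
     (\<forall>k<n. snd s' (ky + int k) = a k * int n + int k) \<and>
     (\<forall>x. x < ky \<or> ky + int n \<le> x \<longrightarrow> snd s' x = H x) \<and>
     (\<forall>r. r \<notin> {vk, vy, vINF} \<longrightarrow> fst s' r = R r))"
proof -
  define Inv where "Inv i s \<longleftrightarrow> fst s vk = int i \<and>
     0 \<le> fst s vINF \<and> fst s vINF \<le> cap \<and> (\<forall>k<i. a k * int n + int k < fst s vINF) \<and>
     (\<forall>k<i. snd s (ky + int k) = a k * int n + int k) \<and>
     (\<forall>x. x < ky \<or> ky + int i \<le> x \<longrightarrow> snd s x = H x) \<and>
     (\<forall>r. r \<notin> {vk, vy, vINF} \<longrightarrow> fst s r = R r)" for i s
  let ?body = "HSet vy (D (V vB [+] V vk) [*] V vN [+] V vk) ;;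
      HPut (V vKy [+] V vk) (V vy) ;;
      HIf (V vy [<] V vINF) HSkip (HSet vINF (V vy [+] N 1)) ;;
      incr vk"
  have "wp W (HWhile (V vk [<] V vN) ?body) (R(vk := 0), H) (\<lambda>t s'. t \<le> (n + 1) * 44 \<and> Inv n s')"
  proof (rule wp_While_for[where Inv = Inv and m = n and b = 40])
    show "Inv 0 (R(vk := 0), H)" using INF by (simp add: Inv_def)
    show "safe W (V vk [<] V vN) s \<and> (aval (V vk [<] V vN) s \<noteq> 0 \<longleftrightarrow> i < n)"
      if "i \<le> n" "Inv i s" for i s
      using that R lay by (simp add: Inv_def regsok_def)
    show "wp W ?body s (\<lambda>t s'. t \<le> 40 \<and> Inv (Suc i) s')" if "i < n" "Inv i s" for i s
    proof -
      obtain R' H' where s: "s = (R', H')" by (cases s)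
      have r: "R' vB = b" "R' vN = int n" "R' vKy = ky" "R' vk = int i" and Hb: "H' (b + int i) = a i"
        using that R a lay unfolding s by (auto simp: Inv_def regsok_def)
      have kb: "\<bar>a i * int n\<bar> \<le> int U * int n" "\<bar>a i * int n + int i\<bar> < cap"
        using key_bound[of "a i" i] a that by auto
      show ?thesis
        using that(2) r Hb kb R lay that(1) unfolding s
        by (auto simp: wp_simps Inv_def cap_def less_Suc_eq)
    qed
  qed auto
  then show ?thesis
    unfolding keys_def using lay
    by (simp add: wp_simps) (erule wp_mono, auto simp: Inv_def)
qed

text \<open>Filling up to q^2 entries gives q full blocks, so that no block has a length of its
  own.\<close>

lemma pad:
  assumes R: "regsok R" "R vk = int n" "0 \<le> R vINF" "R vINF \<le> cap"
  shows "wp W pad (R, H) (\<lambda>t s'. t \<le> 20 * (q * q + 1) \<and>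
     (\<forall>k. n \<le> k \<longrightarrow> k < q * q \<longrightarrow> snd s' (ky + int k) = R vINF) \<and>
     (\<forall>x. x < ky + int n \<or> ky + int q * int q \<le> x \<longrightarrow> snd s' x = H x) \<and>
     (\<forall>r. r \<notin> {vk} \<longrightarrow> fst s' r = R r))"
proof -
  define Inv where "Inv i s \<longleftrightarrow> fst s vk = int n + int i \<and>
     (\<forall>k. n \<le> k \<longrightarrow> k < n + i \<longrightarrow> snd s (ky + int k) = R vINF) \<and>
     (\<forall>x. x < ky + int n \<or> ky + int n + int i \<le> x \<longrightarrow> snd s x = H x) \<and>
     (\<forall>r. r \<notin> {vk} \<longrightarrow> fst s r = R r)" for i s
  obtain m where m: "q * q = n + m" using nq le_Suc_ex by blast
  then have im: "int q * int q = int n + int m" by (metis of_nat_add of_nat_mult)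
  show ?thesis unfolding pad_def
  proof (rule wp_While_for[where Inv = Inv and m = m and b = 12])
    show "Inv 0 (R, H)" using R by (simp add: Inv_def)
    show "safe W (V vk [<] V vq [*] V vq) s \<and> (aval (V vk [<] V vq [*] V vq) s \<noteq> 0 \<longleftrightarrow> i < m)"
      if "i \<le> m" "Inv i s" for i s
      using that R lay im by (auto simp: Inv_def regsok_def)
    show "wp W (HPut (V vKy [+] V vk) (V vINF) ;; incr vk) s (\<lambda>t s'. t \<le> 12 \<and> Inv (Suc i) s')"
      if "i < m" "Inv i s" for i s
    proof -
      obtain R' H' where s: "s = (R', H')" by (cases s)
      have r: "R' vKy = ky" "R' vk = int n + int i" "R' vINF = R vINF"
        using that R lay unfolding s by (auto simp: Inv_def regsok_def)
      show ?thesis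
        using that r R lay im unfolding s
        by (auto simp: wp_simps Inv_def cap_def less_Suc_eq)
    qed
    show "t \<le> 20 * (q * q + 1) \<and> (\<forall>k. n \<le> k \<longrightarrow> k < q * q \<longrightarrow> snd s (ky + int k) = R vINF) \<and>
     (\<forall>x. x < ky + int n \<or> ky + int q * int q \<le> x \<longrightarrow> snd s x = H x) \<and>
     (\<forall>r. r \<notin> {vk} \<longrightarrow> fst s r = R r)"
      if "Inv m s" "t \<le> (m + 1) * (12 + acost (V vk [<] V vq [*] V vq) + 1)" for t s
    proof -
      have "t \<le> 18 * (m + 1)" using that(2) by simp
      then have "t \<le> 20 * (q * q + 1)" unfolding m by simp
      moreover have "ky + int n + int m = ky + int q * int q" using im by linarith
      ultimately show ?thesis using that(1) m unfolding Inv_def by metis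
    qed
  qed
qed

lemma block_index:
  assumes "\<beta> < q" "j < q"
  shows "\<beta> * q + j < q * q" "(\<beta> * q + j) div q = \<beta>" "(\<beta> * q + j) mod q = j"
    "int \<beta> * int q + int q \<le> int q * int q"
proof -
  have "(\<beta> + 1) * q \<le> q * q" using assms by (intro mult_le_mono) auto
  then show "\<beta> * q + j < q * q" using assms by simp
  have "(int \<beta> + 1) * int q \<le> int q * int q" using assms by (intro mult_right_mono) auto
  then show "int \<beta> * int q + int q \<le> int q * int q" by (simp add: algebra_simps)
qed (use assms in auto)

lemma block_of:
  assumes "k < q * q"
  shows "k div q < q" "k div q * q + k mod q = k" "k mod q < q"
  using assms q0 by (auto simp: less_mult_imp_div_less)

lemma blockmins:
  assumes R: "regsok R" "0 \<le> R vINF" "R vINF \<le> cap"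
    and K: "\<And>k. k < q * q \<Longrightarrow> H (ky + int k) = K k" "\<And>k. k < q * q \<Longrightarrow> \<bar>K k\<bar> \<le> cap"
  shows "wp W blockmins (R, H) (\<lambda>t s'. t \<le> 100 * ((q + 1) * (q + 1)) \<and> fst s' vlen = int q \<and>
     (\<forall>\<beta><q. is_min (R vINF) (\<lambda>j. K (\<beta> * q + j)) q (snd s' (bm + int \<beta>))) \<and>
     (\<forall>x. x < bm \<or> bm + int q \<le> x \<longrightarrow> snd s' x = H x) \<and>
     (\<forall>r. r \<notin> {vlen, vt, vp, vm, vj} \<longrightarrow> fst s' r = R r))"
proof -
  define Inv where "Inv i s \<longleftrightarrow> fst s vlen = int q \<and> fst s vt = int i \<and>
     (\<forall>\<beta><i. is_min (R vINF) (\<lambda>j. K (\<beta> * q + j)) q (snd s (bm + int \<beta>))) \<and>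
     (\<forall>x. x < bm \<or> bm + int i \<le> x \<longrightarrow> snd s x = H x) \<and>
     (\<forall>r. r \<notin> {vlen, vt, vp, vm, vj} \<longrightarrow> fst s r = R r)" for i s
  let ?body = "HSet vp (V vKy [+] V vt [*] V vq) ;; minrange ;; HPut (V vBm [+] V vt) (V vm) ;; incr vt"
  have "wp W (HWhile (V vt [<] V vq) ?body) (R(vlen := int q, vt := 0), H)
      (\<lambda>t s'. t \<le> (q + 1) * (40 * (q + 1) + 40 + 4) \<and> Inv q s')"
  proof (rule wp_While_for[where Inv = Inv and m = q and b = "40 * (q + 1) + 40"])
    show "Inv 0 (R(vlen := int q, vt := 0), H)" using R by (simp add: Inv_def)
    show "safe W (V vt [<] V vq) s \<and> (aval (V vt [<] V vq) s \<noteq> 0 \<longleftrightarrow> i < q)"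
      if "i \<le> q" "Inv i s" for i s
      using that R lay by (simp add: Inv_def regsok_def)
    show "wp W ?body s (\<lambda>t s'. t \<le> 40 * (q + 1) + 40 \<and> Inv (Suc i) s')" if "i < q" "Inv i s" for i s
    proof -
      obtain R' H' where s: "s = (R', H')" by (cases s)
      have r: "R' vKy = ky" "R' vBm = bm" "R' vt = int i" "R' vINF = R vINF" "R' vq = int q" "R' vlen = int q"
        using that R lay unfolding s by (auto simp: Inv_def regsok_def)
      have bi: "int i * int q + int q \<le> int q * int q" "0 \<le> int i * int q" using block_index[OF that(1) q0] by auto
      have HK: "H' (ky + int i * int q + int j) = K (i * q + j)" if "j < q" for j
      proof -
        have lt: "i * q + j < q * q" using block_index[OF \<open>i < q\<close> that] by simp
        have "int i * int q + int j < int q * int q" using bi that by linarith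
        then have "H' (ky + int i * int q + int j) = H (ky + int (i * q + j))"
          using \<open>Inv i s\<close> lay unfolding s Inv_def by (simp add: add.assoc)
        then show ?thesis using K(1)[OF lt] by simp
      qed
      have Kb: "\<bar>K (i * q + j)\<bar> \<le> W" if "j < q" for j
        using K(2)[of "i * q + j"] block_index[OF \<open>i < q\<close> that] lay by (simp add: cap_def)
      have 1: "wp W minrange (R'(vp := ky + int i * int q), H') (\<lambda>t s'. t \<le> 40 * (q + 1) \<and> snd s' = H' \<and>
        is_min (R vINF) (\<lambda>j. H' (ky + int i * int q + int j)) q (fst s' vm) \<and>
        (\<forall>r. r \<notin> {vm, vj} \<longrightarrow> fst s' r = (R'(vp := ky + int i * int q)) r))"
        using r bi lay R HK Kb by (intro minrange) (auto simp: cap_def)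
      have 2: "wp W minrange (R'(vp := ky + int i * int q), H') (\<lambda>t1 s1.
         wp W (HPut (V vBm [+] V vt) (V vm) ;; incr vt) s1
          (\<lambda>t2 s2. 6 + (t1 + t2) \<le> 40 * (q + 1) + 40 \<and> Inv (Suc i) s2))"
      proof (rule wp_mono[OF 1], elim conjE)
        fix t1 s1 assume t1: "t1 \<le> 40 * (q + 1)" and s1: "snd s1 = H'"
          and m: "is_min (R vINF) (\<lambda>j. H' (ky + int i * int q + int j)) q (fst s1 vm)"
          and fr: "\<forall>r. r \<notin> {vm, vj} \<longrightarrow> fst s1 r = (R'(vp := ky + int i * int q)) r"
        have m': "is_min (R vINF) (\<lambda>j. K (i * q + j)) q (fst s1 vm)"
          using m by (subst is_min_cong[of q _ "\<lambda>j. H' (ky + int i * int q + int j)"]) (auto simp: HK)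
        then have mW: "\<bar>fst s1 vm\<bar> \<le> W" using R Kb lay by (auto simp: is_min_def cap_def)
        have r1: "fst s1 vBm = bm" "fst s1 vt = int i" "fst s1 vlen = int q" using fr r by auto
        have fr1: "\<forall>r. r \<notin> {vlen, vt, vp, vm, vj} \<longrightarrow> fst s1 r = R r"
          using fr \<open>Inv i s\<close> unfolding s Inv_def by auto
        show "wp W (HPut (V vBm [+] V vt) (V vm) ;; incr vt) s1
          (\<lambda>t2 s2. 6 + (t1 + t2) \<le> 40 * (q + 1) + 40 \<and> Inv (Suc i) s2)"
          using t1 s1 m' mW r1 fr1 \<open>i < q\<close> lay \<open>Inv i s\<close> unfolding s
          by (auto simp: wp_simps Inv_def less_Suc_eq)
      qed
      have "\<bar>int i * int q\<bar> \<le> W" "\<bar>ky + int i * int q\<bar> \<le> W" using bi lay by auto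
      with 2 show ?thesis
        using r lay \<open>i < q\<close> unfolding s by (simp add: wp_Seq wp_Set add.assoc)
    qed
  qed auto
  then show ?thesis
    unfolding blockmins_def using lay R
    by (simp add: wp_Seq wp_Set regsok_def) (erule wp_mono, auto simp: Inv_def algebra_simps)
qed

end

section \<open>Selection sort with blocks of length about sqrt n\<close>

definition sorted_rank :: "nat \<Rightarrow> (nat \<Rightarrow> int) \<Rightarrow> (nat \<Rightarrow> nat) \<Rightarrow> (nat \<Rightarrow> nat) \<Rightarrow> bool" where
  "sorted_rank n a ord rnk \<longleftrightarrow> (\<forall>j<n. ord j < n) \<and> (\<forall>k<n. rnk k < n \<and> ord (rnk k) = k) \<and>
     (\<forall>k<n. \<forall>k'<n. rnk k \<le> rnk k' \<longrightarrow> a k \<le> a k')"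

text \<open>Square root decomposition: the least key is the least of q block minima, and removing it
  affects a single block, so one extraction takes O(q) steps.\<close>

definition ext_body :: hcom where
  "ext_body = HSet vp (V vBm) ;; minrange ;;
    HSet vk (V vm [mod] V vN) ;;
    HPut (V vO [+] V vB [+] V vt) (V vk) ;;
    HPut (V vRK [+] V vB [+] V vk) (V vt) ;;
    HPut (V vKy [+] V vk) (V vINF) ;;
    HSet vk (V vk [div] V vq) ;;
    HSet vp (V vKy [+] V vk [*] V vq) ;; minrange ;;
    HPut (V vBm [+] V vk) (V vm) ;;
    incr vt"

definition select_all :: hcom where
  "select_all = HSet vt (N 0) ;; HWhile (V vt [<] V vN) ext_body"

definition sortrow :: hcom where
  "sortrow = keys ;; pad ;; blockmins ;; select_all"

context layout
begin

text \<open>The key array after extraction of \<open>E\<close>. Removed keys and padding share the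
  sentinel \<open>c\<close>, so neither can be selected.\<close>

definition Kf :: "int \<Rightarrow> (nat \<Rightarrow> int) \<Rightarrow> nat set \<Rightarrow> nat \<Rightarrow> int" where
  "Kf c a E k = (if n \<le> k \<or> k \<in> E then c else a k * int n + int k)"

text \<open>Fewer than n keys are removed, so the minimum lies below the sentinel and is a genuine
  key. Its remainder mod n is the index, and division by n is monotone, which turns the order of
  keys into an order of values.\<close>

lemma select_min:
  assumes E: "E \<subseteq> {..<n}" "card E < n"
    and c: "\<And>k. k < n \<Longrightarrow> a k * int n + int k < c"
    and blocks: "\<And>\<beta>. \<beta> < q \<Longrightarrow> is_min c (\<lambda>j. Kf c a E (\<beta> * q + j)) q (f \<beta>)"
    and m: "is_min c f q m"
  shows "\<exists>k<n. k \<notin> E \<and> m mod int n = int k \<and> (\<forall>k'<n. k' \<notin> E \<longrightarrow> a k \<le> a k')"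
proof -
  have le: "m \<le> Kf c a E k" if "k < q * q" for k
  proof -
    note b = block_of[OF that]
    have "f (k div q) \<le> Kf c a E (k div q * q + k mod q)"
      using blocks[OF b(1)] b(3) unfolding is_min_def by blast
    moreover have "m \<le> f (k div q)" using m b(1) unfolding is_min_def by blast
    ultimately show ?thesis using b(2) by simp
  qed
  have "\<not> {..<n} \<subseteq> E" using E card_mono[of E "{..<n}"] finite_subset[OF E(1)] by auto
  then obtain k0 where k0: "k0 < n" "k0 \<notin> E" by auto
  have "m < c" using le[of k0] k0 c[of k0] nq by (auto simp: Kf_def)
  then obtain \<beta> where \<beta>: "\<beta> < q" "m = f \<beta>" using m unfolding is_min_def by auto
  with \<open>m < c\<close> blocks[OF \<beta>(1)] obtain j where j: "j < q" "m = Kf c a E (\<beta> * q + j)"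
    unfolding is_min_def by auto
  let ?k = "\<beta> * q + j"
  have k: "?k < n" "?k \<notin> E" "m = a ?k * int n + int ?k"
    using j \<open>m < c\<close> unfolding Kf_def by (auto split: if_splits)
  have "m mod int n = int ?k" unfolding k(3) using k(1) by (simp del: of_nat_add of_nat_mult)
  moreover have "a ?k \<le> a k'" if "k' < n" "k' \<notin> E" for k'
  proof -
    have "m \<le> a k' * int n + int k'" using le[of k'] that nq by (auto simp: Kf_def)
    then have "m div int n \<le> (a k' * int n + int k') div int n" using n0 by (intro zdiv_mono1) auto
    then show ?thesis unfolding k(3) using k(1) that n0 by (simp del: of_nat_add of_nat_mult)
  qed
  ultimately show ?thesis using k by blast
qed

text \<open>The first t positions of \<open>ord\<close> are final: sorted, and not above anything
  that remains. Apart from the work arrays, memory may differ from \<open>H0\<close> only in the two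
  segments that belong to offset \<open>b\<close>.\<close>

definition sort_inv :: "(reg \<Rightarrow> int) \<Rightarrow> (int \<Rightarrow> int) \<Rightarrow> (nat \<Rightarrow> int) \<Rightarrow> int \<Rightarrow> int \<Rightarrow> nat \<Rightarrow> (nat \<Rightarrow> nat) \<Rightarrow> state \<Rightarrow> bool" where
  "sort_inv R0 H0 a c b t ord s \<longleftrightarrow>
     fst s vt = int t \<and> fst s vlen = int q \<and> (\<forall>r. r \<notin> {vk, vt, vp, vm, vj} \<longrightarrow> fst s r = R0 r) \<and>
     inj_on ord {..<t} \<and> (\<forall>j<t. ord j < n) \<and> (\<forall>j<t. snd s (od + b + int j) = int (ord j)) \<and>
     (\<forall>j<t. snd s (rk + b + int (ord j)) = int j) \<and>
     (\<forall>k<q * q. snd s (ky + int k) = Kf c a (ord ` {..<t}) k) \<and>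
     (\<forall>\<beta><q. is_min c (\<lambda>j. Kf c a (ord ` {..<t}) (\<beta> * q + j)) q (snd s (bm + int \<beta>))) \<and>
     (\<forall>i j. i \<le> j \<longrightarrow> j < t \<longrightarrow> a (ord i) \<le> a (ord j)) \<and>
     (\<forall>i<t. \<forall>k<n. k \<notin> ord ` {..<t} \<longrightarrow> a (ord i) \<le> a k) \<and>
     (\<forall>x. (x < od + b \<or> od + b + int n \<le> x) \<longrightarrow> (x < rk + b \<or> rk + b + int n \<le> x) \<longrightarrow>
        (x < ky \<or> bm + int q \<le> x) \<longrightarrow> snd s x = H0 x)"

lemma Kf_bound: "0 \<le> c \<Longrightarrow> c \<le> cap \<Longrightarrow> (\<And>k. k < n \<Longrightarrow> \<bar>a k\<bar> \<le> int U) \<Longrightarrow> \<bar>Kf c a E k\<bar> \<le> cap"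
  using key_bound[of "a k" k] by (auto simp: Kf_def intro: less_imp_le)

lemma is_min_bound: "is_min c f len m \<Longrightarrow> \<bar>c\<bar> \<le> z \<Longrightarrow> (\<And>j. j < len \<Longrightarrow> \<bar>f j\<bar> \<le> z) \<Longrightarrow> \<bar>m\<bar> \<le> z"
  by (auto simp: is_min_def)

lemma ext_body:
  assumes R0: "regsok R0" "R0 vB = b" "0 \<le> b" "b \<le> nn" and c: "R0 vINF = c" "0 \<le> c" "c \<le> cap"
    and a: "\<And>k. k < n \<Longrightarrow> \<bar>a k\<bar> \<le> int U" "\<And>k. k < n \<Longrightarrow> a k * int n + int k < c"
    and inv: "sort_inv R0 H0 a c b t ord s" and t: "t < n"
  shows "wp W ext_body s (\<lambda>\<tau> s'. \<tau> \<le> 80 * (q + 1) + 100 \<and> (\<exists>ord'. sort_inv R0 H0 a c b (Suc t) ord' s'))"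
proof -
  obtain R H where s: "s = (R, H)" by (cases s)
  let ?E = "ord ` {..<t}"
  have r: "R vt = int t" "R vlen = int q" "R vB = b" "R vINF = c" "R vN = int n" "R vq = int q" "R vO = od"
      "R vRK = rk" "R vKy = ky" "R vBm = bm"
    and fr: "\<forall>r. r \<notin> {vk, vt, vp, vm, vj} \<longrightarrow> R r = R0 r"
    and inj: "inj_on ord {..<t}" and on: "\<And>j. j < t \<Longrightarrow> ord j < n"
    and Ho: "\<And>j. j < t \<Longrightarrow> H (od + b + int j) = int (ord j)"
    and Hr: "\<And>j. j < t \<Longrightarrow> H (rk + b + int (ord j)) = int j"
    and Hk: "\<And>k. k < q * q \<Longrightarrow> H (ky + int k) = Kf c a ?E k"
    and Hb: "\<And>\<beta>. \<beta> < q \<Longrightarrow> is_min c (\<lambda>j. Kf c a ?E (\<beta> * q + j)) q (H (bm + int \<beta>))"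
    and so: "\<And>i j. i \<le> j \<Longrightarrow> j < t \<Longrightarrow> a (ord i) \<le> a (ord j)"
    and un: "\<And>i k. i < t \<Longrightarrow> k < n \<Longrightarrow> k \<notin> ?E \<Longrightarrow> a (ord i) \<le> a k"
    and H0: "\<And>x. (x < od + b \<or> od + b + int n \<le> x) \<Longrightarrow> (x < rk + b \<or> rk + b + int n \<le> x) \<Longrightarrow>
        (x < ky \<or> bm + int q \<le> x) \<Longrightarrow> H x = H0 x"
    using inv R0 c unfolding s sort_inv_def regsok_def by auto
  have En: "?E \<subseteq> {..<n}" using on by auto
  have cE: "card ?E = t" using card_image[OF inj] by simp
  have capW: "cap \<le> W" using lay by (simp add: cap_def)
  have Kb: "\<bar>Kf c a E k\<bar> \<le> cap" for E k using Kf_bound c a by auto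
  have Hbb: "\<bar>H (bm + int \<beta>)\<bar> \<le> cap" if "\<beta> < q" for \<beta>
    using is_min_bound[OF Hb[OF that], of cap] c Kb by auto
  have 1: "wp W minrange (R(vp := bm), H) (\<lambda>t s'. t \<le> 40 * (q + 1) \<and> snd s' = H \<and>
     is_min c (\<lambda>j. H (bm + int j)) q (fst s' vm) \<and> (\<forall>r. r \<notin> {vm, vj} \<longrightarrow> fst s' r = (R(vp := bm)) r))"
    using r lay c capW Hbb by (intro minrange) (auto intro: order_trans)
  let ?rest = "HSet vk (V vm [mod] V vN) ;;
    HPut (V vO [+] V vB [+] V vt) (V vk) ;;
    HPut (V vRK [+] V vB [+] V vk) (V vt) ;;
    HPut (V vKy [+] V vk) (V vINF) ;;
    HSet vk (V vk [div] V vq) ;;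
    HSet vp (V vKy [+] V vk [*] V vq) ;; minrange ;;
    HPut (V vBm [+] V vk) (V vm) ;;
    incr vt"
  have 2: "wp W minrange (R(vp := bm), H) (\<lambda>t1 s1. wp W ?rest s1
      (\<lambda>t2 s2. 2 + (t1 + t2) \<le> 80 * (q + 1) + 100 \<and> (\<exists>ord'. sort_inv R0 H0 a c b (Suc t) ord' s2)))"
  proof (rule wp_mono[OF 1], elim conjE)
    fix t1 s1 assume t1: "t1 \<le> 40 * (q + 1)" and s1: "snd s1 = H"
      and m: "is_min c (\<lambda>j. H (bm + int j)) q (fst s1 vm)"
      and fr1: "\<forall>r. r \<notin> {vm, vj} \<longrightarrow> fst s1 r = (R(vp := bm)) r"
    obtain R1 where s1': "s1 = (R1, H)" using s1 by (cases s1) auto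
    have r1: "R1 vt = int t" "R1 vlen = int q" "R1 vB = b" "R1 vINF = c" "R1 vN = int n" "R1 vq = int q" "R1 vO = od"
      "R1 vRK = rk" "R1 vKy = ky" "R1 vBm = bm"
      and fr1': "\<forall>r. r \<notin> {vk, vt, vp, vm, vj} \<longrightarrow> R1 r = R0 r"
      using fr1 r fr unfolding s1' by auto
    have mW: "\<bar>R1 vm\<bar> \<le> W" using is_min_bound[OF m, of W] c capW Hbb unfolding s1' by (auto intro: order_trans)
    obtain k where k: "k < n" "k \<notin> ?E" "R1 vm mod int n = int k" "\<forall>k'<n. k' \<notin> ?E \<longrightarrow> a k \<le> a k'"
      using select_min[OF En _ a(2) Hb m] cE t unfolding s1' by auto
    let ?\<beta> = "k div q"
    have kq: "k < q * q" using k(1) nq by simp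
    note blk = block_of[OF kq]
    have bi: "int ?\<beta> * int q + int q \<le> int q * int q" "0 \<le> int ?\<beta> * int q" using block_index[OF blk(1) q0] by auto
    define H2 where "H2 = H(od + b + int t := int k, rk + b + int k := int t, ky + int k := c)"
    define R2 where "R2 = R1(vk := int ?\<beta>, vp := ky + int ?\<beta> * int q)"
    let ?E' = "insert k ?E"
    have H2k: "H2 (ky + int k') = Kf c a ?E' k'" if "k' < q * q" for k'
      using Hk[OF that] k(1) t lay R0(3,4) unfolding H2_def by (auto simp: Kf_def)
    have H2b: "H2 (ky + int ?\<beta> * int q + int j) = Kf c a ?E' (?\<beta> * q + j)" if "j < q" for j
      using H2k[OF block_index(1)[OF blk(1) that]] by (simp add: add.assoc)
    have 3: "wp W minrange (R2, H2) (\<lambda>t s'. t \<le> 40 * (q + 1) \<and> snd s' = H2 \<and>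
       is_min c (\<lambda>j. H2 (ky + int ?\<beta> * int q + int j)) q (fst s' vm) \<and> (\<forall>r. r \<notin> {vm, vj} \<longrightarrow> fst s' r = R2 r))"
      using r1 lay c capW bi H2b Kb unfolding R2_def by (intro minrange) (auto intro: order_trans)
    have 4: "wp W minrange (R2, H2) (\<lambda>t3 s3. wp W (HPut (V vBm [+] V vk) (V vm) ;; incr vt) s3
      (\<lambda>t4 s4. 2 + (t1 + (40 + (t3 + t4))) \<le> 80 * (q + 1) + 100 \<and> (\<exists>ord'. sort_inv R0 H0 a c b (Suc t) ord' s4)))"
    proof (rule wp_mono[OF 3], elim conjE)
      fix t3 s3 assume t3: "t3 \<le> 40 * (q + 1)" and s3: "snd s3 = H2"
        and m3: "is_min c (\<lambda>j. H2 (ky + int ?\<beta> * int q + int j)) q (fst s3 vm)"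
        and fr3: "\<forall>r. r \<notin> {vm, vj} \<longrightarrow> fst s3 r = R2 r"
      obtain R3 where s3': "s3 = (R3, H2)" using s3 by (cases s3) auto
      have r3: "R3 vt = int t" "R3 vk = int ?\<beta>" "R3 vBm = bm" "R3 vlen = int q"
        and fr3': "\<forall>r. r \<notin> {vk, vt, vp, vm, vj} \<longrightarrow> R3 r = R0 r"
        using fr3 r1 fr1' unfolding s3' R2_def by auto
      have m3': "is_min c (\<lambda>j. Kf c a ?E' (?\<beta> * q + j)) q (R3 vm)"
        using m3 unfolding s3' by (subst is_min_cong[of q _ "\<lambda>j. H2 (ky + int ?\<beta> * int q + int j)"]) (auto simp: H2b)
      have mW3: "\<bar>R3 vm\<bar> \<le> W" using is_min_bound[OF m3', of W] c capW Kb by (auto intro: order_trans)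
      define H4 where "H4 = H2(bm + int ?\<beta> := R3 vm)"
      define ord' where "ord' = ord(t := k)"
      have im: "ord' ` {..<Suc t} = ?E'" "\<And>j. j < t \<Longrightarrow> ord' j = ord j" "ord' t = k"
        unfolding ord'_def by (auto simp: lessThan_Suc)
      have "sort_inv R0 H0 a c b (Suc t) ord' (R3(vt := int t + 1), H4)"
        unfolding sort_inv_def fst_conv snd_conv im(1)
      proof (intro conjI)
        show "inj_on ord' {..<Suc t}"
          using inj k(2) unfolding ord'_def by (auto simp: lessThan_Suc inj_on_def)
        show "\<forall>j<Suc t. ord' j < n" using on k(1) unfolding ord'_def by (auto simp: less_Suc_eq)
        show "\<forall>j<Suc t. H4 (od + b + int j) = int (ord' j)"
          using Ho k(1) t lay R0(3,4) unfolding H4_def H2_def ord'_def by (auto simp: less_Suc_eq)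
        show "\<forall>j<Suc t. H4 (rk + b + int (ord' j)) = int j"
        proof (intro allI impI)
          fix j assume j: "j < Suc t"
          show "H4 (rk + b + int (ord' j)) = int j"
          proof (cases "j = t")
            case True
            then show ?thesis using k(1) t lay R0(3,4) unfolding H4_def H2_def ord'_def by auto
          next
            case False
            then have "j < t" using j by simp
            moreover then have "ord j \<noteq> k" using k(2) by auto
            ultimately show ?thesis using Hr[of j] on[of j] k(1) t lay R0(3,4)
              unfolding H4_def H2_def ord'_def by auto
          qed
        qed
        show "\<forall>k'<q * q. H4 (ky + int k') = Kf c a ?E' k'"
        proof (intro allI impI)
          fix k' assume k': "k' < q * q"
          then have "int k' < int q * int q" by (metis of_nat_less_iff of_nat_mult)
          then show "H4 (ky + int k') = Kf c a ?E' k'" using H2k[OF k'] lay unfolding H4_def by auto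
        qed
        show "\<forall>\<beta><q. is_min c (\<lambda>j. Kf c a ?E' (\<beta> * q + j)) q (H4 (bm + int \<beta>))"
        proof (intro allI impI)
          fix \<beta> assume \<beta>: "\<beta> < q"
          show "is_min c (\<lambda>j. Kf c a ?E' (\<beta> * q + j)) q (H4 (bm + int \<beta>))"
          proof (cases "\<beta> = ?\<beta>")
            case True
            then show ?thesis using m3' unfolding H4_def by simp
          next
            case False
            \<comment> \<open>The removed index lies in block \<open>k div q\<close>, so the minima
              of all other blocks stay correct.\<close>
            have "\<beta> * q + j \<noteq> k" if "j < q" for j using block_index(2)[OF \<beta> that] False by auto
            then have "Kf c a ?E' (\<beta> * q + j) = Kf c a ?E (\<beta> * q + j)" if "j < q" for j
              using that unfolding Kf_def by auto
            then have "is_min c (\<lambda>j. Kf c a ?E' (\<beta> * q + j)) q (H (bm + int \<beta>))"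
              using Hb[OF \<beta>] by (subst is_min_cong[of q _ "\<lambda>j. Kf c a ?E (\<beta> * q + j)"]) auto
            moreover have "H4 (bm + int \<beta>) = H (bm + int \<beta>)"
              using False \<beta> k(1) t lay R0(3,4) kq unfolding H4_def H2_def by auto
            ultimately show ?thesis by simp
          qed
        qed
        show "\<forall>i j. i \<le> j \<longrightarrow> j < Suc t \<longrightarrow> a (ord' i) \<le> a (ord' j)"
          using so un k(1,2) unfolding ord'_def by (auto simp: less_Suc_eq)
        show "\<forall>i<Suc t. \<forall>k'<n. k' \<notin> ?E' \<longrightarrow> a (ord' i) \<le> a k'"
          using un k(4) unfolding ord'_def by (auto simp: less_Suc_eq)
        show "\<forall>x. (x < od + b \<or> od + b + int n \<le> x) \<longrightarrow> (x < rk + b \<or> rk + b + int n \<le> x) \<longrightarrow>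
            (x < ky \<or> bm + int q \<le> x) \<longrightarrow> H4 x = H0 x"
          using H0 t k(1) blk(1) lay unfolding H4_def H2_def by auto
      qed (use r3 fr3' in auto)
      then show "wp W (HPut (V vBm [+] V vk) (V vm) ;; incr vt) s3
        (\<lambda>t4 s4. 2 + (t1 + (40 + (t3 + t4))) \<le> 80 * (q + 1) + 100 \<and> (\<exists>ord'. sort_inv R0 H0 a c b (Suc t) ord' s4))"
        using t1 t3 r3 mW3 blk(1) lay t unfolding s3' H4_def by (auto simp: wp_simps)
    qed
    have "\<bar>int ?\<beta> * int q\<bar> \<le> W" "\<bar>ky + int ?\<beta> * int q\<bar> \<le> W" "\<bar>int ?\<beta>\<bar> \<le> W"
      using bi lay blk(1) by linarith+
    moreover have "int k div int q = int ?\<beta>" by (simp add: zdiv_int)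
    ultimately
    show "wp W ?rest s1
      (\<lambda>t2 s2. 2 + (t1 + t2) \<le> 80 * (q + 1) + 100 \<and> (\<exists>ord'. sort_inv R0 H0 a c b (Suc t) ord' s2))"
      using 4 k(1,3) t lay R0(3,4) r1 mW c capW unfolding s1'
      by (simp add: wp_Seq wp_Set wp_Put R2_def[symmetric] H2_def[symmetric] del: of_nat_div)
         (erule wp_mono, auto)
  qed
  then show ?thesis unfolding ext_body_def s using r lay
    by (simp add: wp_Seq wp_Set)
qed

lemma select_all:
  assumes R0: "regsok R0" "R0 vB = b" "0 \<le> b" "b \<le> nn" and c: "R0 vINF = c" "0 \<le> c" "c \<le> cap"
    and a: "\<And>k. k < n \<Longrightarrow> \<bar>a k\<bar> \<le> int U" "\<And>k. k < n \<Longrightarrow> a k * int n + int k < c"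
    and H: "R0 vlen = int q" "\<And>k. k < q * q \<Longrightarrow> H (ky + int k) = Kf c a {} k"
      "\<And>\<beta>. \<beta> < q \<Longrightarrow> is_min c (\<lambda>j. Kf c a {} (\<beta> * q + j)) q (H (bm + int \<beta>))"
  shows "wp W select_all (R0, H) (\<lambda>t s'. t \<le> 250 * ((n + 1) * (q + 1)) \<and> (\<exists>ord. sort_inv R0 H a c b n ord s'))"
proof -
  have "wp W (HWhile (V vt [<] V vN) ext_body) (R0(vt := 0), H)
     (\<lambda>t s'. t \<le> (n + 1) * (80 * (q + 1) + 104) \<and> (\<exists>ord. sort_inv R0 H a c b n ord s'))"
  proof (rule wp_While_for[where m = n and b = "80 * (q + 1) + 100"
        and Inv = "\<lambda>i s. \<exists>ord. sort_inv R0 H a c b i ord s"])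
    show "\<exists>ord. sort_inv R0 H a c b 0 ord (R0(vt := 0), H)"
      using H by (auto simp: sort_inv_def)
    show "safe W (V vt [<] V vN) s \<and> (aval (V vt [<] V vN) s \<noteq> 0 \<longleftrightarrow> i < n)"
      if "i \<le> n" "\<exists>ord. sort_inv R0 H a c b i ord s" for i s
      using that R0 lay by (auto simp: sort_inv_def regsok_def)
    show "wp W ext_body s (\<lambda>t s'. t \<le> 80 * (q + 1) + 100 \<and> (\<exists>ord. sort_inv R0 H a c b (Suc i) ord s'))"
      if "i < n" "\<exists>ord. sort_inv R0 H a c b i ord s" for i s
      using that ext_body[OF R0 c a] by blast
  qed auto
  then show ?thesis
    unfolding select_all_def using lay
    by (simp add: wp_Seq wp_Set) (erule wp_mono, auto simp: algebra_simps)
qed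

lemma sortrow:
  assumes R: "regsok R" "R vB = b" "0 \<le> b" "b \<le> nn" and INF: "0 \<le> R vINF" "R vINF \<le> cap"
    and a: "\<And>k. k < n \<Longrightarrow> H (b + int k) = a k" "\<And>k. k < n \<Longrightarrow> \<bar>a k\<bar> \<le> int U"
  shows "wp W sortrow (R, H) (\<lambda>t s'. t \<le> 500 * ((n + q + 1) * (q + 1)) \<and>
     (\<forall>r. r \<notin> {vk, vy, vINF, vt, vp, vm, vj, vlen} \<longrightarrow> fst s' r = R r) \<and>
     0 \<le> fst s' vINF \<and> fst s' vINF \<le> cap \<and>
     (\<exists>ord rnk. sorted_rank n a ord rnk \<and> (\<forall>j<n. snd s' (od + b + int j) = int (ord j)) \<and>
        (\<forall>k<n. snd s' (rk + b + int k) = int (rnk k))) \<and>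
     (\<forall>x. (x < od + b \<or> od + b + int n \<le> x) \<longrightarrow> (x < rk + b \<or> rk + b + int n \<le> x) \<longrightarrow>
        (x < ky \<or> bm + int q \<le> x) \<longrightarrow> snd s' x = H x))"
  unfolding sortrow_def wp_Seq
proof (rule wp_mono[OF keys[OF R INF, of H a, OF a]], assumption, assumption, elim conjE)
  fix t1 s1
  assume t1: "t1 \<le> 60 * (n + 1)" and k1: "fst s1 vk = int n" and c: "0 \<le> fst s1 vINF" "fst s1 vINF \<le> cap"
    and ac: "\<forall>k<n. a k * int n + int k < fst s1 vINF"
    and key1: "\<forall>k<n. snd s1 (ky + int k) = a k * int n + int k"
    and H1: "\<forall>x. x < ky \<or> ky + int n \<le> x \<longrightarrow> snd s1 x = H x"
    and fr1: "\<forall>r. r \<notin> {vk, vy, vINF} \<longrightarrow> fst s1 r = R r"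
  let ?c = "fst s1 vINF"
  let ?post = "\<lambda>t s'. t \<le> 500 * ((n + q + 1) * (q + 1)) \<and>
     (\<forall>r. r \<notin> {vk, vy, vINF, vt, vp, vm, vj, vlen} \<longrightarrow> fst s' r = R r) \<and>
     0 \<le> fst s' vINF \<and> fst s' vINF \<le> cap \<and>
     (\<exists>ord rnk. sorted_rank n a ord rnk \<and> (\<forall>j<n. snd s' (od + b + int j) = int (ord j)) \<and>
        (\<forall>k<n. snd s' (rk + b + int k) = int (rnk k))) \<and>
     (\<forall>x. (x < od + b \<or> od + b + int n \<le> x) \<longrightarrow> (x < rk + b \<or> rk + b + int n \<le> x) \<longrightarrow>
        (x < ky \<or> bm + int q \<le> x) \<longrightarrow> snd s' x = H x)"
  obtain R1 H1' where s1: "s1 = (R1, H1')" by (cases s1)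
  have R1: "regsok R1" using R(1) fr1 unfolding s1 by (auto simp: regsok_def)
  have wpad: "wp W pad s1 (\<lambda>t s'. t \<le> 20 * (q * q + 1) \<and>
     (\<forall>k. n \<le> k \<longrightarrow> k < q * q \<longrightarrow> snd s' (ky + int k) = ?c) \<and>
     (\<forall>x. x < ky + int n \<or> ky + int q * int q \<le> x \<longrightarrow> snd s' x = snd s1 x) \<and>
     (\<forall>r. r \<notin> {vk} \<longrightarrow> fst s' r = fst s1 r))"
    using pad[OF R1, of H1'] k1 c unfolding s1 by simp
  show "wp W pad s1 (\<lambda>t2 s2. wp W blockmins s2 (\<lambda>t3 s3. wp W select_all s3
     (\<lambda>t4 s4. ?post (t1 + (t2 + (t3 + t4))) s4)))"
  proof (rule wp_mono[OF wpad], elim conjE)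
    fix t2 s2
    assume t2: "t2 \<le> 20 * (q * q + 1)"
      and pd: "\<forall>k. n \<le> k \<longrightarrow> k < q * q \<longrightarrow> snd s2 (ky + int k) = ?c"
      and H2: "\<forall>x. x < ky + int n \<or> ky + int q * int q \<le> x \<longrightarrow> snd s2 x = snd s1 x"
      and fr2: "\<forall>r. r \<notin> {vk} \<longrightarrow> fst s2 r = fst s1 r"
    obtain R2 H2' where s2: "s2 = (R2, H2')" by (cases s2)
    have R2: "regsok R2" "R2 vINF = ?c" using R1 fr2 unfolding s1 s2 by (auto simp: regsok_def)
    have HK: "H2' (ky + int k) = Kf ?c a {} k" if "k < q * q" for k
    proof (cases "k < n")
      case True
      then have "H2' (ky + int k) = snd s1 (ky + int k)" using H2 unfolding s2 by simp
      then show ?thesis using key1 True by (simp add: Kf_def)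
    qed (use pd that s2 in \<open>auto simp: Kf_def\<close>)
    have wbm: "wp W blockmins s2 (\<lambda>t s'. t \<le> 100 * ((q + 1) * (q + 1)) \<and> fst s' vlen = int q \<and>
     (\<forall>\<beta><q. is_min ?c (\<lambda>j. Kf ?c a {} (\<beta> * q + j)) q (snd s' (bm + int \<beta>))) \<and>
     (\<forall>x. x < bm \<or> bm + int q \<le> x \<longrightarrow> snd s' x = snd s2 x) \<and>
     (\<forall>r. r \<notin> {vlen, vt, vp, vm, vj} \<longrightarrow> fst s' r = fst s2 r))"
      using blockmins[OF R2(1), of H2' "Kf ?c a {}"] R2 c HK Kf_bound[OF c a(2)] unfolding s2 by simp
    show "wp W blockmins s2 (\<lambda>t3 s3. wp W select_all s3
       (\<lambda>t4 s4. ?post (t1 + (t2 + (t3 + t4))) s4))"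
    proof (rule wp_mono[OF wbm], elim conjE)
      fix t3 s3
      assume t3: "t3 \<le> 100 * ((q + 1) * (q + 1))" and l3: "fst s3 vlen = int q"
        and bm3: "\<forall>\<beta><q. is_min ?c (\<lambda>j. Kf ?c a {} (\<beta> * q + j)) q (snd s3 (bm + int \<beta>))"
        and H3: "\<forall>x. x < bm \<or> bm + int q \<le> x \<longrightarrow> snd s3 x = snd s2 x"
        and fr3: "\<forall>r. r \<notin> {vlen, vt, vp, vm, vj} \<longrightarrow> fst s3 r = fst s2 r"
      obtain R3 H3' where s3: "s3 = (R3, H3')" by (cases s3)
      have R3: "regsok R3" "R3 vINF = ?c" "R3 vB = b"
        using R2 fr3 fr2 fr1 R(2) unfolding s2 s3 by (auto simp: regsok_def)
      have HK3: "H3' (ky + int k) = Kf ?c a {} k" if "k < q * q" for k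
      proof -
        have "int k < int q * int q" using that by (metis of_nat_less_iff of_nat_mult)
        then show ?thesis using H3 HK[OF that] lay unfolding s2 s3 by simp
      qed
      have wsel: "wp W select_all s3 (\<lambda>t s'. t \<le> 250 * ((n + 1) * (q + 1)) \<and>
          (\<exists>ord. sort_inv R3 H3' a ?c b n ord s'))"
        unfolding s3 using R3 R(3,4) c a(2) ac l3 HK3 bm3 unfolding s3 by (intro select_all) auto
      show "wp W select_all s3 (\<lambda>t4 s4. ?post (t1 + (t2 + (t3 + t4))) s4)"
      proof (rule wp_mono[OF wsel], elim conjE exE)
        fix t4 s4 ord
        assume t4: "t4 \<le> 250 * ((n + 1) * (q + 1))" and inv: "sort_inv R3 H3' a ?c b n ord s4"
        have on: "\<And>j. j < n \<Longrightarrow> ord j < n" and inj: "inj_on ord {..<n}"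
          and Ho: "\<And>j. j < n \<Longrightarrow> snd s4 (od + b + int j) = int (ord j)"
          and Hr: "\<And>j. j < n \<Longrightarrow> snd s4 (rk + b + int (ord j)) = int j"
          and so: "\<And>i j. i \<le> j \<Longrightarrow> j < n \<Longrightarrow> a (ord i) \<le> a (ord j)"
          and fr4: "\<forall>r. r \<notin> {vk, vt, vp, vm, vj} \<longrightarrow> fst s4 r = R3 r"
          and H4: "\<And>x. (x < od + b \<or> od + b + int n \<le> x) \<Longrightarrow> (x < rk + b \<or> rk + b + int n \<le> x) \<Longrightarrow>
            (x < ky \<or> bm + int q \<le> x) \<Longrightarrow> snd s4 x = H3' x"
          using inv unfolding sort_inv_def by blast+
        \<comment> \<open>After n extractions \<open>ord\<close> is an injective self-map of a
          finite set, hence onto; the rank is its inverse.\<close>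
        have "ord ` {..<n} = {..<n}" using on inj by (intro endo_inj_surj) auto
        then have "\<forall>k<n. \<exists>j<n. ord j = k" by (metis imageE lessThan_iff)
        then obtain rnk where rnk: "\<And>k. k < n \<Longrightarrow> rnk k < n \<and> ord (rnk k) = k" by metis
        have "sorted_rank n a ord rnk" unfolding sorted_rank_def using on rnk so by metis
        moreover have "\<forall>k<n. snd s4 (rk + b + int k) = int (rnk k)" using Hr rnk by metis
        moreover have "t1 + (t2 + (t3 + t4)) \<le> 500 * ((n + q + 1) * (q + 1))"
          using t1 t2 t3 t4 by (simp add: algebra_simps)
        moreover have "snd s4 x = H x" if "x < od + b \<or> od + b + int n \<le> x" "x < rk + b \<or> rk + b + int n \<le> x"
            "x < ky \<or> bm + int q \<le> x" for x
          using H4[OF that] H3 H2 H1 that(3) lay unfolding s3 by auto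
        moreover have "\<forall>r. r \<notin> {vk, vy, vINF, vt, vp, vm, vj, vlen} \<longrightarrow> fst s4 r = R r"
          using fr4 fr3 fr2 fr1 unfolding s3 by auto
        moreover have "fst s4 vINF = ?c" using fr4 R3(2) by auto
        ultimately show "?post (t1 + (t2 + (t3 + t4))) s4" using c Ho by auto
      qed
    qed
  qed
qed

end

subsection \<open>Dominance instances\<close>

definition build :: hcom where
  "build = HPut (regE 0) (V vN) ;; HSet vk (N 0) ;;
    HWhile (V vk [<] V vNN)
     (HIf (V vka)
        (HIf (D (V vRK [+] V vk) [div] V vS [=] V vg)
          (HSet vy (N 0 [-] D (V vk))) (HSet vy (N 1 [-] V vL)))
        (HSet vy (D (V vk))) ;;
      HPut (heapE (V vk)) (V vy) ;; incr vk)"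

definition writeq :: hcom where
  "writeq = HSet vk (N 0) ;;
    HWhile (V vk [<] V vN)
     (HSet vy (D (V vNN [+] V vk)) ;;
      HIf (V vka)
        (HIf (V vy [<] V vL) (HSet vy (N 0 [-] V vL)) (HSet vy (N 0 [-] V vy)))
        (HIf (D (V vRK [+] V vNN [+] V vk) [div] V vS [=] V vg) HSkip (HSet vy (V vL [-] N 1))) ;;
      HSet vt (V vNN [+] V vk) ;;
      HPut (heapE (V vt)) (V vy) ;; incr vk)"

text \<open>A later group overwrites the entry of an earlier run. As the instances run from the last
  group down to the first, the smallest group with a witness survives.\<close>

definition collect :: hcom where
  "collect = HSet vk (N 0) ;;
    HWhile (V vk [<] V vN)
     (HSet vt (V vNN [+] V vN [+] V vk) ;;
      HIf (D (heapE (V vt))) (HPut (V vF [+] N 2 [*] V vk [+] V vka) (V vg)) HSkip ;; incr vk)"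

text \<open>Separates the simulation from the main program, whose arrays lie at nonnegative
  addresses, where no instance has a cell.\<close>

lemma foreign_nonneg: "0 \<le> y \<Longrightarrow> 0 \<le> b \<Longrightarrow> foreign y b"
  using cell_neg[of y] cell_neg[of "y + 1"] unfolding foreign_def
  by (metis add_increasing2 not_less zero_le_one)

lemma foreign_cell: "0 \<le> y \<Longrightarrow> 0 \<le> y' \<Longrightarrow> y' \<noteq> y \<Longrightarrow> y' \<noteq> y + 1 \<Longrightarrow> foreign y (cell y' a)"
  by (auto simp: foreign_def cell_inject)

lemma int_div_eq: "(int a div int b = int g) \<longleftrightarrow> a div b = g"
  by (metis of_nat_div of_nat_eq_iff)

text \<open>The solver is invoked for integers up to \<open>U + 1\<close> because the sentinels
  \<open>L - 1\<close> and \<open>1 - L\<close> may exceed \<open>U\<close> by one. \<open>T\<close>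
  bounds its total time on one instance, over all n queries.\<close>

locale omv = layout n q U W nn od rk F ky bm + cell_bounds Win W A Y
  for n q U :: nat and W nn od rk F ky bm Win A Y :: int +
  fixes P Q :: com and T :: nat and M :: matrix and L :: int and ord rnk :: "nat \<Rightarrow> nat \<Rightarrow> nat"
  assumes solver: "\<And>X w. (\<forall>i<n. \<forall>k<n. \<bar>X i k\<bar> \<le> int U + 1) \<Longrightarrow> (\<forall>j<n. \<forall>k<n. \<bar>w j k\<bar> \<le> int U + 1) \<Longrightarrow>
      solves_online exists_dominance_OMv (P, Q) Win n X w T"
    and regsA: "\<And>r. r \<in> regs P \<union> regs Q \<Longrightarrow> int r \<le> A"
    and Winb: "int n + int U + 1 \<le> Win" and Ab: "nn + 2 * int n \<le> A"
    and MU: "\<And>i k. i < n \<Longrightarrow> k < n \<Longrightarrow> \<bar>M i k\<bar> \<le> int U"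
    and LM: "\<And>i k. i < n \<Longrightarrow> k < n \<Longrightarrow> L \<le> M i k" and L: "- int U \<le> L" "L \<le> 0"
    and Msort: "\<And>i. i < n \<Longrightarrow> sorted_rank n (M i) (ord i) (rnk i)"
begin

section \<open>Runs of the solver whose queries become known one by one\<close>

definition vecb :: "vector \<Rightarrow> bool" where
  "vecb w \<longleftrightarrow> (\<forall>k<n. \<bar>w k\<bar> \<le> int U + 1)"

definition matb :: "matrix \<Rightarrow> bool" where
  "matb X \<longleftrightarrow> (\<forall>i<n. \<forall>k<n. \<bar>X i k\<bar> \<le> int U + 1)"

text \<open>The most recent query is the head of the list. Initial parts of runs need a notion of
  their own, since \<open>solves_online\<close> speaks about complete sequences of n queries
  only.\<close>

primrec reach :: "matrix \<Rightarrow> vector list \<Rightarrow> state \<Rightarrow> nat \<Rightarrow> bool" where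
  "reach X [] st tt \<longleftrightarrow> exec Win P (initial_state n X) tt st"
| "reach X (w # ws) st tt \<longleftrightarrow> (\<exists>st0 t0 t. reach X ws st0 t0 \<and>
     exec Win Q (receive_query n w st0) t st \<and> tt = t0 + t)"

lemma bdd_initial: "matb X \<Longrightarrow> bdd Win (initial_state n X)"
proof -
  assume X: "matb X"
  have "\<bar>X (nat a div n) (nat a mod n)\<bar> \<le> Win" if "0 \<le> a" "a < int n * int n" for a
  proof -
    have "nat a < n * n" using that by (metis nat_less_iff of_nat_mult)
    then have "nat a div n < n" "nat a mod n < n" using n0 by (auto simp: less_mult_imp_div_less)
    then have "\<bar>X (nat a div n) (nat a mod n)\<bar> \<le> int U + 1" using X unfolding matb_def by blast
    then show ?thesis using Winb by linarith
  qed
  then show ?thesis using Winb by (auto simp: bdd_def initial_state_def)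
qed

lemma bdd_receive: "vecb w \<Longrightarrow> bdd Win s \<Longrightarrow> bdd Win (receive_query n w s)"
proof -
  assume w: "vecb w" and s: "bdd Win s"
  have "\<bar>w (nat a - n * n)\<bar> \<le> Win" if "int n * int n \<le> a" "a < int n * int n + int n" for a
  proof -
    have "0 \<le> a" using that(1) zero_le_square[of "int n"] by linarith
    moreover have "a < int (n * n + n)" using that(2) by simp
    ultimately have "nat a < n * n + n" using nat_less_iff by blast
    then have "nat a - n * n < n" using n0 by linarith
    then have "\<bar>w (nat a - n * n)\<bar> \<le> int U + 1" using w unfolding vecb_def by blast
    then show ?thesis using Winb by linarith
  qed
  then show ?thesis using s by (auto simp: bdd_def receive_query_def)
qed

lemma reach_bdd: "matb X \<Longrightarrow> list_all vecb ws \<Longrightarrow> reach X ws st tt \<Longrightarrow> bdd Win st"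
proof (induction ws arbitrary: st tt)
  case Nil
  then show ?case using exec_bdd[OF _ bdd_initial] by simp
next
  case (Cons w ws)
  then obtain st0 t0 t where "reach X ws st0 t0" "exec Win Q (receive_query n w st0) t st" by auto
  moreover have "list_all vecb ws" "vecb w" using Cons.prems(2) by auto
  ultimately show ?case using Cons.IH[OF Cons.prems(1)] bdd_receive exec_bdd by blast
qed

text \<open>Execution is deterministic, so a run on the queries seen so far is the beginning of the
  run that \<open>solves_online\<close> provides for any continuation of them.\<close>

lemma reach_det:
  assumes "exec Win P (initial_state n X) t0 (s 0)"
    and "\<And>j. j < n \<Longrightarrow> exec Win Q (receive_query n (v j) (s j)) (t j) (s (Suc j))"
  shows "reach X ws st tt \<Longrightarrow> length ws \<le> n \<Longrightarrow> (\<And>j. j < length ws \<Longrightarrow> v j = rev ws ! j) \<Longrightarrow>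
    st = s (length ws) \<and> tt = t0 + (\<Sum>j<length ws. t j)"
proof (induction ws arbitrary: st tt)
  case Nil
  then show ?case using exec_deterministic[OF assms(1), of tt st] by simp
next
  case (Cons w ws)
  from Cons.prems(1) obtain st0 u0 u where st0: "reach X ws st0 u0"
    "exec Win Q (receive_query n w st0) u st" "tt = u0 + u" by auto
  have v: "v j = rev ws ! j" if "j < length ws" for j
    using Cons.prems(3)[of j] that by (simp add: nth_append)
  have IH: "st0 = s (length ws)" "u0 = t0 + (\<Sum>j<length ws. t j)"
    using Cons.IH[OF st0(1)] Cons.prems(2) v by auto
  have "v (length ws) = w" using Cons.prems(3)[of "length ws"] by (simp add: nth_append)
  then have "u = t (length ws)" "st = s (Suc (length ws))"
    using exec_deterministic[OF assms(2)[of "length ws"]] st0(2) IH Cons.prems(2) by auto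
  then show ?case using IH st0(3) by simp
qed

lemma reach_start:
  assumes "matb X"
  shows "\<exists>st tt. reach X [] st tt \<and> tt \<le> T"
proof -
  have "solves_online exists_dominance_OMv (P, Q) Win n X (\<lambda>_ _. 0) T"
    using assms by (intro solver) (auto simp: matb_def)
  then obtain s t0 t where "exec Win P (initial_state n X) t0 (s 0)" "n * n + t0 + (\<Sum>j<n. n + t j) \<le> T"
    unfolding solves_online_def by auto
  then show ?thesis by (intro exI[of _ "s 0"] exI[of _ t0]) auto
qed

text \<open>Continue the queries seen so far by copies of \<open>w\<close>. The solver is correct on
  this complete sequence, and by \<open>reach_det\<close> its run passes through \<open>st\<close>;
  its total time \<open>T\<close> bounds every initial part.\<close>

lemma reach_step:
  assumes "matb X" "list_all vecb ws" "vecb w" "length ws < n" "reach X ws st tt"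
  shows "\<exists>t st'. exec Win Q (receive_query n w st) t st' \<and> reach X (w # ws) st' (tt + t) \<and> tt + t \<le> T \<and>
    (\<forall>i<n. answer n st' i = exists_dominance_OMv n X w i)"
proof -
  let ?m = "length ws"
  define v where "v j = (if j < ?m then rev ws ! j else w)" for j
  have "vecb (v j)" for j
    using assms(2,3) nth_mem[of j "rev ws"] unfolding v_def list_all_iff by auto
  then have "solves_online exists_dominance_OMv (P, Q) Win n X v T"
    using assms(1) by (intro solver) (auto simp: matb_def vecb_def)
  then obtain s t0 t where e0: "exec Win P (initial_state n X) t0 (s 0)"
    "\<forall>j<n. exec Win Q (receive_query n (v j) (s j)) (t j) (s (Suc j)) \<and>
       (\<forall>i<n. answer n (s (Suc j)) i = exists_dominance_OMv n X (v j) i)"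
    "n * n + t0 + (\<Sum>j<n. n + t j) \<le> T"
    unfolding solves_online_def fst_conv snd_conv by blast
  then have e: "exec Win P (initial_state n X) t0 (s 0)"
    "\<And>j. j < n \<Longrightarrow> exec Win Q (receive_query n (v j) (s j)) (t j) (s (Suc j))"
    "\<And>j i. j < n \<Longrightarrow> i < n \<Longrightarrow> answer n (s (Suc j)) i = exists_dominance_OMv n X (v j) i"
    "n * n + t0 + (\<Sum>j<n. n + t j) \<le> T"
    by blast+
  have st: "st = s ?m" "tt = t0 + (\<Sum>j<?m. t j)"
    using reach_det[OF e(1,2) assms(5)] assms(4) by (auto simp: v_def)
  have vm: "v ?m = w" by (simp add: v_def)
  have "(\<Sum>j<Suc ?m. t j) \<le> (\<Sum>j<n. t j)" using assms(4) by (intro sum_mono2) auto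
  also have "\<dots> \<le> (\<Sum>j<n. n + t j)" by (intro sum_mono) simp
  finally have "tt + t ?m \<le> T" using e(4) st by simp
  moreover have ex: "exec Win Q (receive_query n w st) (t ?m) (s (Suc ?m))" using e(2)[OF assms(4)] vm st by simp
  moreover have "reach X (w # ws) (s (Suc ?m)) (tt + t ?m)" using ex assms(5) unfolding reach.simps by blast
  ultimately show ?thesis using e(3)[OF assms(4)] vm by blast
qed

text \<open>Holds from the end of the preprocessing on. \<open>vINF\<close> is only confined to an
  interval, because sorting a query may raise it.\<close>

definition static :: "(reg \<Rightarrow> int) \<Rightarrow> (int \<Rightarrow> int) \<Rightarrow> bool" where
  "static R H \<longleftrightarrow> regsok R \<and> R vL = L \<and> 0 \<le> R vINF \<and> R vINF \<le> cap \<and>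
     (\<forall>p<n * n. H (int p) = M (p div n) (p mod n) \<and> H (od + int p) = int (ord (p div n) (p mod n)) \<and>
        H (rk + int p) = int (rnk (p div n) (p mod n)))"

definition qstatic :: "vector \<Rightarrow> (nat \<Rightarrow> nat) \<Rightarrow> (nat \<Rightarrow> nat) \<Rightarrow> (int \<Rightarrow> int) \<Rightarrow> bool" where
  "qstatic v ov rv H \<longleftrightarrow> (\<forall>k<n. H (nn + int k) = v k \<and> H (od + nn + int k) = int (ov k) \<and>
      H (rk + nn + int k) = int (rv k))"

text \<open>
  Instance \<open>2 * g + x\<close> treats group \<open>g\<close> of the order of \<open>v\<close> if \<open>x = 0\<close>, and group \<open>g\<close> of the
  order of each row if \<open>x = 1\<close>. As future queries are unknown when the latter instances are built,
  their queries are clamped at the lower bound \<open>L\<close> of the matrix.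
\<close>
definition Xm :: "nat \<Rightarrow> nat \<Rightarrow> nat \<Rightarrow> matrix" where
  "Xm s x = (\<lambda>g i k. if x = 0 then M i k else if rnk i k div s = g then - M i k else 1 - L)"

text \<open>\<open>L - 1\<close> lies below all entries of the matrix, and \<open>1 - L\<close>
  above all clamped queries, so masked entries never are witnesses. Clamping preserves witnesses: if
  \<open>v k < L\<close>, then \<open>v k \<le> M i k\<close>, and \<open>- M i k \<le> - L\<close>
  holds as well.\<close>

definition yv :: "nat \<Rightarrow> vector \<Rightarrow> (nat \<Rightarrow> nat) \<Rightarrow> nat \<Rightarrow> nat \<Rightarrow> vector" where
  "yv s v rv x g k = (if x = 0 then if rv k div s = g then v k else L - 1 else if v k < L then - L else - v k)"

lemma matb_Xm: "matb (Xm s x g)"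
proof -
  have "\<bar>Xm s x g i k\<bar> \<le> int U + 1" if "i < n" "k < n" for i k
    using MU[OF that] L unfolding Xm_def by auto
  then show ?thesis unfolding matb_def by blast
qed

lemma vecb_yv: "(\<And>k. k < n \<Longrightarrow> \<bar>v k\<bar> \<le> int U) \<Longrightarrow> vecb (yv s v rv x g)"
proof -
  assume v: "\<And>k. k < n \<Longrightarrow> \<bar>v k\<bar> \<le> int U"
  have "\<bar>yv s v rv x g k\<bar> \<le> int U + 1" if "k < n" for k
    using v[OF that] L unfolding yv_def by auto
  then show ?thesis unfolding vecb_def by blast
qed

definition zeroed :: "int \<Rightarrow> (int \<Rightarrow> int) \<Rightarrow> bool" where
  "zeroed y H \<longleftrightarrow> (\<forall>a. H (cell y a) = 0 \<and> H (cell (y + 1) a) = 0)"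

lemma idx: "p < n * n \<Longrightarrow> p div n < n \<and> p mod n < n"
  using n0 by (auto simp: less_mult_imp_div_less)

lemma rnk_less: "i < n \<Longrightarrow> k < n \<Longrightarrow> rnk i k < n"
  using Msort by (auto simp: sorted_rank_def)

lemma div_bound: "a < n \<Longrightarrow> \<bar>int a div int s\<bar> \<le> W"
proof -
  assume "a < n"
  then have "a div s < n" by (meson div_le_dividend le_less_trans)
  then have "\<bar>int (a div s)\<bar> \<le> W" using lay by linarith
  then show ?thesis by (simp add: zdiv_int)
qed

lemma nn_nat: "p < n * n \<longleftrightarrow> int p < nn" "int (n * n) = nn"
proof -
  show "int (n * n) = nn" using nn by simp
  then show "p < n * n \<longleftrightarrow> int p < nn" by (metis of_nat_less_iff)
qed

lemma build:
  assumes R: "static R H" "R vI = y" "0 \<le> y" "y \<le> Y" "R vka = int x" "x < 2" "R vg = int g" "R vS = int s"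
      "int g \<le> W" "int s \<le> W"
    and z: "zeroed y H"
  shows "wp W build (R, H) (\<lambda>t s'. t \<le> 200 * (n * n + 1) \<and> rel y (initial_state n (Xm s x g)) (snd s') \<and>
     (\<forall>b. foreign y b \<longrightarrow> snd s' b = H b) \<and> (\<forall>r. r \<notin> {vk, vy} \<longrightarrow> fst s' r = R r))"
proof -
  define val where "val p = Xm s x g (p div n) (p mod n)" for p
  define Inv where "Inv i st \<longleftrightarrow> fst st vk = int i \<and>
     (\<forall>a. snd st (cell y a) = (if 0 \<le> a \<and> a < int i then val (nat a) else 0)) \<and>
     (\<forall>r. snd st (cell (y + 1) (int r)) = (if r = 0 then int n else 0)) \<and>
     (\<forall>b. foreign y b \<longrightarrow> snd st b = H b) \<and> (\<forall>r. r \<notin> {vk, vy} \<longrightarrow> fst st r = R r)" for i st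
  let ?set = "HIf (V vka)
        (HIf (D (V vRK [+] V vk) [div] V vS [=] V vg)
          (HSet vy (N 0 [-] D (V vk))) (HSet vy (N 1 [-] V vL)))
        (HSet vy (D (V vk)))"
  let ?body = "?set ;; HPut (heapE (V vk)) (V vy) ;; incr vk"
  have rg: "R vN = int n" "R vNN = nn" "R vRK = rk" "R vL = L" using R(1) by (auto simp: static_def regsok_def)
  \<comment> \<open>Register 0 of the instance receives n, as \<open>initial_state\<close> demands;
    its other registers are still 0.\<close>
  let ?H0 = "H(cell (y + 1) 0 := int n)"
  have "wp W (HWhile (V vk [<] V vNN) ?body) (R(vk := 0), ?H0) (\<lambda>t st. t \<le> (n * n + 1) * 84 \<and> Inv (n * n) st)"
  proof (rule wp_While_for[where Inv = Inv and m = "n * n" and b = 80])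
    show "Inv 0 (R(vk := 0), ?H0)"
      using z R(3) by (auto simp: Inv_def zeroed_def cell_inject not_foreign)
    show "safe W (V vk [<] V vNN) st \<and> (aval (V vk [<] V vNN) st \<noteq> 0 \<longleftrightarrow> i < n * n)"
      if "i \<le> n * n" "Inv i st" for i st
    proof -
      have "int i \<le> nn" using that(1) nn_nat(2) by (metis of_nat_le_iff)
      then show ?thesis using that(2) rg lay nn_nat(1)[of i] by (auto simp: Inv_def)
    qed
    show "wp W ?body st (\<lambda>t st'. t \<le> 80 \<and> Inv (Suc i) st')" if "i < n * n" "Inv i st" for i st
    proof -
      obtain R' H' where st: "st = (R', H')" by (cases st)
      have r: "R' vk = int i" "R' vka = int x" "R' vRK = rk" "R' vS = int s" "R' vg = int g" "R' vL = L" "R' vI = y"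
        using that(2) R rg unfolding st by (auto simp: Inv_def)
      have i: "int i < nn" using that(1) nn_nat by simp
      have Hf: "H' b = H b" if "0 \<le> b" for b
        using that \<open>Inv i st\<close> foreign_nonneg[OF R(3)] unfolding st Inv_def by auto
      have Hi: "H' (int i) = M (i div n) (i mod n)" "H' (rk + int i) = int (rnk (i div n) (i mod n))"
        using Hf R(1) that(1) lay by (auto simp: static_def)
      note ix = idx[OF that(1)]
      have b: "\<bar>M (i div n) (i mod n)\<bar> \<le> W" "\<bar>- M (i div n) (i mod n)\<bar> \<le> W" "\<bar>1 - L\<bar> \<le> W"
        "\<bar>int (rnk (i div n) (i mod n)) div int s\<bar> \<le> W" "\<bar>L\<bar> \<le> W" "\<bar>rk + int i\<bar> \<le> W" "\<bar>int i\<bar> \<le> W" "\<bar>int i + 1\<bar> \<le> W" "\<bar>rk\<bar> \<le> W"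
        using MU[of "i div n" "i mod n"] ix L lay i div_bound[OF rnk_less, of "i div n" "i mod n" s] by linarith+
      have vb: "\<bar>val i\<bar> \<le> W" unfolding val_def Xm_def by (simp add: b)
      have gs: "int g \<le> W" "int s \<le> W" "int x \<le> W" "1 \<le> W" "int i + 1 \<le> W" using R(6,9,10) lay i by linarith+
      have heap: "safe W (heapE (V vk)) (R'(vy := u), H')" "aval (heapE (V vk)) (R'(vy := u), H') = cell y (int i)" for u
        using heapE_ok[of "V vk" "R'(vy := u)" H' y] r R(3,4) i Ab sizes gs by simp_all
      have fin: "Inv (Suc i) (R'(vy := val i, vk := int i + 1), H'(cell y (int i) := val i))"
        using that(2) R(3) unfolding st Inv_def by (auto simp: cell_inject not_foreign)
      have set: "wp W ?set st (\<lambda>t st'. t \<le> 30 \<and> st' = (R'(vy := val i), H'))"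
        using r Hi gs unfolding st val_def Xm_def
        by (simp add: wp_simps int_div_eq b)
      show ?thesis unfolding wp_Seq
        by (rule wp_mono[OF set]) (use heap fin r gs in \<open>simp add: wp_simps acost_heapE vb\<close>)
    qed
  qed auto
  moreover have "Inv (n * n) st \<Longrightarrow> rel y (initial_state n (Xm s x g)) (snd st)" for st
    unfolding Inv_def rel_def initial_state_def val_def using nn_nat by auto
  moreover have "safe W (regE 0) (R, H)" "aval (regE 0) (R, H) = cell (y + 1) 0"
    using regE_ok[of 0 R y H] R A0 by auto
  ultimately show ?thesis
    unfolding build_def using rg lay
    by (simp add: wp_Seq wp_Set wp_Put acost_regE) (erule wp_mono, auto simp: Inv_def)
qed

end

text \<open>Instance numbers are doubled because memory and registers of an instance use two
  consecutive values in \<open>cell\<close>. The parity of \<open>vx\<close> is the kind of the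
  instance, its half the group.\<close>

definition runinst :: "com \<Rightarrow> com \<Rightarrow> hcom" where
  "runinst P Q = HSet vI (N 2 [*] (V vbase [+] V vx)) ;; HSet vg (V vx [div] N 2) ;; HSet vka (V vx [mod] N 2) ;;
     HIf (V vFr) (build ;; tr P) HSkip ;; writeq ;; tr Q ;; collect"

lemma setup_regs:
  assumes "R vbase = int b" "R vx = int x'" "y = 2 * (int b + int x')" "int x' div 2 = int g" "int x' mod 2 = int x"
    and "int b + int x' \<le> W" "\<bar>y\<bar> \<le> W" "2 \<le> W" "int g \<le> W" "int x \<le> W"
    and "wp W rest (R(vI := y, vg := int g, vka := int x), H) (\<lambda>t. Q' (14 + t))"
  shows "wp W (HSet vI (N 2 [*] (V vbase [+] V vx)) ;; HSet vg (V vx [div] N 2) ;; HSet vka (V vx [mod] N 2) ;; rest)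
    (R, H) Q'"
  using assms by (simp add: wp_Seq wp_Set) (erule wp_mono, simp add: eval_nat_numeral)

lemma nat_diff_int: "int m \<le> a \<Longrightarrow> nat (a - int m) = nat a - m"
  by arith

context omv
begin

lemma writeq:
  assumes R: "static R H" "R vI = y" "0 \<le> y" "y \<le> Y" "R vka = int x" "x < 2" "R vg = int g" "R vS = int s"
      "int g \<le> W" "int s \<le> W"
    and v: "qstatic v ov rv H" "\<And>k. k < n \<Longrightarrow> \<bar>v k\<bar> \<le> int U" "\<And>k. k < n \<Longrightarrow> rv k < n"
    and z: "rel y st0 H"
  shows "wp W writeq (R, H) (\<lambda>t s'. t \<le> 150 * (n + 1) \<and> rel y (receive_query n (yv s v rv x g) st0) (snd s') \<and>
     (\<forall>b. foreign y b \<longrightarrow> snd s' b = H b) \<and> (\<forall>r. r \<notin> {vk, vy, vt} \<longrightarrow> fst s' r = R r))"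
proof -
  let ?val = "yv s v rv x g"
  define Inv where "Inv i st \<longleftrightarrow> fst st vk = int i \<and>
     (\<forall>a. snd st (cell y a) = (if nn \<le> a \<and> a < nn + int i then ?val (nat (a - nn)) else snd st0 a)) \<and>
     (\<forall>r. snd st (cell (y + 1) (int r)) = fst st0 r) \<and>
     (\<forall>b. foreign y b \<longrightarrow> snd st b = H b) \<and> (\<forall>r. r \<notin> {vk, vy, vt} \<longrightarrow> fst st r = R r)" for i st
  let ?set = "HIf (V vka)
        (HIf (V vy [<] V vL) (HSet vy (N 0 [-] V vL)) (HSet vy (N 0 [-] V vy)))
        (HIf (D (V vRK [+] V vNN [+] V vk) [div] V vS [=] V vg) HSkip (HSet vy (V vL [-] N 1)))"
  let ?body = "HSet vy (D (V vNN [+] V vk)) ;; ?set ;; HSet vt (V vNN [+] V vk) ;;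
      HPut (heapE (V vt)) (V vy) ;; incr vk"
  have rg: "R vN = int n" "R vNN = nn" "R vRK = rk" "R vL = L" using R(1) by (auto simp: static_def regsok_def)
  have "wp W (HWhile (V vk [<] V vN) ?body) (R(vk := 0), H) (\<lambda>t st. t \<le> (n + 1) * 104 \<and> Inv n st)"
  proof (rule wp_While_for[where Inv = Inv and m = "n" and b = 100])
    show "Inv 0 (R(vk := 0), H)"
      using z by (simp add: Inv_def rel_def)
    show "safe W (V vk [<] V vN) st \<and> (aval (V vk [<] V vN) st \<noteq> 0 \<longleftrightarrow> i < n)"
      if "i \<le> n" "Inv i st" for i st
      using that rg lay by (simp add: Inv_def)
    show "wp W ?body st (\<lambda>t st'. t \<le> 100 \<and> Inv (Suc i) st')" if i: "i < n" and inv: "Inv i st" for i st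
    proof -
      obtain R' H' where st: "st = (R', H')" by (cases st)
      have r: "R' vk = int i" "R' vka = int x" "R' vRK = rk" "R' vS = int s" "R' vg = int g" "R' vL = L" "R' vI = y"
          "R' vNN = nn"
        using inv R rg unfolding st by (auto simp: Inv_def)
      have Hf: "H' b = H b" if "0 \<le> b" for b
        using inv foreign_nonneg[OF R(3) that] unfolding st Inv_def by auto
      have Hi: "H' (nn + int i) = v i" "H' (rk + nn + int i) = int (rv i)"
      proof -
        have "0 \<le> nn + int i" "0 \<le> rk + nn + int i" using lay by linarith+
        then show "H' (nn + int i) = v i" "H' (rk + nn + int i) = int (rv i)"
          using Hf v(1) i unfolding qstatic_def by auto
      qed
      have b: "\<bar>v i\<bar> \<le> W" "\<bar>- v i\<bar> \<le> W" "\<bar>- L\<bar> \<le> W" "\<bar>L - 1\<bar> \<le> W"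
        "\<bar>int (rv i) div int s\<bar> \<le> W" "\<bar>L\<bar> \<le> W" "\<bar>rk + nn\<bar> \<le> W" "\<bar>rk + nn + int i\<bar> \<le> W" "\<bar>nn + int i\<bar> \<le> W" "\<bar>nn\<bar> \<le> W"
        "\<bar>int i\<bar> \<le> W" "\<bar>int i + 1\<bar> \<le> W" "\<bar>rk\<bar> \<le> W"
        using v(2)[OF i] i L lay div_bound[OF v(3)[OF i], of s] by linarith+
      have vb: "\<bar>?val i\<bar> \<le> W" unfolding yv_def by (simp add: b)
      have gs: "int g \<le> W" "int s \<le> W" "int x \<le> W" "1 \<le> W" "int i + 1 \<le> W" using R(6,9,10) lay i by linarith+
      have fin: "Inv (Suc i) (R'(vy := ?val i, vt := nn + int i, vk := int i + 1), H'(cell y (nn + int i) := ?val i))"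
        unfolding Inv_def fst_conv snd_conv
      proof (intro conjI allI impI)
        fix a
        have old: "H' (cell y a) = (if nn \<le> a \<and> a < nn + int i then ?val (nat (a - nn)) else snd st0 a)"
          using inv unfolding st Inv_def by simp
        show "(H'(cell y (nn + int i) := ?val i)) (cell y a) =
            (if nn \<le> a \<and> a < nn + int (Suc i) then ?val (nat (a - nn)) else snd st0 a)"
        proof (cases "a = nn + int i")
          case True
          then show ?thesis by simp
        next
          case False
          then have "a < nn + int (Suc i) \<longleftrightarrow> a < nn + int i" by auto
          then show ?thesis using False old R(3) by (simp add: cell_inject)
        qed
      next
        fix b assume b: "foreign y b"
        then have "b \<noteq> cell y (nn + int i)" using not_foreign by blast
        then show "(H'(cell y (nn + int i) := ?val i)) b = H b"
          using inv b unfolding st Inv_def by simp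
      next
        fix r show "(H'(cell y (nn + int i) := ?val i)) (cell (y + 1) (int r)) = fst st0 r"
          using inv R(3) unfolding st Inv_def by (simp add: cell_inject)
      next
        fix r :: reg assume "r \<notin> {vk, vy, vt}"
        then show "(R'(vy := ?val i, vt := nn + int i, vk := int i + 1)) r = R r"
          using inv unfolding st Inv_def by simp
      qed simp
      have set: "wp W ?set (R'(vy := v i), H') (\<lambda>t st'. t \<le> 30 \<and> st' = (R'(vy := ?val i), H'))"
        using r Hi gs unfolding yv_def
        by (simp add: wp_simps int_div_eq b)
      let ?R2 = "R'(vy := ?val i, vt := nn + int i)"
      have heap: "safe W (heapE (V vt)) (?R2, H')" "aval (heapE (V vt)) (?R2, H') = cell y (nn + int i)"
      proof -
        have "\<bar>nn + int i\<bar> \<le> A" using Ab i sizes by linarith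
        then show "safe W (heapE (V vt)) (?R2, H')" "aval (heapE (V vt)) (?R2, H') = cell y (nn + int i)"
          using heapE_ok[of "V vt" ?R2 H' y] r R(3,4) by (simp_all add: b)
      qed
      have "wp W (?set ;; HSet vt (V vNN [+] V vk) ;; HPut (heapE (V vt)) (V vy) ;; incr vk) (R'(vy := v i), H')
         (\<lambda>t st'. t \<le> 90 \<and> Inv (Suc i) st')"
        unfolding wp_Seq
        by (rule wp_mono[OF set]) (use heap fin r gs in \<open>simp add: wp_Set wp_Put acost_heapE vb b\<close>)
      then have "wp W (?set ;; HSet vt (V vNN [+] V vk) ;; HPut (heapE (V vt)) (V vy) ;; incr vk) (R'(vy := v i), H')
         (\<lambda>t st'. 5 + t \<le> 100 \<and> Inv (Suc i) st')"
        by (rule wp_mono) simp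
      then show ?thesis
        using r Hi gs unfolding st wp_Seq[of _ "HSet vy (D (V vNN [+] V vk))"] by (simp add: wp_Set b)
    qed
  qed auto
  moreover have "rel y (receive_query n ?val st0) (snd st)" if inv: "Inv n st" for st
  proof -
    have "nat (a - nn) = nat a - n * n" if "nn \<le> a" for a
      using nat_diff_int[of "n * n" a] that unfolding nn_nat(2) by blast
    moreover have "int (n * n + n) = nn + int n" using nn_nat(2) by simp
    ultimately show ?thesis
      using inv unfolding Inv_def rel_def receive_query_def fst_conv snd_conv nn_nat(2) by simp
  qed
  ultimately show ?thesis
    unfolding writeq_def using lay
    by (simp add: wp_Seq wp_Set) (erule wp_mono, auto simp: Inv_def)
qed

lemma collect:
  assumes R: "regsok R" "R vI = y" "0 \<le> y" "y \<le> Y" "R vka = int x" "x < 2" "R vg = int g" "int g \<le> W"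
    and z: "rel y st0 H" "\<And>i. i < n \<Longrightarrow> answer n st0 i = of_bool (Dm i)"
  shows "wp W collect (R, H) (\<lambda>t s'. t \<le> 100 * (n + 1) \<and>
     (\<forall>i<n. snd s' (F + 2 * int i + int x) = (if Dm i then int g else H (F + 2 * int i + int x))) \<and>
     (\<forall>b. (\<forall>i<n. b \<noteq> F + 2 * int i + int x) \<longrightarrow> snd s' b = H b) \<and>
     (\<forall>r. r \<notin> {vk, vt} \<longrightarrow> fst s' r = R r))"
proof -
  define Inv where "Inv i st \<longleftrightarrow> fst st vk = int i \<and>
     (\<forall>j<i. snd st (F + 2 * int j + int x) = (if Dm j then int g else H (F + 2 * int j + int x))) \<and>
     (\<forall>b. (\<forall>j<i. b \<noteq> F + 2 * int j + int x) \<longrightarrow> snd st b = H b) \<and>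
     (\<forall>r. r \<notin> {vk, vt} \<longrightarrow> fst st r = R r)" for i st
  let ?body = "HSet vt (V vNN [+] V vN [+] V vk) ;;
      HIf (D (heapE (V vt))) (HPut (V vF [+] N 2 [*] V vk [+] V vka) (V vg)) HSkip ;; incr vk"
  have rg: "R vN = int n" "R vNN = nn" "R vF = F" using R(1) by (auto simp: regsok_def)
  have "wp W (HWhile (V vk [<] V vN) ?body) (R(vk := 0), H) (\<lambda>t st. t \<le> (n + 1) * 84 \<and> Inv n st)"
  proof (rule wp_While_for[where Inv = Inv and m = "n" and b = 80])
    show "Inv 0 (R(vk := 0), H)" by (simp add: Inv_def)
    show "safe W (V vk [<] V vN) st \<and> (aval (V vk [<] V vN) st \<noteq> 0 \<longleftrightarrow> i < n)"
      if "i \<le> n" "Inv i st" for i st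
      using that rg lay by (simp add: Inv_def)
    show "wp W ?body st (\<lambda>t st'. t \<le> 80 \<and> Inv (Suc i) st')" if i: "i < n" and inv: "Inv i st" for i st
    proof -
      obtain R' H' where st: "st = (R', H')" by (cases st)
      have r: "R' vk = int i" "R' vka = int x" "R' vg = int g" "R' vI = y" "R' vNN = nn" "R' vF = F" "R' vN = int n"
        using inv R rg unfolding st by (auto simp: Inv_def)
      have "cell y (nn + int n + int i) \<noteq> F + 2 * int j + int x" for j
        using cell_neg[OF R(3), of "nn + int n + int i"] lay by linarith
      then have "H' (cell y (nn + int n + int i)) = H (cell y (nn + int n + int i))"
        using inv unfolding st Inv_def by simp
      also have "\<dots> = of_bool (Dm i)"
        using z(1) z(2)[OF i] nn unfolding rel_def answer_def by simp
      finally have Hi: "H' (cell y (nn + int n + int i)) = of_bool (Dm i)" .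
      have HF: "H' (F + 2 * int i + int x) = H (F + 2 * int i + int x)"
        using inv unfolding st Inv_def by simp
      let ?R2 = "R'(vt := nn + int n + int i)"
      have heap: "safe W (heapE (V vt)) (?R2, H')" "aval (heapE (V vt)) (?R2, H') = cell y (nn + int n + int i)"
        using heapE_ok[of "V vt" ?R2 H' y] r R(3,4) i Ab sizes lay by auto
      have b: "\<bar>nn\<bar> \<le> W" "\<bar>int n\<bar> \<le> W" "\<bar>int i\<bar> \<le> W" "\<bar>nn + int n\<bar> \<le> W" "\<bar>nn + int n + int i\<bar> \<le> W" "\<bar>F\<bar> \<le> W"
        "\<bar>F + 2 * int i\<bar> \<le> W" "\<bar>2 * int i\<bar> \<le> W" "\<bar>F + 2 * int i + int x\<bar> \<le> W" "\<bar>int x\<bar> \<le> W" "\<bar>int g\<bar> \<le> W"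
        "\<bar>int i + 1\<bar> \<le> W" "2 \<le> W"
        using i lay R(6,8) by auto
      have fin: "Inv (Suc i) (R'(vt := nn + int n + int i, vk := int i + 1),
          if Dm i then H'(F + 2 * int i + int x := int g) else H')"
        using inv HF unfolding st Inv_def by (auto simp: less_Suc_eq)
      show ?thesis
        using r heap b Hi fin unfolding st by (cases "Dm i") (simp_all add: wp_simps acost_heapE)
    qed
  qed auto
  then show ?thesis
    unfolding collect_def using lay
    by (simp add: wp_Seq wp_Set) (erule wp_mono, auto simp: Inv_def)
qed

text \<open>Only an upper bound on the number of queries seen: an instance built at a later query
  has missed the earlier ones. Below n queries, the solver is still obliged to answer the next one
  within \<open>T\<close>.\<close>

definition inst :: "(int \<Rightarrow> int) \<Rightarrow> int \<Rightarrow> matrix \<Rightarrow> nat \<Rightarrow> nat \<Rightarrow> bool" where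
  "inst H y X m tt \<longleftrightarrow> (\<exists>ws st. length ws \<le> m \<and> list_all vecb ws \<and> reach X ws st tt \<and> rel y st H)"

lemma rel_foreign: "rel y st H \<Longrightarrow> (\<And>a. H' (cell y a) = H (cell y a)) \<Longrightarrow>
    (\<And>a. H' (cell (y + 1) a) = H (cell (y + 1) a)) \<Longrightarrow> rel y st H'"
  by (simp add: rel_def)

lemma static_mono:
  assumes "static R H" "\<And>b. 0 \<le> b \<Longrightarrow> b < nn \<or> od \<le> b \<and> b < od + nn \<or> rk \<le> b \<and> b < rk + nn \<Longrightarrow> H' b = H b"
    "\<And>r. r \<in> {vN, vq, vNN, vO, vRK, vF, vKy, vBm, vL, vINF} \<Longrightarrow> R' r = R r"
  shows "static R' H'"
proof -
  have "H' (int p) = H (int p)" "H' (od + int p) = H (od + int p)" "H' (rk + int p) = H (rk + int p)" if "p < n * n" for p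
    using assms(2)[of "int p"] assms(2)[of "od + int p"] assms(2)[of "rk + int p"] nn_nat(1)[of p] that lay by auto
  then show ?thesis using assms(1,3) unfolding static_def regsok_def by simp
qed

lemma qstatic_mono:
  assumes "qstatic v ov rv H" "\<And>b. nn \<le> b \<Longrightarrow> b < nn + int n \<or> od \<le> b \<and> b < F \<Longrightarrow> H' b = H b"
  shows "qstatic v ov rv H'"
proof -
  have "H' (nn + int k) = H (nn + int k)" "H' (od + nn + int k) = H (od + nn + int k)"
    "H' (rk + nn + int k) = H (rk + nn + int k)" if "k < n" for k
    using assms(2)[of "nn + int k"] assms(2)[of "od + nn + int k"] assms(2)[of "rk + nn + int k"] that lay by auto
  then show ?thesis using assms(1) unfolding qstatic_def by simp
qed

text \<open>An instance is built and preprocessed at its first use, in the middle of answering a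
  query; until then its simulated time \<open>tt\<close> is 0.\<close>

lemma prep:
  assumes R: "static R H" "R vI = y" "0 \<le> y" "y \<le> Y" "R vka = int x" "x < 2" "R vg = int g" "R vS = int s"
      "int g \<le> W" "int s \<le> W" "R vFr = of_bool fresh" "0 \<le> R vC" "R vC + int T \<le> W"
    and z: "fresh \<Longrightarrow> zeroed y H \<and> tt = 0" "\<not> fresh \<Longrightarrow> inst H y (Xm s x g) j tt"
  shows "wp W (HIf (V vFr) (build ;; tr P) HSkip) (R, H) (\<lambda>t s'. \<exists>tt'. tt \<le> tt' \<and> tt' \<le> max tt T \<and>
     inst (snd s') y (Xm s x g) j tt' \<and> fst s' vC = R vC + int (tt' - tt) \<and>
     t \<le> 100 * (tt' - tt) + (if fresh then 200 * (n * n + 1) else 0) + 10 \<and>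
     (\<forall>b. foreign y b \<longrightarrow> snd s' b = H b) \<and> (\<forall>r. r \<notin> {vk, vy, vC, vA} \<longrightarrow> fst s' r = R r))"
    (is "wp _ _ _ ?post")
proof (cases fresh)
  case False
  then have "?post 3 (R, H)" using z(2) by (intro exI[of _ tt]) auto
  then show ?thesis using False R lay by (simp add: wp_simps)
next
  case True
  let ?X = "Xm s x g"
  obtain st tt' where st: "reach ?X [] st tt'" "tt' \<le> T" using reach_start[OF matb_Xm] by blast
  have zz: "zeroed y H" "tt = 0" using z(1) True by auto
  have ex: "exec Win P (initial_state n ?X) tt' st" using st by simp
  have "wp W (build ;; tr P) (R, H) (\<lambda>t. ?post (2 + t))" unfolding wp_Seq
  proof (rule wp_mono[OF build[OF R(1-10) zz(1)]], elim conjE)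
    fix t1 s1 assume t1: "t1 \<le> 200 * (n * n + 1)" and rl: "rel y (initial_state n ?X) (snd s1)"
      and f1: "\<forall>b. foreign y b \<longrightarrow> snd s1 b = H b" and r1: "\<forall>r. r \<notin> {vk, vy} \<longrightarrow> fst s1 r = R r"
    have "wp W (tr P) (fst s1, snd s1) (simpost y st tt' (fst s1, snd s1))"
      using ex bdd_initial[OF matb_Xm] regsA R(2,3,4,12,13) rl r1 st(2) by (intro tr_sim) auto
    then show "wp W (tr P) s1 (\<lambda>t2 s2. ?post (2 + (t1 + t2)) s2)"
      unfolding prod.collapse
    proof (rule wp_mono)
      fix t2 s2 assume p: "simpost y st tt' s1 t2 s2"
      have "inst (snd s2) y ?X j tt'"
        using st(1) p unfolding inst_def simpost_def by (intro exI[of _ "[]"] exI[of _ st]) auto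
      then show "?post (2 + (t1 + t2)) s2"
        using p t1 zz True r1 f1 st(2) unfolding simpost_def by (intro exI[of _ tt']) auto
    qed
  qed
  then show ?thesis using True R lay by (simp add: wp_If)
qed

text \<open>\<open>tt\<close> is the simulated time of this instance over all queries so far.
  Charging the increase \<open>tt' - tt\<close>, and not a bound per query, is what lets an instance
  cost at most \<open>T\<close> altogether.\<close>

lemma runinst:
  fixes x' base :: nat
  defines "x \<equiv> x' mod 2" and "g \<equiv> x' div 2" and "y \<equiv> 2 * (int base + int x')"
  assumes R: "static R H" "R vbase = int base" "R vx = int x'" "y \<le> Y" "R vS = int s"
      "int s \<le> W" "R vFr = of_bool fresh" "0 \<le> R vC" "R vC + int T \<le> W"
    and v: "qstatic v ov rv H" "\<And>k. k < n \<Longrightarrow> \<bar>v k\<bar> \<le> int U" "\<And>k. k < n \<Longrightarrow> rv k < n"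
    and z: "fresh \<Longrightarrow> zeroed y H \<and> tt = 0" "\<not> fresh \<Longrightarrow> inst H y (Xm s x g) j tt" and j: "j < n"
    and tt: "tt \<le> T"
  shows "wp W (runinst P Q) (R, H) (\<lambda>t s'. \<exists>tt'. tt \<le> tt' \<and> tt' \<le> T \<and>
     inst (snd s') y (Xm s x g) (Suc j) tt' \<and> fst s' vC = R vC + int (tt' - tt) \<and>
     t \<le> 100 * (tt' - tt) + (if fresh then 200 * (n * n + 1) else 0) + 300 * (n + 1) \<and>
     (\<forall>i<n. snd s' (F + 2 * int i + int x) =
        (if \<exists>k<n. Xm s x g i k \<le> yv s v rv x g k then int g else H (F + 2 * int i + int x))) \<and>
     (\<forall>b. foreign y b \<longrightarrow> (\<forall>i<n. b \<noteq> F + 2 * int i + int x) \<longrightarrow> snd s' b = H b) \<and>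
     (\<forall>r. r \<notin> {vI, vg, vka, vk, vy, vt, vC, vA} \<longrightarrow> fst s' r = R r))"
proof -
  let ?X = "Xm s x g" and ?w = "yv s v rv x g"
  let ?R1 = "R(vI := y, vg := int g, vka := int x)"
  let ?post = "\<lambda>t s'. \<exists>tt'. tt \<le> tt' \<and> tt' \<le> T \<and>
     inst (snd s') y ?X (Suc j) tt' \<and> fst s' vC = R vC + int (tt' - tt) \<and>
     t \<le> 100 * (tt' - tt) + (if fresh then 200 * (n * n + 1) else 0) + 300 * (n + 1) \<and>
     (\<forall>i<n. snd s' (F + 2 * int i + int x) =
        (if \<exists>k<n. ?X i k \<le> ?w k then int g else H (F + 2 * int i + int x))) \<and>
     (\<forall>b. foreign y b \<longrightarrow> (\<forall>i<n. b \<noteq> F + 2 * int i + int x) \<longrightarrow> snd s' b = H b) \<and>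
     (\<forall>r. r \<notin> {vI, vg, vka, vk, vy, vt, vC, vA} \<longrightarrow> fst s' r = R r)"
  have y0: "0 \<le> y" unfolding y_def by simp
  have x2: "x < 2" unfolding x_def by simp
  have YW: "Y + 2 \<le> W" using Z_le by simp
  have "int g \<le> int x'" unfolding g_def by simp
  then have xW: "int x' \<le> W" "int g \<le> W" "int base \<le> W" "int base + int x' \<le> W" using R(4) YW unfolding y_def by auto
  have st1: "static ?R1 H" using R(1) by (rule static_mono) auto
  have vb: "vecb ?w" using vecb_yv v(2) by blast
  have pr: "wp W (HIf (V vFr) (build ;; tr P) HSkip) (?R1, H) (\<lambda>t s'. \<exists>tt'. tt \<le> tt' \<and> tt' \<le> max tt T \<and>
     inst (snd s') y ?X j tt' \<and> fst s' vC = ?R1 vC + int (tt' - tt) \<and>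
     t \<le> 100 * (tt' - tt) + (if fresh then 200 * (n * n + 1) else 0) + 10 \<and>
     (\<forall>b. foreign y b \<longrightarrow> snd s' b = H b) \<and> (\<forall>r. r \<notin> {vk, vy, vC, vA} \<longrightarrow> fst s' r = ?R1 r))"
    using R st1 y0 x2 xW z by (intro prep) auto
  have main: "wp W (HIf (V vFr) (build ;; tr P) HSkip) (?R1, H)
     (\<lambda>t1 s1. wp W writeq s1 (\<lambda>t2 s2. wp W (tr Q) s2 (\<lambda>t3 s3. wp W collect s3
       (\<lambda>t4 s4. ?post (14 + (t1 + (t2 + (t3 + t4)))) s4))))"
  proof (rule wp_mono[OF pr], elim exE conjE)
    fix t1 s1 t'
    assume t': "tt \<le> t'" "t' \<le> max tt T" and in1: "inst (snd s1) y ?X j t'"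
      and C1: "fst s1 vC = ?R1 vC + int (t' - tt)"
      and t1: "t1 \<le> 100 * (t' - tt) + (if fresh then 200 * (n * n + 1) else 0) + 10"
      and f1: "\<forall>b. foreign y b \<longrightarrow> snd s1 b = H b" and r1: "\<forall>r. r \<notin> {vk, vy, vC, vA} \<longrightarrow> fst s1 r = ?R1 r"
    obtain ws st where ws: "length ws \<le> j" "list_all vecb ws" "reach ?X ws st t'" "rel y st (snd s1)"
      using in1 unfolding inst_def by blast
    have "length ws < n" using ws(1) j by simp
    from reach_step[OF matb_Xm ws(2) vb this ws(3)] obtain u st' where
      u: "exec Win Q (receive_query n ?w st) u st'" "reach ?X (?w # ws) st' (t' + u)" "t' + u \<le> T"
        "\<And>i. i < n \<Longrightarrow> answer n st' i = exists_dominance_OMv n ?X ?w i" by blast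
    have h1: "snd s1 b = H b" if "0 \<le> b" for b using f1 foreign_nonneg[OF y0 that] by simp
    have st1': "static (fst s1) (snd s1)" by (rule static_mono[OF st1]) (use h1 r1 in auto)
    have q1: "qstatic v ov rv (snd s1)" by (rule qstatic_mono[OF v(1)]) (use h1 lay in auto)
    have rr1: "fst s1 vI = y" "fst s1 vka = int x" "fst s1 vg = int g" "fst s1 vS = int s" using r1 R(5) by auto
    note wq = writeq[OF st1' rr1(1) y0 R(4) rr1(2) x2 rr1(3,4) xW(2) R(6) q1 v(2,3) ws(4), unfolded prod.collapse]
    show "wp W writeq s1 (\<lambda>t2 s2. wp W (tr Q) s2 (\<lambda>t3 s3. wp W collect s3
       (\<lambda>t4 s4. ?post (14 + (t1 + (t2 + (t3 + t4)))) s4)))"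
    proof (rule wp_mono[OF wq], assumption, assumption, elim conjE)
      fix t2 s2
      assume t2: "t2 \<le> 150 * (n + 1)" and rl2: "rel y (receive_query n ?w st) (snd s2)"
        and f2: "\<forall>b. foreign y b \<longrightarrow> snd s2 b = snd s1 b" and r2: "\<forall>r. r \<notin> {vk, vy, vt} \<longrightarrow> fst s2 r = fst s1 r"
      have C2: "fst s2 vC = R vC + int (t' - tt)" using r2 C1 by auto
      have "wp W (tr Q) (fst s2, snd s2) (simpost y st' u (fst s2, snd s2))"
      proof (rule tr_sim[OF u(1)])
        show "bdd Win (receive_query n ?w st)" using bdd_receive[OF vb] reach_bdd[OF matb_Xm ws(2,3)] by blast
        show "fst s2 vI = y" using r2 rr1 by auto
        show "fst s2 vC + int u \<le> W" using C2 u(3) t'(1) R(9) by simp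
      qed (use regsA y0 R(4,8) rl2 C2 in auto)
      then show "wp W (tr Q) s2 (\<lambda>t3 s3. wp W collect s3
         (\<lambda>t4 s4. ?post (14 + (t1 + (t2 + (t3 + t4)))) s4))"
        unfolding prod.collapse
      proof (rule wp_mono)
        fix t3 s3 assume p3: "simpost y st' u s2 t3 s3"
        then have t3: "t3 \<le> 100 * u" and C3: "fst s3 vC = fst s2 vC + int u" and rl3: "rel y st' (snd s3)"
          and f3: "\<forall>b. foreign y b \<longrightarrow> snd s3 b = snd s2 b" and r3: "\<forall>r. r \<notin> {vC, vA} \<longrightarrow> fst s3 r = fst s2 r"
          unfolding simpost_def by blast+
        have fr3: "fst s3 r = R r" if "r \<notin> {vI, vg, vka, vk, vy, vt, vC, vA}" for r
          using r1 r2 r3 that by simp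
        have rr3: "fst s3 vI = y" "fst s3 vka = int x" "fst s3 vg = int g" using rr1 r2 r3 by auto
        have rok: "regsok (fst s3)" using R(1) fr3 unfolding static_def regsok_def by auto
        have F3: "snd s3 b = H b" if "foreign y b" for b using f1 f2 f3 that by auto
        have ans: "answer n st' i = of_bool (\<exists>k<n. ?X i k \<le> ?w k)" if "i < n" for i
          using u(4)[OF that] by (simp add: exists_dominance_OMv_def)
        note cl = collect[OF rok rr3(1) y0 R(4) rr3(2) x2 rr3(3) xW(2) rl3 ans, unfolded prod.collapse]
        show "wp W collect s3 (\<lambda>t4 s4. ?post (14 + (t1 + (t2 + (t3 + t4)))) s4)"
        proof (rule wp_mono[OF cl], assumption, elim conjE)
          fix t4 s4
          assume t4: "t4 \<le> 100 * (n + 1)"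
            and a4: "\<forall>i<n. snd s4 (F + 2 * int i + int x) =
              (if \<exists>k<n. ?X i k \<le> ?w k then int g else snd s3 (F + 2 * int i + int x))"
            and f4: "\<forall>b. (\<forall>i<n. b \<noteq> F + 2 * int i + int x) \<longrightarrow> snd s4 b = snd s3 b"
            and r4: "\<forall>r. r \<notin> {vk, vt} \<longrightarrow> fst s4 r = fst s3 r"
          have Fp: "0 \<le> F + 2 * int i + int x" for i using lay by linarith
          have "cell z a \<noteq> F + 2 * int i + int x" if "0 \<le> z" for z a i
            using cell_neg[OF that, of a] Fp[of i] by linarith
          then have "rel y st' (snd s4)"
            using f4 y0 by (intro rel_foreign[OF rl3]) simp_all
          then have "inst (snd s4) y ?X (Suc j) (t' + u)"
            using u(2) vb ws(1,2) unfolding inst_def by (intro exI[of _ "?w # ws"] exI[of _ st']) auto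
          moreover have "snd s3 (F + 2 * int i + int x) = H (F + 2 * int i + int x)" for i
            using F3 foreign_nonneg[OF y0 Fp] by blast
          then have "\<forall>i<n. snd s4 (F + 2 * int i + int x) =
              (if \<exists>k<n. ?X i k \<le> ?w k then int g else H (F + 2 * int i + int x))"
            using a4 by presburger
          moreover note u(3)
          moreover have "14 + (t1 + (t2 + (t3 + t4))) \<le>
             100 * (t' + u - tt) + (if fresh then 200 * (n * n + 1) else 0) + 300 * (n + 1)"
          proof -
            have "100 * (t' + u - tt) = 100 * (t' - tt) + 100 * u" using t'(1) by simp
            then show ?thesis using t1 t2 t3 t4 by (cases fresh) simp_all
          qed
          moreover have "fst s4 vC = R vC + int (t' + u - tt)" using r4 C3 C2 t'(1) by auto
          moreover have "fst s4 r = R r" if "r \<notin> {vI, vg, vka, vk, vy, vt, vC, vA}" for r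
            using r4 fr3 that by auto
          moreover have "snd s4 b = H b" if "foreign y b" "\<forall>i<n. b \<noteq> F + 2 * int i + int x" for b
            using f4 F3 that by simp
          moreover have "tt \<le> t' + u" using t'(1) by simp
          ultimately show "?post (14 + (t1 + (t2 + (t3 + t4)))) s4"
            by blast
        qed
      qed
    qed
  qed
  have e: "int x' div 2 = int g" "int x' mod 2 = int x" unfolding g_def x_def by (auto simp: zdiv_int zmod_int)
  have "\<bar>y\<bar> \<le> W" "2 \<le> W" using y0 R(4) YW lay by auto
  note e2 = this
  show ?thesis
    unfolding runinst_def
  proof (rule setup_regs)
    show "wp W (HIf (V vFr) (build ;; tr P) HSkip ;; writeq ;; tr Q ;; collect) (?R1, H) (\<lambda>t. ?post (14 + t))"
      unfolding wp_Seq using main .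
  qed (use R(2,3) e e2 xW x2 y_def in auto)
qed

end

subsection \<open>Choosing the group size adaptively\<close>

text \<open>The test precedes the run. Once the budget is used up, the remaining instances are
  skipped, so the counter exceeds the budget by the time of one instance at most.\<close>

definition attempt_body :: "com \<Rightarrow> com \<Rightarrow> hcom" where
  "attempt_body P Q = HSet vx (V vx [-] N 1) ;; HIf (V vC [<] V vNN [*] V vS) (runinst P Q) HSkip"

text \<open>There are two instances for each of the n / s groups, rounded up, and they are visited
  in descending order. An abandoned level moves \<open>vbase\<close> beyond its own cells, because
  the next level needs cells that still are 0.\<close>

definition attempt :: "com \<Rightarrow> com \<Rightarrow> hcom" where
  "attempt P Q = HSet vG (N 2 [*] ((V vN [+] V vS [-] N 1) [div] V vS)) ;; HSet vx (V vG) ;;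
     HWhile (N 0 [<] V vx) (attempt_body P Q) ;;
     HIf (V vC [<] V vNN [*] V vS) (HSet vDone (N 1) ;; HSet vFr (N 0))
       (HSet vbase (V vbase [+] V vG) ;; HSet vS (N 2 [*] V vS) ;; HSet vFr (N 1) ;; HSet vC (N 0))"

text \<open>\<open>Smax\<close> bounds every group size that occurs. By \<open>lev\<close>, a level
  whose instances can exhaust the budget leaves room for one more doubling. The program itself knows
  neither \<open>Smax\<close> nor \<open>T\<close>.\<close>

locale omv2 = omv n q U W nn od rk F ky bm Win A Y P Q T M L ord rnk
  for n q U :: nat and W nn od rk F ky bm Win A Y :: int and P Q :: com and T :: nat and M :: matrix
    and L :: int and ord rnk :: "nat \<Rightarrow> nat \<Rightarrow> nat" +
  fixes Smax :: nat
  assumes qn: "q \<le> n" and qS: "q \<le> Smax"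
    and lev: "\<And>s. q \<le> s \<Longrightarrow> n * n * s \<le> 2 * ((n + s - 1) div s) * T \<Longrightarrow> 2 * s \<le> Smax"
    and Yb: "8 * (int n * int Smax) \<le> Y" and Wb: "4 * (nn * int Smax) + int T + 9 \<le> W"
begin

definition G2 :: "nat \<Rightarrow> nat" where "G2 s = 2 * ((n + s - 1) div s)"

text \<open>From \<open>n \<le> q * q\<close> and \<open>q \<le> s\<close> there are at most s
  groups. Hence the O(n) overhead per instance and query adds up to O(n * s) per query, and building
  all instances takes O(n^2 * s).\<close>

lemma G2_le:
  assumes "q \<le> s"
  shows "G2 s \<le> 2 * s" "G2 s \<le> 2 * n" "n \<le> (G2 s div 2) * s"
proof -
  have s0: "0 < s" using q0 assms by simp
  have "n \<le> s * s" using nq assms mult_le_mono[OF assms assms] by linarith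
  then have "n + s - 1 < s * (s + 1)" using s0 by (simp add: algebra_simps)
  then have "(n + s - 1) div s < s + 1" using s0 by (simp add: div_less_iff_less_mult mult.commute)
  then show "G2 s \<le> 2 * s" by (simp add: G2_def)
  have "n + s - 1 < s * (n + 1)"
  proof -
    have "n * 1 \<le> n * s" using s0 by (intro mult_le_mono) auto
    then have "n + s - 1 < s + n * s" using s0 n0 by linarith
    then show ?thesis by (simp add: algebra_simps)
  qed
  then have "(n + s - 1) div s < n + 1" using s0 by (simp add: div_less_iff_less_mult mult.commute)
  then show "G2 s \<le> 2 * n" by (simp add: G2_def)
  have "n + s - 1 = (n + s - 1) div s * s + (n + s - 1) mod s" by simp
  moreover have "(n + s - 1) mod s < s" using s0 by simp
  ultimately have "n \<le> (n + s - 1) div s * s" using s0 n0 by linarith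
  then show "n \<le> (G2 s div 2) * s" by (simp add: G2_def)
qed

lemma level_sizes:
  assumes "q \<le> s" "s \<le> Smax" "base \<le> 2 * n * s"
  shows "0 < int s" "int s \<le> int n * int s" "int n * int s \<le> nn * int s" "nn * int s \<le> nn * int Smax"
    "2 * (int base + int (G2 s)) \<le> Y" "int n \<le> nn * int s" "0 < nn * int s"
    "int base \<le> 2 * (int n * int s)" "2 * int s + 2 * int n \<le> W" "nn \<le> nn * int s"
proof -
  show s0: "0 < int s" using assms(1) q0 by simp
  have "1 * int s \<le> int n * int s" using n0 by (intro mult_right_mono) auto
  then show a: "int s \<le> int n * int s" by simp
  show b: "int n * int s \<le> nn * int s" using sizes by (intro mult_right_mono) auto
  show c: "nn * int s \<le> nn * int Smax" using sizes assms by (intro mult_left_mono) auto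
  have ns: "int n * 1 \<le> int n * int s" using s0 by (intro mult_left_mono) auto
  then show "int n \<le> nn * int s" using b by simp
  then show "0 < nn * int s" using n0 by simp
  have "nn * 1 \<le> nn * int s" using s0 sizes by (intro mult_left_mono) auto
  then show "nn \<le> nn * int s" by simp
  have "int base \<le> int (2 * n * s)" using assms(3) by (simp only: of_nat_le_iff)
  then show d: "int base \<le> 2 * (int n * int s)" by simp
  have "int n * int s \<le> int n * int Smax" using assms(2) by (intro mult_left_mono) auto
  moreover have "int (G2 s) \<le> 2 * int n" using G2_le(2)[OF assms(1)] by simp
  ultimately show "2 * (int base + int (G2 s)) \<le> Y" using d ns Yb by (simp add: distrib_left)
  show "2 * int s + 2 * int n \<le> W" using a b c ns Wb sizes by linarith
qed

section \<open>First groups with a witness, and one pass over a level\<close>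

definition Wit :: "nat \<Rightarrow> vector \<Rightarrow> (nat \<Rightarrow> nat) \<Rightarrow> nat \<Rightarrow> nat \<Rightarrow> nat \<Rightarrow> bool" where
  "Wit s v rv x i g \<longleftrightarrow> (\<exists>k<n. Xm s x g i k \<le> yv s v rv x g k)"

definition instx :: "nat \<Rightarrow> nat \<Rightarrow> (int \<Rightarrow> int) \<Rightarrow> nat \<Rightarrow> nat \<Rightarrow> nat \<Rightarrow> bool" where
  "instx s base H x j tt \<longleftrightarrow> inst H (2 * (int base + int x)) (Xm s (x mod 2) (x div 2)) j tt"

text \<open>The table of first groups is not cleared between queries. A stale entry merely proposes
  further candidates, but it must be bounded, as an address is computed from it.\<close>

definition fstb :: "(int \<Rightarrow> int) \<Rightarrow> bool" where
  "fstb H \<longleftrightarrow> (\<forall>i<2 * n. 0 \<le> H (F + int i) \<and> H (F + int i) \<le> int n)"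

text \<open>Guarded by a witness, so that a row without one may keep a stale entry. Comparing the
  entry with every witness group from \<open>m\<close> on makes it the first of them.\<close>

definition found :: "nat \<Rightarrow> vector \<Rightarrow> (nat \<Rightarrow> nat) \<Rightarrow> nat \<Rightarrow> (int \<Rightarrow> int) \<Rightarrow> bool" where
  "found s v rv m H \<longleftrightarrow> (\<forall>i<n. \<forall>x<2. \<forall>g. m \<le> 2 * g + x \<longrightarrow> 2 * g + x < G2 s \<longrightarrow> Wit s v rv x i g \<longrightarrow>
     (\<exists>g'\<le>g. Wit s v rv x i g' \<and> H (F + 2 * int i + int x) = int g'))"

text \<open>The numbers given to \<open>cell\<close> are even and thus differ by at least 2, so no
  cell belongs to two instances.\<close>

lemma instx_keep:
  assumes "instx s base H x' j tt" "x \<noteq> x'"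
    and "\<And>b. foreign (2 * (int base + int x)) b \<Longrightarrow> b < 0 \<Longrightarrow> H' b = H b"
  shows "instx s base H' x' j tt"
proof -
  have "H' (cell z a) = H (cell z a)" if "z \<in> {2 * (int base + int x'), 2 * (int base + int x') + 1}" for z a
  proof (rule assms(3))
    show "foreign (2 * (int base + int x)) (cell z a)"
      using that assms(2) by (intro foreign_cell) (auto; presburger)+
    show "cell z a < 0" by (rule cell_neg) (use that in auto)
  qed
  then show ?thesis using assms(1) unfolding instx_def inst_def rel_def by (metis insertCI)
qed

lemma zeroed_keep:
  assumes "zeroed (2 * int i) H" "i \<noteq> base + x"
    and "\<And>b. foreign (2 * (int base + int x)) b \<Longrightarrow> b < 0 \<Longrightarrow> H' b = H b"
  shows "zeroed (2 * int i) H'"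
proof -
  have "H' (cell z a) = H (cell z a)" if "z \<in> {2 * int i, 2 * int i + 1}" for z a
  proof (rule assms(3))
    show "foreign (2 * (int base + int x)) (cell z a)"
      using that assms(2) by (intro foreign_cell) (auto; presburger)+
    show "cell z a < 0" by (rule cell_neg) (use that in auto)
  qed
  then show ?thesis using assms(1) unfolding zeroed_def by simp
qed

text \<open>While the step counter stays below the budget, the instances from \<open>m\<close> on have answered the
  current query, and those below \<open>m\<close> are untouched.\<close>
definition progress ::
  "nat \<Rightarrow> nat \<Rightarrow> bool \<Rightarrow> vector \<Rightarrow> (nat \<Rightarrow> nat) \<Rightarrow> nat \<Rightarrow> nat \<Rightarrow> (nat \<Rightarrow> nat) \<Rightarrow> (int \<Rightarrow> int) \<Rightarrow> bool" where
  "progress s base fresh v rv j m \<tau> H \<longleftrightarrow>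
     (\<forall>x. m \<le> x \<longrightarrow> x < G2 s \<longrightarrow> instx s base H x (Suc j) (\<tau> x)) \<and>
     (\<forall>x<m. if fresh then zeroed (2 * (int base + int x)) H \<and> \<tau> x = 0 else instx s base H x j (\<tau> x)) \<and>
     found s v rv m H"

definition tch :: "reg set" where "tch = {vI, vg, vka, vk, vy, vt, vC, vA, vx}"

text \<open>Once the budget is exceeded, the level is lost and \<open>progress\<close> is no longer
  claimed. What still matters is the bound on the times and that the cells beyond the level are
  0.\<close>

definition ainv where
  "ainv R H s base fresh v rv j m \<tau> R' H' \<longleftrightarrow>
     R' vx = int m \<and> (\<forall>r. r \<notin> tch \<longrightarrow> R' r = R r) \<and>
     (\<forall>b. 0 \<le> b \<longrightarrow> b < F \<or> F + 2 * int n \<le> b \<longrightarrow> H' b = H b) \<and> fstb H' \<and>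
     (\<forall>x<G2 s. \<tau> x \<le> T) \<and> R' vC = int (\<Sum>x<G2 s. \<tau> x) \<and> R' vC \<le> nn * int s + int T \<and>
     (\<forall>i\<ge>base + G2 s. zeroed (2 * int i) H') \<and>
     (R' vC < nn * int s \<longrightarrow> progress s base fresh v rv j m \<tau> H')"

lemma attempt_body:
  assumes R: "static R H" "R vbase = int base" "R vS = int s" "R vFr = of_bool fresh"
    and s: "q \<le> s" "s \<le> Smax" "base \<le> 2 * n * s"
    and v: "qstatic v ov rv H" "\<And>k. k < n \<Longrightarrow> \<bar>v k\<bar> \<le> int U" "\<And>k. k < n \<Longrightarrow> rv k < n" and j: "j < n"
    and m: "Suc m \<le> G2 s" and inv: "ainv R H s base fresh v rv j (Suc m) \<tau> R' H'"
  shows "wp W (attempt_body P Q) (R', H') (\<lambda>t s'. \<exists>\<tau>'. ainv R H s base fresh v rv j m \<tau>' (fst s') (snd s') \<and>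
    R' vC \<le> fst s' vC \<and>
    int t \<le> 100 * (fst s' vC - R' vC) + (if fresh then 200 * (nn + 1) else 0) + 300 * (int n + 1) + 20)"
    (is "wp _ _ _ ?post")
proof -
  note sz = level_sizes[OF s]
  let ?R1 = "R'(vx := int m)"
  have r: "R' vx = int (Suc m)" "\<And>r. r \<notin> tch \<Longrightarrow> R' r = R r"
    and h: "\<And>b. 0 \<le> b \<Longrightarrow> b < F \<or> F + 2 * int n \<le> b \<Longrightarrow> H' b = H b" and fb: "fstb H'"
    and \<tau>T: "\<And>x. x < G2 s \<Longrightarrow> \<tau> x \<le> T" and C: "R' vC = int (\<Sum>x<G2 s. \<tau> x)" "R' vC \<le> nn * int s + int T"
    and zr: "\<And>i. base + G2 s \<le> i \<Longrightarrow> zeroed (2 * int i) H'"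
    and pg: "R' vC < nn * int s \<Longrightarrow> progress s base fresh v rv j (Suc m) \<tau> H'"
    using inv unfolding ainv_def by blast+
  have m2: "int m + 1 \<le> 2 * int n" using m G2_le(2)[OF s(1)] by linarith
  have rr: "R' vN = int n" "R' vNN = nn" "R' vS = int s" "R' vbase = int base" "R' vFr = of_bool fresh"
    using r(2) R unfolding static_def regsok_def tch_def by auto
  have WW: "nn * int s + int T + 9 \<le> W" "nn \<le> W" "int s \<le> W" "int m + 2 \<le> W" "0 \<le> R' vC" "1 \<le> W" "0 \<le> nn"
    using Wb sz m2 C(1) sizes by linarith+
  have first: "wp W (HSet vx (V vx [-] N 1) ;; c) (R', H') Q' \<longleftrightarrow> wp W c (?R1, H') (\<lambda>t. Q' (4 + t))" for c Q'
    using r(1) WW by (simp add: wp_Seq wp_Set eval_nat_numeral)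
  show ?thesis
  proof (cases "R' vC < nn * int s")
    case False
    then have "ainv R H s base fresh v rv j m \<tau> ?R1 H'"
      using inv unfolding ainv_def by (auto simp: tch_def)
    then have "?post 11 (?R1, H')" using lay by (intro exI[of _ \<tau>]) auto
    then show ?thesis unfolding attempt_body_def first
      using False rr WW C(2) sz(7) by (simp add: wp_simps)
  next
    case True
    note pr = pg[OF True, unfolded progress_def]
    let ?x = "m mod 2" and ?g = "m div 2" and ?y = "2 * (int base + int m)"
    have st: "static ?R1 H'"
      by (rule static_mono[OF R(1)]) (use h r(2) lay in \<open>auto simp: tch_def\<close>)
    have qs: "qstatic v ov rv H'"
      by (rule qstatic_mono[OF v(1)]) (use h lay in auto)
    have run: "wp W (runinst P Q) (?R1, H') (\<lambda>t s'. \<exists>tt'. \<tau> m \<le> tt' \<and> tt' \<le> T \<and>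
     inst (snd s') ?y (Xm s ?x ?g) (Suc j) tt' \<and> fst s' vC = ?R1 vC + int (tt' - \<tau> m) \<and>
     t \<le> 100 * (tt' - \<tau> m) + (if fresh then 200 * (n * n + 1) else 0) + 300 * (n + 1) \<and>
     (\<forall>i<n. snd s' (F + 2 * int i + int ?x) =
        (if \<exists>k<n. Xm s ?x ?g i k \<le> yv s v rv ?x ?g k then int ?g else H' (F + 2 * int i + int ?x))) \<and>
     (\<forall>b. foreign ?y b \<longrightarrow> (\<forall>i<n. b \<noteq> F + 2 * int i + int ?x) \<longrightarrow> snd s' b = H' b) \<and>
     (\<forall>r. r \<notin> {vI, vg, vka, vk, vy, vt, vC, vA} \<longrightarrow> fst s' r = ?R1 r))"
    proof (rule runinst[OF st])
      show "2 * (int base + int m) \<le> Y" using sz(5) m by simp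
      show "fresh \<Longrightarrow> zeroed ?y H' \<and> \<tau> m = 0" using pr by (meson lessI)
      show "\<not> fresh \<Longrightarrow> inst H' ?y (Xm s ?x ?g) j (\<tau> m)" using pr unfolding instx_def by (meson lessI)
      show "?R1 vC + int T \<le> W" using True WW by simp
      show "\<tau> m \<le> T" using \<tau>T m by simp
    qed (use rr WW qs v(2,3) j in auto)
    have "wp W (runinst P Q) (?R1, H') (\<lambda>t. ?post (4 + (5 + Suc t)))"
    proof (rule wp_mono[OF run], elim exE conjE)
      fix t s' tt'
      assume tt: "\<tau> m \<le> tt'" "tt' \<le> T" and ins: "inst (snd s') ?y (Xm s ?x ?g) (Suc j) tt'"
        and C': "fst s' vC = ?R1 vC + int (tt' - \<tau> m)"
        and t: "t \<le> 100 * (tt' - \<tau> m) + (if fresh then 200 * (n * n + 1) else 0) + 300 * (n + 1)"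
        and a0: "\<forall>i<n. snd s' (F + 2 * int i + int ?x) =
          (if \<exists>k<n. Xm s ?x ?g i k \<le> yv s v rv ?x ?g k then int ?g else H' (F + 2 * int i + int ?x))"
        and f: "\<forall>b. foreign ?y b \<longrightarrow> (\<forall>i<n. b \<noteq> F + 2 * int i + int ?x) \<longrightarrow> snd s' b = H' b"
        and fr: "\<forall>r. r \<notin> {vI, vg, vka, vk, vy, vt, vC, vA} \<longrightarrow> fst s' r = ?R1 r"
      have a: "snd s' (F + 2 * int i + int ?x) =
          (if Wit s v rv ?x i ?g then int ?g else H' (F + 2 * int i + int ?x))" if "i < n" for i
        using a0 that unfolding Wit_def by blast
      define \<tau>' where "\<tau>' = \<tau>(m := tt')"
      have mG: "m < G2 s" using m by simp
      have sum': "(\<Sum>x<G2 s. \<tau>' x) = (\<Sum>x<G2 s. \<tau> x) + (tt' - \<tau> m)"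
      proof -
        have "(\<Sum>x<G2 s. \<tau>' x) = tt' + (\<Sum>x\<in>{..<G2 s} - {m}. \<tau> x)"
          unfolding \<tau>'_def using mG by (subst sum.remove[of _ m]) auto
        moreover have "(\<Sum>x<G2 s. \<tau> x) = \<tau> m + (\<Sum>x\<in>{..<G2 s} - {m}. \<tau> x)"
          using mG by (intro sum.remove) auto
        ultimately show ?thesis using tt(1) by simp
      qed
      have Fx: "0 \<le> F + 2 * int i + int ?x" for i using lay by linarith
      have neg: "snd s' b = H' b" if "foreign ?y b" "b < 0" for b
      proof -
        have "b \<noteq> F + 2 * int i + int ?x" for i using Fx[of i] that(2) by linarith
        then show ?thesis using f that(1) by blast
      qed
      have pos: "snd s' b = H' b" if "0 \<le> b" "\<And>i. i < n \<Longrightarrow> b \<noteq> F + 2 * int i + int ?x" for b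
        using f that foreign_nonneg[of ?y b] by simp
      have gn: "int ?g \<le> int n" using m2 by linarith
      have Fi: "F + int i = F + 2 * int (i div 2) + int (i mod 2)" for i by simp presburger
      have fb': "fstb (snd s')" unfolding fstb_def
      proof (intro allI impI)
        fix i assume i: "i < 2 * n"
        show "0 \<le> snd s' (F + int i) \<and> snd s' (F + int i) \<le> int n"
        proof (cases "\<exists>i'<n. F + int i = F + 2 * int i' + int ?x")
          case True
          then obtain i' where i': "i' < n" "F + int i = F + 2 * int i' + int ?x" by blast
          then show ?thesis using a fb i gn unfolding fstb_def by (metis of_nat_0_le_iff)
        next
          case False
          then have "snd s' (F + int i) = H' (F + int i)" using lay by (intro pos) auto
          then show ?thesis using fb i unfolding fstb_def by simp
        qed
      qed
      have found': "found s v rv m (snd s')" unfolding found_def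
      proof (intro allI impI)
        fix i x g assume i: "i < n" and x: "x < 2" and mg: "m \<le> 2 * g + x" "2 * g + x < G2 s" and w: "Wit s v rv x i g"
        show "\<exists>g'\<le>g. Wit s v rv x i g' \<and> snd s' (F + 2 * int i + int x) = int g'"
        proof (cases "x = ?x")
          case False
          have ne: "2 * g + x \<noteq> m" using False x by auto
          then have "Suc m \<le> 2 * g + x" using mg by simp
          then obtain g' where g': "g' \<le> g" "Wit s v rv x i g'" "H' (F + 2 * int i + int x) = int g'"
            using pr mg(2) i x w unfolding found_def by blast
          have "snd s' (F + 2 * int i + int x) = H' (F + 2 * int i + int x)"
          proof (rule pos)
            show "0 \<le> F + 2 * int i + int x" using lay by linarith
            have "x + ?x = 1" using False x by auto
            then show "F + 2 * int i + int x \<noteq> F + 2 * int i' + int ?x" for i' by presburger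
          qed
          then show ?thesis using g' by auto
        next
          case xx: True
          show ?thesis
          \<comment> \<open>Groups are visited downward. A witness in the current group is the least
            so far and overrides the entry; without one, the group in question was visited before
            and its entry remains right.\<close>
          proof (cases "Wit s v rv ?x i ?g")
            case True
            then have "snd s' (F + 2 * int i + int ?x) = int ?g" using a[OF i] by simp
            moreover have "?g \<le> g" using mg(1) xx x by presburger
            ultimately show ?thesis using True xx by auto
          next
            case False
            then have "snd s' (F + 2 * int i + int ?x) = H' (F + 2 * int i + int ?x)" using a[OF i] by simp
            moreover have "g \<noteq> ?g" using False w xx by auto
            then have "Suc m \<le> 2 * g + x" using mg(1) xx by presburger
            then obtain g' where "g' \<le> g" "Wit s v rv x i g'" "H' (F + 2 * int i + int x) = int g'"
              using pr mg(2) i x w unfolding found_def by blast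
            ultimately show ?thesis using xx by auto
          qed
        qed
      qed
      have prog: "progress s base fresh v rv j m \<tau>' (snd s')"
        unfolding progress_def
      proof (intro conjI allI impI)
        fix x assume x: "m \<le> x" "x < G2 s"
        show "instx s base (snd s') x (Suc j) (\<tau>' x)"
        proof (cases "x = m")
          case True
          then show ?thesis using ins unfolding \<tau>'_def instx_def by simp
        next
          case False
          then have "instx s base H' x (Suc j) (\<tau> x)" using pr x by simp
          then show ?thesis using instx_keep[of s base H' x _ _ m "snd s'"] False neg unfolding \<tau>'_def by auto
        qed
      next
        fix x assume x: "x < m"
        then have "x < Suc m" by simp
        then have o: "if fresh then zeroed (2 * (int base + int x)) H' \<and> \<tau> x = 0 else instx s base H' x j (\<tau> x)"
          using pr by blast
        show "if fresh then zeroed (2 * (int base + int x)) (snd s') \<and> \<tau>' x = 0 else instx s base (snd s') x j (\<tau>' x)"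
          using o x instx_keep[of s base H' x j "\<tau> x" m "snd s'"] zeroed_keep[of "base + x" H' base m "snd s'"] neg
          unfolding \<tau>'_def by (cases fresh) auto
      qed (rule found')
      have "ainv R H s base fresh v rv j m \<tau>' (fst s') (snd s')"
        unfolding ainv_def
      proof (intro conjI allI impI)
        show "fst s' vx = int m" using fr by simp
        show "fst s' r = R r" if "r \<notin> tch" for r using fr r(2)[OF that] that unfolding tch_def by simp
        show "snd s' b = H b" if "0 \<le> b" "b < F \<or> F + 2 * int n \<le> b" for b
        proof -
          have "b \<noteq> F + 2 * int i + int ?x" if "i < n" for i
            using that \<open>b < F \<or> F + 2 * int n \<le> b\<close> by linarith
          then show ?thesis using pos[of b] h[of b] that by simp
        qed
        show "\<tau>' x \<le> T" if "x < G2 s" for x using \<tau>T[OF that] tt(2) unfolding \<tau>'_def by simp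
        show "fst s' vC = int (\<Sum>x<G2 s. \<tau>' x)" using C' C(1) sum' by simp
        show "fst s' vC \<le> nn * int s + int T" using C' True tt by simp
        show "zeroed (2 * int i) (snd s')" if "base + G2 s \<le> i" for i
          using zeroed_keep[OF zr[OF that], of base m "snd s'"] neg that mG by simp
      qed (use fb' prog in auto)
      moreover have "int t \<le> 100 * (fst s' vC - R' vC) + (if fresh then 200 * (nn + 1) else 0) + 300 * (int n + 1)"
      proof -
        have "int t \<le> int (100 * (tt' - \<tau> m) + (if fresh then 200 * (n * n + 1) else 0) + 300 * (n + 1))"
          using t by (simp only: of_nat_le_iff)
        then show ?thesis using C' tt(1) nn by (cases fresh) (simp_all add: of_nat_diff)
      qed
      ultimately show "?post (4 + (5 + Suc t)) s'" using C' tt(1) by (intro exI[of _ \<tau>']) auto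
    qed
    moreover have "wp W (attempt_body P Q) (R', H') Q' \<longleftrightarrow> wp W (runinst P Q) (?R1, H') (\<lambda>t. Q' (4 + (5 + Suc t)))" for Q'
      unfolding attempt_body_def first using True rr WW sz(7) by (simp add: wp_If)
    ultimately show ?thesis by blast
  qed
qed

end

section \<open>Doubling the group size until the query is answered\<close>

definition levels :: "com \<Rightarrow> com \<Rightarrow> hcom" where
  "levels P Q = HSet vDone (N 0) ;; HWhile (V vDone [=] N 0) (attempt P Q)"

context omv2
begin

text \<open>The state between attempts. The counter and its budget belong to a level and accumulate
  over all queries served at it. The bound on \<open>base\<close> survives a doubling of
  \<open>s\<close>, as a level adds at most 2n instances.\<close>

definition dyn :: "(reg \<Rightarrow> int) \<Rightarrow> (int \<Rightarrow> int) \<Rightarrow> nat \<Rightarrow> nat \<Rightarrow> nat \<Rightarrow> bool \<Rightarrow> (nat \<Rightarrow> nat) \<Rightarrow> bool" where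
  "dyn R H j s base fresh \<tau> \<longleftrightarrow> R vS = int s \<and> R vbase = int base \<and> R vFr = of_bool fresh \<and>
     q \<le> s \<and> s \<le> Smax \<and> base \<le> 2 * n * s \<and> R vC = int (\<Sum>x<G2 s. \<tau> x) \<and> R vC < nn * int s \<and>
     (\<forall>x<G2 s. \<tau> x \<le> T) \<and>
     (\<forall>x<G2 s. if fresh then zeroed (2 * (int base + int x)) H \<and> \<tau> x = 0 else instx s base H x j (\<tau> x)) \<and>
     (\<forall>i\<ge>base + G2 s. zeroed (2 * int i) H) \<and> fstb H"

lemma dyn_cong:
  assumes "R' vS = R vS" "R' vbase = R vbase" "R' vFr = R vFr" "R' vC = R vC"
  shows "dyn R' H j s base fresh \<tau> = dyn R H j s base fresh \<tau>"
  unfolding dyn_def assms ..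

text \<open>The cost of an attempt outside the simulated steps: per instance about 200 n^2 for
  building, only if fresh, and 300 n for passing the query in and the answer out.\<close>

definition ovh :: "nat \<Rightarrow> bool \<Rightarrow> int" where
  "ovh s fresh = int (G2 s) * ((if fresh then 200 * (nn + 1) else 0) + 300 * (int n + 1) + 24) + 60"

lemma ovh_le:
  assumes "q \<le> s"
  shows "ovh s fresh \<le> (if fresh then 2500 * (nn * int s) else 1400 * (int n * int s))"
proof -
  have s0: "0 < int s" using assms q0 by simp
  have ns: "1 * 1 \<le> int n * int s" using s0 n0 by (intro mult_mono) auto
  have nns: "int n * int s \<le> nn * int s" using sizes by (intro mult_right_mono) auto
  have "int (G2 s) \<le> 2 * int s" using G2_le(1)[OF assms] by simp
  then have "int (G2 s) * ((if fresh then 200 * (nn + 1) else 0) + 300 * (int n + 1) + 24) \<le>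
      2 * int s * ((if fresh then 200 * (nn + 1) else 0) + 300 * (int n + 1) + 24)"
    using sizes by (intro mult_right_mono) auto
  also have "\<dots> \<le> 2 * int s * (if fresh then 1100 * nn else 650 * int n)"
    using sizes s0 by (intro mult_left_mono) auto
  finally show ?thesis unfolding ovh_def using ns nns by (auto simp: algebra_simps)
qed

abbreviation (input) "touched \<equiv> tch \<union> {vG, vDone, vbase, vS, vFr}"

lemma attempt:
  assumes R: "static R H" "dyn R H j s base fresh \<tau>" "R vDone = 0"
    and v: "qstatic v ov rv H" "\<And>k. k < n \<Longrightarrow> \<bar>v k\<bar> \<le> int U" "\<And>k. k < n \<Longrightarrow> rv k < n" and j: "j < n"
  shows "wp W (attempt P Q) (R, H) (\<lambda>t s'. (\<forall>r. r \<notin> touched \<longrightarrow> fst s' r = R r) \<and>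
    (\<forall>b. 0 \<le> b \<longrightarrow> b < F \<or> F + 2 * int n \<le> b \<longrightarrow> snd s' b = H b) \<and>
    (fst s' vDone = 1 \<and> (\<exists>\<tau>'. dyn (fst s') (snd s') (Suc j) s base False \<tau>') \<and> found s v rv 0 (snd s') \<and>
       int t \<le> 100 * (fst s' vC - R vC) + ovh s fresh \<or>
     fst s' vDone = 0 \<and> (\<exists>\<tau>'. dyn (fst s') (snd s') j (2 * s) (base + G2 s) True \<tau>') \<and> fst s' vC = 0 \<and>
       int t \<le> 100 * (nn * int s + int T - R vC) + ovh s fresh))"
    (is "wp _ _ _ ?post")
proof -
  have d: "R vS = int s" "R vbase = int base" "R vFr = of_bool fresh" "q \<le> s" "s \<le> Smax" "base \<le> 2 * n * s"
    "R vC = int (\<Sum>x<G2 s. \<tau> x)" "R vC < nn * int s" "\<forall>x<G2 s. \<tau> x \<le> T"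
    "\<forall>x<G2 s. if fresh then zeroed (2 * (int base + int x)) H \<and> \<tau> x = 0 else instx s base H x j (\<tau> x)"
    "\<forall>i\<ge>base + G2 s. zeroed (2 * int i) H" "fstb H"
    using R(2) unfolding dyn_def by blast+
  note sz = level_sizes[OF d(4-6)]
  define R0 where "R0 = R(vG := int (G2 s), vx := int (G2 s))"
  have rr: "R vN = int n" "R vNN = nn" using R(1) unfolding static_def regsok_def by auto
  have st0: "static R0 H" by (rule static_mono[OF R(1)]) (auto simp: R0_def)
  have G2W: "int (G2 s) \<le> 2 * int n" using G2_le(2)[OF d(4)] by simp
  have WW: "int (G2 s) \<le> W" "int n + int s \<le> W" "int s \<le> W" "2 * int s \<le> W" "2 \<le> W" "nn \<le> W" "0 \<le> nn" "nn * int s + int T + 9 \<le> W"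
    "int base + int (G2 s) \<le> W"
    using G2W sz Wb lay by linarith+
  \<comment> \<open>24 is made up of 20 steps of \<open>attempt_body\<close> and 4 of the loop
    test.\<close>
  define c where "c = (if fresh then 200 * (nn + 1) else 0) + 300 * (int n + 1) + 24"
  define Inv where "Inv i Tm st \<longleftrightarrow> (\<exists>\<tau>. ainv R0 H s base fresh v rv j (G2 s - i) \<tau> (fst st) (snd st)) \<and>
     R vC \<le> fst st vC \<and> int Tm \<le> 100 * (fst st vC - R vC) + int i * c" for i :: nat and Tm :: nat and st
  let ?w = "HWhile (N 0 [<] V vx) (attempt_body P Q)"
  let ?fin = "HIf (V vC [<] V vNN [*] V vS) (HSet vDone (N 1) ;; HSet vFr (N 0))
       (HSet vbase (V vbase [+] V vG) ;; HSet vS (N 2 [*] V vS) ;; HSet vFr (N 1) ;; HSet vC (N 0))"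
  have loop: "wp W ?w (R0, H) (\<lambda>t st. \<exists>Tm. t = Tm + 4 \<and> Inv (G2 s) Tm st)"
  proof (rule wp_While_count[where m = "G2 s" and Inv = Inv])
    have "0 < nn * int s" by (rule sz(7))
    have prog: "progress s base fresh v rv j (G2 s) \<tau> H"
      unfolding progress_def found_def using d(10) by auto
    show "Inv 0 0 (R0, H)"
      unfolding Inv_def ainv_def using d prog by (auto simp: R0_def tch_def intro!: exI[of _ \<tau>])
    show "safe W (N 0 [<] V vx) st \<and> (aval (N 0 [<] V vx) st \<noteq> 0 \<longleftrightarrow> i < G2 s)"
      if "i \<le> G2 s" "Inv i Tm st" for i Tm st
    proof -
      have "fst st vx = int (G2 s - i)" using that(2) unfolding Inv_def ainv_def by blast
      then show ?thesis using that(1) WW by auto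
    qed
    show "wp W (attempt_body P Q) st (\<lambda>t st'. Inv (Suc i) (Tm + acost (N 0 [<] V vx) + 1 + t) st')"
      if i: "i < G2 s" and inv: "Inv i Tm st" for i Tm st
    proof -
      obtain \<tau>1 where ai: "ainv R0 H s base fresh v rv j (G2 s - i) \<tau>1 (fst st) (snd st)"
        and le: "R vC \<le> fst st vC" "int Tm \<le> 100 * (fst st vC - R vC) + int i * c"
        using inv unfolding Inv_def by blast
      have e: "G2 s - i = Suc (G2 s - Suc i)" using i by simp
      have "wp W (attempt_body P Q) (fst st, snd st) (\<lambda>t s'. \<exists>\<tau>'. ainv R0 H s base fresh v rv j (G2 s - Suc i) \<tau>' (fst s') (snd s') \<and>
        fst st vC \<le> fst s' vC \<and>
        int t \<le> 100 * (fst s' vC - fst st vC) + (if fresh then 200 * (nn + 1) else 0) + 300 * (int n + 1) + 20)"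
        by (rule attempt_body[OF st0 _ _ _ d(4-6) v j]) (use d(1-3) ai e in \<open>auto simp: R0_def\<close>)
      then show ?thesis unfolding prod.collapse
      proof (rule wp_mono, elim exE conjE)
        fix t s' \<tau>'
        assume a: "ainv R0 H s base fresh v rv j (G2 s - Suc i) \<tau>' (fst s') (snd s')" and C: "fst st vC \<le> fst s' vC"
          and "int t \<le> 100 * (fst s' vC - fst st vC) + (if fresh then 200 * (nn + 1) else 0) + 300 * (int n + 1) + 20"
        then have t: "int t + 4 \<le> 100 * (fst s' vC - fst st vC) + c" unfolding c_def by simp
        have "int (Tm + acost (N 0 [<] V vx) + 1 + t) = int Tm + int t + 4" by simp
        moreover have "int (Suc i) * c = int i * c + c" by (simp add: distrib_right)
        ultimately have "int (Tm + acost (N 0 [<] V vx) + 1 + t) \<le> 100 * (fst s' vC - R vC) + int (Suc i) * c"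
          using t le(2) by (simp add: right_diff_distrib distrib_right)
        then show "Inv (Suc i) (Tm + acost (N 0 [<] V vx) + 1 + t) s'"
          unfolding Inv_def using a C le(1) by auto
      qed
    qed
  qed auto
  have fin: "wp W ?fin st (\<lambda>t. ?post (16 + (Tm + t)))" if inv: "Inv (G2 s) Tm st" for Tm st
  proof -
    obtain \<tau>1 where ai: "ainv R0 H s base fresh v rv j 0 \<tau>1 (fst st) (snd st)"
      and le: "R vC \<le> fst st vC" "int Tm \<le> 100 * (fst st vC - R vC) + int (G2 s) * c"
      using inv unfolding Inv_def by auto
    obtain R1 H1 where st: "st = (R1, H1)" by (cases st)
    have a: "\<And>r. r \<notin> tch \<Longrightarrow> R1 r = R0 r" "\<And>b. 0 \<le> b \<Longrightarrow> b < F \<or> F + 2 * int n \<le> b \<Longrightarrow> H1 b = H b"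
      "fstb H1" "\<And>x. x < G2 s \<Longrightarrow> \<tau>1 x \<le> T" "R1 vC = int (\<Sum>x<G2 s. \<tau>1 x)" "R1 vC \<le> nn * int s + int T"
      "\<And>i. base + G2 s \<le> i \<Longrightarrow> zeroed (2 * int i) H1"
      "R1 vC < nn * int s \<Longrightarrow> progress s base fresh v rv j 0 \<tau>1 H1"
      using ai unfolding ainv_def st fst_conv snd_conv by blast+
    have r1: "R1 vNN = nn" "R1 vS = int s" "R1 vbase = int base" "R1 vG = int (G2 s)" "R1 vDone = 0" "R1 vFr = of_bool fresh"
      using a(1) rr d R(3) unfolding R0_def tch_def by auto
    have fr: "R1 r = R r" if "r \<notin> touched" for r using a(1)[of r] that unfolding R0_def tch_def by auto
    have C0: "0 \<le> R1 vC" unfolding a(5) by (rule of_nat_0_le_iff)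
    show ?thesis
    proof (cases "R1 vC < nn * int s")
      case True
      let ?R2 = "R1(vDone := 1, vFr := 0)"
      have "dyn ?R2 H1 (Suc j) s base False \<tau>1"
        unfolding dyn_def using a(3-5,7) a(8)[OF True] True r1 d(4-6) unfolding progress_def by auto
      moreover have "found s v rv 0 H1" using a(8)[OF True] unfolding progress_def by simp
      moreover have "int (16 + (Tm + 10)) \<le> 100 * (R1 vC - R vC) + ovh s fresh"
        using le(2) unfolding ovh_def c_def[symmetric] st by simp
      moreover have "\<forall>r. r \<notin> touched \<longrightarrow> ?R2 r = R r" using fr by auto
      ultimately have "?post (16 + (Tm + 10)) (?R2, H1)" using a(2) by auto
      moreover have eq: "wp W ?fin (R1, H1) Q' \<longleftrightarrow> Q' 10 (?R2, H1)" for Q'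
        using True r1 WW C0 by (simp add: wp_simps) (simp add: eval_nat_numeral)
      ultimately show ?thesis unfolding st eq by blast
    next
      case False
      let ?R2 = "R1(vbase := int base + int (G2 s), vS := 2 * int s, vFr := 1, vC := 0)"
      \<comment> \<open>Each of the \<open>G2 s\<close> instances takes at most \<open>T\<close>,
        and yet the budget is exhausted. Thus \<open>n * n * s \<le> G2 s * T\<close>, the premise
        of \<open>lev\<close>.\<close>
      have "(\<Sum>x<G2 s. \<tau>1 x) \<le> (\<Sum>x<G2 s. T)" using a(4) by (intro sum_mono) auto
      then have "(\<Sum>x<G2 s. \<tau>1 x) \<le> G2 s * T" by simp
      then have "R1 vC \<le> int (G2 s * T)" unfolding a(5) by (simp only: of_nat_le_iff)
      then have "int (n * n * s) \<le> int (G2 s * T)" using False nn by simp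
      then have "n * n * s \<le> G2 s * T" by (simp only: of_nat_le_iff)
      then have S2: "2 * s \<le> Smax" using lev[OF d(4)] unfolding G2_def by simp
      have "G2 s \<le> 2 * n * s"
      proof -
        have "2 * n * 1 \<le> 2 * n * s" using d(4) q0 by (intro mult_le_mono) auto
        then show ?thesis using G2_le(2)[OF d(4)] by linarith
      qed
      then have b2: "base + G2 s \<le> 2 * n * (2 * s)" using d(6) by simp
      have z: "zeroed (2 * (int base + int (G2 s) + int x)) H1" for x
        using a(7)[of "base + G2 s + x"] by simp
      have dy: "dyn ?R2 H1 j (2 * s) (base + G2 s) True (\<lambda>_. 0)"
        unfolding dyn_def using a(3,7) r1 d(4) S2 b2 z sz(7) by auto
      have "int (16 + (Tm + 18)) \<le> 100 * (nn * int s + int T - R vC) + ovh s fresh"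
        using le(2) a(6) unfolding ovh_def c_def[symmetric] st by simp
      moreover have "\<forall>r. r \<notin> touched \<longrightarrow> ?R2 r = R r" using fr unfolding tch_def by auto
      moreover have "?R2 vDone = 0" "?R2 vC = 0" using r1 by auto
      ultimately have "?post (16 + (Tm + 18)) (?R2, H1)" unfolding fst_conv snd_conv using a(2) dy by blast
      moreover have eq: "wp W ?fin (R1, H1) Q' \<longleftrightarrow> Q' 18 (?R2, H1)" for Q'
        using False r1 WW C0 a(6) sz(7) by (simp add: wp_simps) (simp add: eval_nat_numeral)
      ultimately show ?thesis unfolding st eq by blast
    qed
  qed
  have main: "wp W (?w ;; ?fin) (R0, H) (\<lambda>t. ?post (12 + t))"
    unfolding wp_Seq
  proof (rule wp_mono[OF loop], elim exE conjE)
    fix t st Tm assume t: "t = Tm + 4" and i: "Inv (G2 s) Tm st"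
    have "12 + (t + u) = 16 + (Tm + u)" for u using t by simp
    then show "wp W ?fin st (\<lambda>t2 s2. ?post (12 + (t + t2)) s2)" using fin[OF i] by simp
  qed
  have eq: "wp W (attempt P Q) (R, H) Q' \<longleftrightarrow> wp W (?w ;; ?fin) (R0, H) (\<lambda>t. Q' (12 + t))" for Q'
  proof -
    have "int n + int s - 1 = int (n + s - 1)" using n0 by simp
    then have "(int n + int s - 1) div int s = int ((n + s - 1) div s)" by (simp only: of_nat_div)
    then have dv: "2 * ((int n + int s - 1) div int s) = int (G2 s)" unfolding G2_def by simp
    have "\<bar>(int n + int s - 1) div int s\<bar> \<le> W" using dv WW(1) by linarith
    then show ?thesis
      unfolding attempt_def R0_def wp_Seq wp_Set using rr d(1) dv WW n0
      by (simp add: eval_nat_numeral)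
  qed
  show ?thesis unfolding eq by (rule main)
qed

text \<open>
  Bounds the total time before query \<open>j\<close>, when the group size is \<open>s\<close>, reached after \<open>l\<close>
  doublings, and the current instances have used \<open>C\<close> simulated steps.
\<close>
definition pot :: "nat \<Rightarrow> nat \<Rightarrow> nat \<Rightarrow> int \<Rightarrow> bool \<Rightarrow> int" where
  "pot j s l C fresh = 100 * C + 10000 * (nn * int s) + 100 * (int l * int T) + 10000 * (int j * (int n * int s)) +
     (if fresh then 0 else 3000 * (nn * int s))"

text \<open>Doubling s increases the term \<open>10000 * (nn * int s)\<close> by its own amount,
  which pays for the whole abandoned level: this is the geometric series. The overshoot
  \<open>T\<close> is paid by the growth of \<open>l\<close>.\<close>

lemma pot_fail:
  assumes "q \<le> s"
  shows "pot j s l C fresh + 4 + (100 * (nn * int s + int T - C) + ovh s fresh) \<le> pot j (2 * s) (Suc l) 0 True"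
proof -
  define a b d e where abde: "a = nn * int s" "b = int n * int s" "d = int j * (int n * int s)" "e = int l * int T"
  have s0: "0 < int s" using assms q0 by simp
  have "1 * 1 \<le> int n * int s" using s0 n0 by (intro mult_mono) auto
  moreover have "int n * int s \<le> nn * int s" using sizes by (intro mult_right_mono) auto
  moreover have "0 \<le> int j * (int n * int s)" by simp
  ultimately have ineqs: "1 \<le> b" "b \<le> a" "0 \<le> d" unfolding abde by auto
  have 1: "pot j s l C fresh = 100 * C + 10000 * a + 100 * e + 10000 * d + (if fresh then 0 else 3000 * a)"
    unfolding pot_def abde by simp
  have 2: "pot j (2 * s) (Suc l) 0 True = 20000 * a + 100 * (e + int T) + 20000 * d"
    unfolding pot_def abde by (simp add: algebra_simps)
  have 3: "ovh s fresh \<le> (if fresh then 2500 * a else 1400 * b)"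
    using ovh_le[OF assms] unfolding abde .
  show ?thesis unfolding 1 2 abde(1)[symmetric] using 3 ineqs by (cases fresh) simp_all
qed

text \<open>When \<open>fresh\<close> becomes false, the additional
  \<open>3000 * (nn * int s)\<close> pays for building the instances. Otherwise only O(n * s) is
  spent beyond the simulated steps, which \<open>C\<close> records.\<close>

lemma pot_success:
  assumes "q \<le> s"
  shows "pot j s l C fresh + 6 + (100 * (C' - C) + ovh s fresh) \<le> pot j s l C' False + 1450 * (int n * int s)"
proof -
  define a b d e where abde: "a = nn * int s" "b = int n * int s" "d = int j * (int n * int s)" "e = int l * int T"
  have s0: "0 < int s" using assms q0 by simp
  have "1 * 1 \<le> int n * int s" using s0 n0 by (intro mult_mono) auto
  moreover have "int n * int s \<le> nn * int s" using sizes by (intro mult_right_mono) auto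
  ultimately have ineqs: "1 \<le> b" "b \<le> a" unfolding abde by auto
  have 1: "pot j s l C fresh = 100 * C + 10000 * a + 100 * e + 10000 * d + (if fresh then 0 else 3000 * a)" for C fresh
    unfolding pot_def abde by simp
  have 3: "ovh s fresh \<le> (if fresh then 2500 * a else 1400 * b)"
    using ovh_le[OF assms] unfolding abde .
  show ?thesis unfolding 1 abde(2)[symmetric] using 3 ineqs by (cases fresh) simp_all
qed

lemma levels:
  assumes R: "static R H" "dyn R H j s0 base0 fresh0 \<tau>0" "q * 2 ^ l0 = s0" "T0 \<le> pot j s0 l0 (R vC) fresh0"
    and v: "qstatic v ov rv H" "\<And>k. k < n \<Longrightarrow> \<bar>v k\<bar> \<le> int U" "\<And>k. k < n \<Longrightarrow> rv k < n" and j: "j < n"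
  shows "wp W (levels P Q) (R, H) (\<lambda>t s'. (\<forall>r. r \<notin> touched \<longrightarrow> fst s' r = R r) \<and>
    (\<forall>b. 0 \<le> b \<longrightarrow> b < F \<or> F + 2 * int n \<le> b \<longrightarrow> snd s' b = H b) \<and>
    (\<exists>s base \<tau> l. dyn (fst s') (snd s') (Suc j) s base False \<tau> \<and> found s v rv 0 (snd s') \<and> q * 2 ^ l = s \<and>
       T0 + int t \<le> pot j s l (fst s' vC) False + 1500 * (int n * int s)))"
    (is "wp _ _ _ ?post")
proof -
  define frame where "frame st \<longleftrightarrow> (\<forall>r. r \<notin> touched \<longrightarrow> fst st r = R r) \<and>
    (\<forall>b. 0 \<le> b \<longrightarrow> b < F \<or> F + 2 * int n \<le> b \<longrightarrow> snd st b = H b)" for st :: state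
  define run where "run Tm st \<longleftrightarrow> fst st vDone = 0 \<and> (\<exists>s base fresh \<tau> l. dyn (fst st) (snd st) j s base fresh \<tau> \<and>
      q * 2 ^ l = s \<and> T0 + int Tm \<le> pot j s l (fst st vC) fresh + 2)" for Tm :: nat and st :: state
  define stop where "stop Tm st \<longleftrightarrow> fst st vDone = 1 \<and> (\<exists>s base \<tau> l. dyn (fst st) (snd st) (Suc j) s base False \<tau> \<and>
      found s v rv 0 (snd st) \<and> q * 2 ^ l = s \<and> T0 + int Tm \<le> pot j s l (fst st vC) False + 1450 * (int n * int s))"
    for Tm :: nat and st :: state
  \<comment> \<open>\<open>Smax - s\<close> decreases with each doubling; the successor leaves 0 for
    the moment when the query has been answered.\<close>
  define m where "m st = (if fst st vDone \<noteq> 0 then 0 else Suc (Smax - nat (fst st vS)))" for st :: state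
  have main: "wp W (HWhile (V vDone [=] N 0) (attempt P Q)) (R(vDone := 0), H) (\<lambda>t. ?post (2 + t))"
  proof (rule wp_While_measure[where Inv = "\<lambda>Tm st. frame st \<and> (run Tm st \<or> stop Tm st)" and m = m and T = 2])
    have "dyn (R(vDone := 0)) H j s0 base0 fresh0 \<tau>0" using R(2) dyn_cong[of "R(vDone := 0)" R] by simp
    moreover have "T0 + int 2 \<le> pot j s0 l0 ((R(vDone := 0)) vC) fresh0 + 2" using R(4) by simp
    ultimately have "run 2 (R(vDone := 0), H)" using R(3) unfolding run_def fst_conv snd_conv by auto
    moreover have "frame (R(vDone := 0), H)" unfolding frame_def by simp
    ultimately show "frame (R(vDone := 0), H) \<and> (run 2 (R(vDone := 0), H) \<or> stop 2 (R(vDone := 0), H))" by blast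
    show "safe W (V vDone [=] N 0) st" if "frame st \<and> (run Tm st \<or> stop Tm st)" for Tm st
    proof -
      have "fst st vDone = 0 \<or> fst st vDone = 1" using that unfolding run_def stop_def by blast
      then show ?thesis using lay by auto
    qed
    show "?post (Tm + acost (V vDone [=] N 0) + 1) st"
      if "frame st \<and> (run Tm st \<or> stop Tm st)" "aval (V vDone [=] N 0) st = 0" for Tm st
    proof -
      have "fst st vDone \<noteq> 0" using that(2) by simp
      then have fr: "frame st" and "stop Tm st" using that(1) unfolding run_def by blast+
      then obtain s base \<tau> l where *: "dyn (fst st) (snd st) (Suc j) s base False \<tau>" "found s v rv 0 (snd st)"
        "q * 2 ^ l = s" "T0 + int Tm \<le> pot j s l (fst st vC) False + 1450 * (int n * int s)"
        unfolding stop_def by blast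
      have "1 * 1 \<le> int n * int s" using *(1) n0 q0 unfolding dyn_def by (intro mult_mono) auto
      then have tm: "T0 + int (Tm + acost (V vDone [=] N 0) + 1) \<le> pot j s l (fst st vC) False + 1500 * (int n * int s)"
        using *(4) by simp
      have fr2: "\<forall>r. r \<notin> touched \<longrightarrow> fst st r = R r"
        "\<forall>b. 0 \<le> b \<longrightarrow> b < F \<or> F + 2 * int n \<le> b \<longrightarrow> snd st b = H b"
        using fr unfolding frame_def by blast+
      show ?thesis
        by (rule conjI[OF fr2(1) conjI[OF fr2(2)]], rule exI[of _ s], rule exI[of _ base], rule exI[of _ \<tau>],
            rule exI[of _ l]) (intro conjI *(1,2,3) tm)
    qed
    show "wp W (attempt P Q) st (\<lambda>t s'. (frame s' \<and>
        (run (Tm + acost (V vDone [=] N 0) + 1 + t) s' \<or> stop (Tm + acost (V vDone [=] N 0) + 1 + t) s')) \<and> m s' < m st)"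
      if "frame st \<and> (run Tm st \<or> stop Tm st)" "aval (V vDone [=] N 0) st \<noteq> 0" for Tm st
    proof -
      have "fst st vDone \<noteq> 1" using that(2) by simp
      then have fr: "frame st" and "run Tm st" using that(1) unfolding stop_def by blast+
      then obtain s base fresh \<tau> l where *: "dyn (fst st) (snd st) j s base fresh \<tau>" "q * 2 ^ l = s"
        "T0 + int Tm \<le> pot j s l (fst st vC) fresh + 2" and d0: "fst st vDone = 0"
        unfolding run_def by blast
      have sS: "q \<le> s" "fst st vS = int s" using *(1) unfolding dyn_def by auto
      have s0: "0 < s" using sS(1) q0 by simp
      have fr1: "\<And>r. r \<notin> touched \<Longrightarrow> fst st r = R r"
        "\<And>b. 0 \<le> b \<Longrightarrow> b < F \<or> F + 2 * int n \<le> b \<Longrightarrow> snd st b = H b"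
        using fr unfolding frame_def by blast+
      have st: "static (fst st) (snd st)"
        by (rule static_mono[OF R(1)]) (use fr1 lay in \<open>auto simp: tch_def\<close>)
      have qs: "qstatic v ov rv (snd st)"
        by (rule qstatic_mono[OF v(1)]) (use fr1 lay in auto)
      show ?thesis
      proof (rule wp_mono[OF attempt[OF st *(1) d0 qs v(2,3) j, unfolded prod.collapse]], assumption, assumption, elim conjE)
        fix t s'
        assume r': "\<forall>r. r \<notin> touched \<longrightarrow> fst s' r = fst st r"
          and h': "\<forall>b. 0 \<le> b \<longrightarrow> b < F \<or> F + 2 * int n \<le> b \<longrightarrow> snd s' b = snd st b"
          and cs: "fst s' vDone = 1 \<and> (\<exists>\<tau>'. dyn (fst s') (snd s') (Suc j) s base False \<tau>') \<and> found s v rv 0 (snd s') \<and>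
             int t \<le> 100 * (fst s' vC - fst st vC) + ovh s fresh \<or>
           fst s' vDone = 0 \<and> (\<exists>\<tau>'. dyn (fst s') (snd s') j (2 * s) (base + G2 s) True \<tau>') \<and> fst s' vC = 0 \<and>
             int t \<le> 100 * (nn * int s + int T - fst st vC) + ovh s fresh"
        have fr': "frame s'" using r' h' fr1 unfolding frame_def by simp
        let ?t = "Tm + acost (V vDone [=] N 0) + 1 + t"
        have tt: "int ?t = int Tm + 4 + int t" by simp
        from cs show "(frame s' \<and> (run ?t s' \<or> stop ?t s')) \<and> m s' < m st"
        proof (elim disjE conjE exE)
          fix \<tau>' assume c: "fst s' vDone = 1" "dyn (fst s') (snd s') (Suc j) s base False \<tau>'" "found s v rv 0 (snd s')"
            "int t \<le> 100 * (fst s' vC - fst st vC) + ovh s fresh"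
          have "T0 + int ?t \<le> pot j s l (fst s' vC) False + 1450 * (int n * int s)"
            unfolding tt using pot_success[OF sS(1), of j l "fst st vC" fresh "fst s' vC"] c(4) *(3) by linarith
          then have "stop ?t s'" unfolding stop_def using c *(2) by blast
          then show ?thesis using fr' c(1) d0 unfolding m_def by simp
        next
          fix \<tau>' assume c: "fst s' vDone = 0" "dyn (fst s') (snd s') j (2 * s) (base + G2 s) True \<tau>'" "fst s' vC = 0"
            "int t \<le> 100 * (nn * int s + int T - fst st vC) + ovh s fresh"
          have "T0 + int ?t \<le> pot j (2 * s) (Suc l) (fst s' vC) True + 2"
            unfolding tt c(3) using pot_fail[OF sS(1), of j l "fst st vC" fresh] c(4) *(3) by linarith
          moreover have "q * 2 ^ Suc l = 2 * s" using *(2) by simp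
          ultimately have "run ?t s'" unfolding run_def using c by blast
          moreover have "2 * s \<le> Smax" "fst s' vS = int (2 * s)" using c(2) unfolding dyn_def by auto
          then have "m s' < m st" unfolding m_def using c(1) d0 sS s0 by simp
          ultimately show ?thesis using fr' by simp
        qed
      qed
    qed
  qed
  have eq: "wp W (levels P Q) (R, H) Q' \<longleftrightarrow>
      wp W (HWhile (V vDone [=] N 0) (attempt P Q)) (R(vDone := 0), H) (\<lambda>t. Q' (2 + t))" for Q'
    unfolding levels_def wp_Seq wp_Set using lay by simp
  show ?thesis unfolding eq by (rule main)
qed

end

subsection \<open>Answering a query\<close>

definition cand :: hcom where
  "cand = HSet vy (D (V vi [*] V vN [+] V vk)) ;; HSet vm (D (V vNN [+] V vk)) ;;
     HIf (V vy [<] V vm) (HSet vy (V vm)) HSkip"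

text \<open>One counter runs through both candidate groups: its parity selects the kind, its half
  the place within the group. The position may be n or more, in an incomplete last group or for a
  stale entry.\<close>

definition scan_body :: hcom where
  "scan_body = HSet vka (V vj [mod] N 2) ;;
      HSet vt (D (V vF [+] N 2 [*] V vi [+] V vka) [*] V vS [+] V vj [div] N 2) ;;
      HIf (V vt [<] V vN)
       (HIf (V vka) (HSet vt (V vt [+] V vi [*] V vN)) (HSet vt (V vt [+] V vNN)) ;;
        HSet vk (D (V vO [+] V vt)) ;;
        cand ;;
        HIf (V vy [<] V vbest) (HSet vbest (V vy)) HSkip)
       HSkip ;;
      incr vj"

text \<open>Starting with the candidate k = 0 makes \<open>vbest\<close> the value of an actual
  index from the beginning.\<close>

definition finish_body :: hcom where
  "finish_body = HSet vk (N 0) ;; cand ;; HSet vbest (V vy) ;; HSet vj (N 0) ;;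
     HWhile (V vj [<] V vS [+] V vS) scan_body ;;
     HPut (V vNN [+] V vN [+] V vi) (V vbest) ;; incr vi"

definition finish :: hcom where
  "finish = HSet vi (N 0) ;; HWhile (V vi [<] V vN) finish_body"

definition query :: "com \<Rightarrow> com \<Rightarrow> hcom" where
  "query P Q = HSet vB (V vNN) ;; sortrow ;; levels P Q ;; finish"

text \<open>If g is the group of k, then k itself is found there. Otherwise g is an earlier group,
  so its member k' precedes k in the sorted order and its value is not larger.\<close>

lemma group_min:
  assumes so: "sorted_rank n a od rk" and mx: "\<And>k. k < n \<Longrightarrow> a k \<le> mx k"
    and k: "k < n" "mx k = a k" and k': "k' < n" "mx k' = a k'" "rk k' div s = g" and g: "g \<le> rk k div s"
  shows "\<exists>t<n. t div s = g \<and> mx (od t) \<le> (mx k :: int)"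
proof -
  have r: "rk k < n" "od (rk k) = k" "rk k' < n" "od (rk k') = k'"
    using so k(1) k'(1) unfolding sorted_rank_def by blast+
  show ?thesis
  proof (cases "g = rk k div s")
    case True
    then show ?thesis using r by (intro exI[of _ "rk k"] conjI) simp_all
  next
    case False
    have "rk k' \<le> rk k"
    proof (rule ccontr)
      assume "\<not> rk k' \<le> rk k"
      then have "rk k div s \<le> rk k' div s" by (intro div_le_mono) auto
      then show False using False g k'(3) by simp
    qed
    then have "a k' \<le> a k" using so k(1) k'(1) unfolding sorted_rank_def by blast
    then show ?thesis using r k k' by (intro exI[of _ "rk k'"] conjI) simp_all
  qed
qed

context omv2
begin

definition ksel :: "(nat \<Rightarrow> nat) \<Rightarrow> nat \<Rightarrow> nat \<Rightarrow> nat \<Rightarrow> nat" where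
  "ksel ov i x t = (if x = 0 then ov t else ord i t)"

text \<open>Take a minimizer k. If \<open>M i k \<le> v k\<close>, its group in the order of v has a
  witness, otherwise its group in the order of row i. The first group with a witness is not later,
  so \<open>group_min\<close> applies to it.\<close>

lemma found_min:
  assumes f: "found s v rv 0 H" and s: "q \<le> s" and so: "sorted_rank n v ov rv" and i: "i < n"
  shows "\<exists>x<2. \<exists>t<n. H (F + 2 * int i + int x) = int (t div s) \<and>
     (\<forall>k<n. max (M i (ksel ov i x t)) (v (ksel ov i x t)) \<le> max (M i k) (v k))"
proof -
  let ?mx = "\<lambda>k. max (M i k) (v k)"
  have s0: "0 < s" using s q0 by simp
  obtain k where k: "k < n" "\<And>k'. k' < n \<Longrightarrow> ?mx k \<le> ?mx k'"
  proof -
    have "\<exists>k. is_arg_min ?mx (\<lambda>k. k \<in> {..<n}) k" using n0 by (intro ex_is_arg_min_if_finite) auto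
    then obtain k where "k < n" "\<forall>k'<n. ?mx k \<le> ?mx k'" unfolding is_arg_min_linorder by (meson lessThan_iff)
    then show thesis using that by blast
  qed
  have grp: "2 * (r div s) + x < G2 s" if "r < n" "x < 2" for r x
  proof -
    have "r < (G2 s div 2) * s" using that G2_le(3)[OF s] by simp
    then have "r div s < G2 s div 2" using s0 by (simp add: div_less_iff_less_mult)
    then show ?thesis using that(2) by linarith
  qed
  show ?thesis
  proof (cases "M i k \<le> v k")
    case True
    let ?g = "rv k div s"
    have rk: "rv k < n" using so k(1) unfolding sorted_rank_def by blast
    have w: "Wit s v rv 0 i ?g" unfolding Wit_def Xm_def yv_def using True k(1) by (intro exI[of _ k]) simp
    have "\<exists>g'\<le>?g. Wit s v rv 0 i g' \<and> H (F + 2 * int i + int 0) = int g'"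
      by (rule f[unfolded found_def, rule_format, OF i _ _ _ w]) (use grp[OF rk, of 0] in simp_all)
    then obtain g' where g': "g' \<le> ?g" "Wit s v rv 0 i g'" "H (F + 2 * int i + int 0) = int g'"
      by blast
    from g'(2) obtain k' where "k' < n" "M i k' \<le> (if rv k' div s = g' then v k' else L - 1)"
      unfolding Wit_def Xm_def yv_def by auto
    \<comment> \<open>\<open>L - 1\<close> lies below \<open>M i k'\<close>, so k' is not a masked
      entry.\<close>
    then have k': "k' < n" "rv k' div s = g'" "M i k' \<le> v k'" using LM[OF i, of k'] by (auto split: if_splits)
    have "\<exists>t<n. t div s = g' \<and> ?mx (ov t) \<le> ?mx k"
      by (rule group_min[OF so, of ?mx k k' s g']) (use k(1) k' g'(1) True in auto)
    then obtain t where t: "t < n" "t div s = g'" "?mx (ov t) \<le> ?mx k" by blast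
    have "?mx (ov t) \<le> ?mx k'" if "k' < n" for k' using t(3) k(2)[OF that] by linarith
    then show ?thesis
      using t(1,2) g'(3) by (intro exI[of _ 0] conjI exI[of _ t]) (simp_all add: ksel_def)
  next
    case False
    let ?g = "rnk i k div s"
    note so' = Msort[OF i]
    have rk: "rnk i k < n" using so' k(1) unfolding sorted_rank_def by blast
    have w: "Wit s v rv 1 i ?g" unfolding Wit_def Xm_def yv_def using False k(1) LM[OF i k(1)]
      by (intro exI[of _ k]) simp
    have "\<exists>g'\<le>?g. Wit s v rv 1 i g' \<and> H (F + 2 * int i + int 1) = int g'"
      by (rule f[unfolded found_def, rule_format, OF i _ _ _ w]) (use grp[OF rk, of 1] in simp_all)
    then obtain g' where g': "g' \<le> ?g" "Wit s v rv 1 i g'" "H (F + 2 * int i + int 1) = int g'"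
      by blast
    from g'(2) obtain k' where "k' < n" "(if rnk i k' div s = g' then - M i k' else 1 - L) \<le> (if v k' < L then - L else - v k')"
      unfolding Wit_def Xm_def yv_def by auto
    \<comment> \<open>\<open>1 - L\<close> exceeds both possible right sides, so k' is not masked.
      If its query entry was clamped, then \<open>v k' < L\<close> and
      \<open>L \<le> M i k'\<close>.\<close>
    then have k': "k' < n" "rnk i k' div s = g'" "v k' \<le> M i k'" using LM[OF i, of k'] by (auto split: if_splits)
    have "\<exists>t<n. t div s = g' \<and> ?mx (ord i t) \<le> ?mx k"
      by (rule group_min[OF so', of ?mx k k' s g']) (use k(1) k' g'(1) False in auto)
    then obtain t where t: "t < n" "t div s = g'" "?mx (ord i t) \<le> ?mx k" by blast
    have "?mx (ord i t) \<le> ?mx k'" if "k' < n" for k' using t(3) k(2)[OF that] by linarith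
    then show ?thesis
      using t(1,2) g'(3) by (intro exI[of _ 1] conjI exI[of _ t]) (simp_all add: ksel_def)
  qed
qed

lemma idx2:
  assumes "i < n" "k < n"
  shows "i * n + k < n * n" "(i * n + k) div n = i" "(i * n + k) mod n = k" "int i * int n + int k < nn"
    "0 \<le> int i * int n" "int i * int n \<le> nn"
proof -
  have "(i + 1) * n \<le> n * n" using assms by (intro mult_le_mono) auto
  then show lt: "i * n + k < n * n" using assms by simp
  show "(i * n + k) div n = i" "(i * n + k) mod n = k" using assms by auto
  show 1: "int i * int n + int k < nn" using lt nn_nat(1)[of "i * n + k"] by simp
  show "0 \<le> int i * int n" by simp
  show "int i * int n \<le> nn" using 1 by linarith
qed

lemma cand:
  assumes R: "static R H" "R vi = int i" "R vk = int k" "i < n" "k < n"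
    and v: "qstatic v ov rv H" "\<And>k. k < n \<Longrightarrow> \<bar>v k\<bar> \<le> int U"
  shows "wp W cand (R, H) (\<lambda>t s'. t \<le> 30 \<and> snd s' = H \<and> fst s' vy = max (M i k) (v k) \<and>
     (\<forall>r. r \<notin> {vy, vm} \<longrightarrow> fst s' r = R r))"
proof -
  note ix = idx2[OF R(4,5)]
  have r: "R vN = int n" "R vNN = nn" using R(1) by (auto simp: static_def regsok_def)
  have "H (int (i * n + k)) = M i k" using R(1) ix unfolding static_def by metis
  then have h: "H (int i * int n + int k) = M i k" "H (nn + int k) = v k"
    using v(1) R(5) unfolding qstatic_def by simp_all
  have b: "\<bar>M i k\<bar> \<le> W" "\<bar>v k\<bar> \<le> W" using MU[OF R(4,5)] v(2)[OF R(5)] lay by linarith+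
  have "int i * int n \<le> W" "int i * int n + int k \<le> W" "nn + int k \<le> W" "int i \<le> W" "int k \<le> W" "int n \<le> W" "nn \<le> W"
    "0 \<le> nn" "1 \<le> W"
    using ix R(4,5) lay by linarith+
  then show ?thesis unfolding cand_def using r R(2,3) h ix(5) by (simp add: wp_simps b max_def)
qed

text \<open>\<open>vbest\<close> always is the value of some index, hence never below the minimum.
  This is why candidates from stale entries cannot spoil the result.\<close>

definition sinv where
  "sinv R H s v ov i p st \<longleftrightarrow> snd st = H \<and> fst st vj = int p \<and>
     (\<forall>r. r \<notin> {vk, vy, vm, vbest, vj, vka, vt} \<longrightarrow> fst st r = R r) \<and>
     (\<exists>k<n. fst st vbest = max (M i k) (v k)) \<and>
     (\<forall>x<2. \<forall>t<n. H (F + 2 * int i + int x) = int (t div s) \<longrightarrow> 2 * (t mod s) + x < p \<longrightarrow>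
        fst st vbest \<le> max (M i (ksel ov i x t)) (v (ksel ov i x t)))"

lemma scan_body:
  assumes R: "static R H" "R vi = int i" "i < n" "R vS = int s" "fstb H"
    and s: "q \<le> s" "s \<le> Smax"
    and v: "qstatic v ov rv H" "\<And>k. k < n \<Longrightarrow> \<bar>v k\<bar> \<le> int U" "sorted_rank n v ov rv"
    and p: "p < 2 * s" and inv: "sinv R H s v ov i p st"
  shows "wp W scan_body st (\<lambda>t st'. t \<le> 100 \<and> sinv R H s v ov i (Suc p) st')"
proof -
  obtain R1 where st: "st = (R1, H)" using inv unfolding sinv_def by (cases st) auto
  have fr: "\<And>r. r \<notin> {vk, vy, vm, vbest, vj, vka, vt} \<Longrightarrow> R1 r = R r" and pj: "R1 vj = int p"
    and best: "\<exists>k<n. R1 vbest = max (M i k) (v k)"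
    and bl: "\<And>x t. x < 2 \<Longrightarrow> t < n \<Longrightarrow> H (F + 2 * int i + int x) = int (t div s) \<Longrightarrow> 2 * (t mod s) + x < p \<Longrightarrow>
        R1 vbest \<le> max (M i (ksel ov i x t)) (v (ksel ov i x t))"
    using inv unfolding st sinv_def fst_conv snd_conv by blast+
  have r: "R1 vN = int n" "R1 vNN = nn" "R1 vO = od" "R1 vF = F" "R1 vS = int s" "R1 vi = int i"
    using fr R(1,2,4) by (auto simp: static_def regsok_def)
  have s0: "0 < s" using s q0 by simp
  define x where "x = p mod 2"
  have x2: "x < 2" unfolding x_def by simp
  have "2 * i + x < 2 * n" using x2 R(3) by linarith
  then have "0 \<le> H (F + int (2 * i + x)) \<and> H (F + int (2 * i + x)) \<le> int n"
    using R(5) unfolding fstb_def by blast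
  \<comment> \<open>Stale or not, the entry is a natural number at most n, which keeps the positions
    computed from it within words.\<close>
  then obtain g where g: "H (F + 2 * int i + int x) = int g" "g \<le> n"
    by (metis (no_types, opaque_lifting) add.assoc nonneg_int_cases of_nat_add of_nat_le_iff of_nat_mult of_nat_numeral)
  define t where "t = g * s + p div 2"
  have p2: "p div 2 < s" using p by linarith
  have td: "t div s = g" "t mod s = p div 2" unfolding t_def using p2 by auto
  have pe: "p = 2 * (p div 2) + x" unfolding x_def by simp
  have gs: "int g * int s \<le> int n * int s" using g(2) by (intro mult_right_mono) auto
  have ss: "int s \<le> int n * int s" "int n * int s \<le> nn * int s" "nn * int s \<le> nn * int Smax"
    using level_sizes[OF s, of 0] by auto
  have intp: "int p div 2 = int (p div 2)" "int p mod 2 = int x" unfolding x_def by (simp_all add: zdiv_int zmod_int)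
  have tW: "int g * int s + int (p div 2) = int t" unfolding t_def by simp
  have p2s: "int (p div 2) < int s" using p2 by simp
  have tb: "int t + nn + 9 \<le> W"
  proof -
    have "nn \<le> nn * int s" using level_sizes[OF s, of 0] by auto
    then show ?thesis using tW gs ss p2s Wb by linarith
  qed
  let ?R2 = "R1(vka := int x, vt := int t)"
  let ?sel = "HIf (V vka) (HSet vt (V vt [+] V vi [*] V vN)) (HSet vt (V vt [+] V vNN)) ;;
        HSet vk (D (V vO [+] V vt)) ;; cand ;; HIf (V vy [<] V vbest) (HSet vbest (V vy)) HSkip"
  obtain kb where kb: "kb < n" "R1 vbest = max (M i kb) (v kb)" using best by blast
  have bb: "\<bar>R1 vbest\<bar> \<le> W"
  proof -
    have "\<bar>max (M i kb) (v kb)\<bar> \<le> int U" using MU[OF R(3) kb(1)] v(2)[OF kb(1)] by linarith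
    then show ?thesis using kb(2) lay by linarith
  qed
  have sel: "wp W (HIf (V vt [<] V vN) ?sel HSkip) (?R2, H) (\<lambda>u st'. u \<le> 70 \<and> snd st' = H \<and>
     (\<forall>r. r \<notin> {vk, vy, vm, vbest, vka, vt} \<longrightarrow> fst st' r = R1 r) \<and> fst st' vbest \<le> R1 vbest \<and>
     (\<exists>k<n. fst st' vbest = max (M i k) (v k)) \<and>
     (t < n \<longrightarrow> fst st' vbest \<le> max (M i (ksel ov i x t)) (v (ksel ov i x t))))"
    (is "wp _ _ _ ?P")
  proof (cases "t < n")
    case False
    have "?P 5 (?R2, H)" using best False by simp
    then show ?thesis using False r tb lay by (simp add: wp_simps)
  next
    case True
    let ?k = "ksel ov i x t"
    have kn: "?k < n" using True v(3) Msort[OF R(3)] unfolding ksel_def sorted_rank_def by simp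
    note ix = idx2[OF R(3) True]
    define tt where "tt = (if x = 0 then int t + nn else int t + int i * int n)"
    have hk: "H (od + tt) = int ?k"
    proof (cases "x = 0")
      case True
      then show ?thesis using v(1) \<open>t < n\<close> unfolding qstatic_def tt_def ksel_def by (simp add: algebra_simps)
    next
      case False
      have "H (od + int (i * n + t)) = int (ord i t)" using R(1) ix unfolding static_def by metis
      then show ?thesis using False unfolding tt_def ksel_def by (simp add: algebra_simps)
    qed
    have ttb: "0 \<le> tt" "od + tt \<le> W" "tt \<le> W" "int i * int n \<le> W" "int n \<le> W" "nn \<le> W" "0 \<le> nn" "od \<le> W" "0 \<le> od"
      "int ?k \<le> W" "int i \<le> W" "int x \<le> W" "int t \<le> W" "1 \<le> W"
      using ix lay kn R(3) True x2 unfolding tt_def by (auto split: if_splits)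
    let ?R3 = "?R2(vt := tt, vk := int ?k)"
    have st3: "static ?R3 H" by (rule static_mono[OF R(1)]) (use fr in auto)
    have c: "wp W cand (?R3, H) (\<lambda>t s'. t \<le> 30 \<and> snd s' = H \<and> fst s' vy = max (M i ?k) (v ?k) \<and>
     (\<forall>r. r \<notin> {vy, vm} \<longrightarrow> fst s' r = ?R3 r))"
      by (rule cand[OF st3 _ _ R(3) kn v(1,2)]) (use r in auto)
    have 1: "wp W (cand ;; HIf (V vy [<] V vbest) (HSet vbest (V vy)) HSkip) (?R3, H) (\<lambda>u st'. ?P (25 + u) st')"
      unfolding wp_Seq
    proof (rule wp_mono[OF c], elim conjE)
      fix u :: nat and s' assume u: "u \<le> 30" and h: "snd s' = H" and y: "fst s' vy = max (M i ?k) (v ?k)"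
        and f: "\<forall>r. r \<notin> {vy, vm} \<longrightarrow> fst s' r = ?R3 r"
      obtain R4 where s': "s' = (R4, H)" using h by (cases s') auto
      have yb: "\<bar>R4 vy\<bar> \<le> W"
      proof -
        have "\<bar>max (M i ?k) (v ?k)\<bar> \<le> int U" using MU[OF R(3) kn] v(2)[OF kn] by linarith
        then show ?thesis using y lay unfolding s' by simp
      qed
      have fb: "R4 vbest = R1 vbest" using f unfolding s' by simp
      define R5 where "R5 = (if R4 vy < R1 vbest then R4(vbest := R4 vy) else R4)"
      have "\<exists>k<n. R5 vbest = max (M i k) (v k)"
        unfolding R5_def using y kn kb fb unfolding s' by auto
      moreover have "R5 vbest \<le> R1 vbest" "R5 vbest \<le> max (M i ?k) (v ?k)"
        unfolding R5_def using y fb unfolding s' by auto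
      moreover have "\<forall>r. r \<notin> {vk, vy, vm, vbest, vka, vt} \<longrightarrow> R5 r = R1 r"
        unfolding R5_def using f unfolding s' by auto
      ultimately have P: "?P (25 + (u + w)) (R5, H)" if "w \<le> 10" for w :: nat using u that by simp
      have "wp W (HIf (V vy [<] V vbest) (HSet vbest (V vy)) HSkip) (R4, H) (\<lambda>w st'. w \<le> 10 \<and> st' = (R5, H))"
        unfolding R5_def using fb ttb(14) by (simp add: wp_simps yb bb)
      then show "wp W (HIf (V vy [<] V vbest) (HSet vbest (V vy)) HSkip) s' (\<lambda>w. ?P (25 + (u + w)))"
        unfolding s' by (rule wp_mono) (use P in blast)
    qed
    have 2: "wp W (HIf (V vt [<] V vN) (?sel) HSkip) (?R2, H) Q'"
      if a: "\<And>w. w \<le> 25 \<Longrightarrow> wp W (cand ;; HIf (V vy [<] V vbest) (HSet vbest (V vy)) HSkip) (?R3, H) (\<lambda>u. Q' (w + u))" for Q'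
    proof -
      have pre: "wp W (HIf (V vka) (HSet vt (V vt [+] V vi [*] V vN)) (HSet vt (V vt [+] V vNN))) (?R2, H)
          (\<lambda>u st'. u \<le> 10 \<and> st' = (?R2(vt := tt), H))"
        using r ttb unfolding tt_def by (cases "x = 0") (simp_all add: wp_simps)
      have "wp W ?sel (?R2, H) (\<lambda>u. Q' (acost (V vt [<] V vN) + Suc u))"
        unfolding wp_Seq[of _ "HIf (V vka) _ _"]
      proof (rule wp_mono[OF pre], elim conjE)
        fix u :: nat and st' assume u: "u \<le> 10" and st': "st' = (?R2(vt := tt), H)"
        have "wp W (cand ;; HIf (V vy [<] V vbest) (HSet vbest (V vy)) HSkip) (?R3, H) (\<lambda>w. Q' (9 + u + w))"
          using u by (intro a) simp
        then show "wp W (HSet vk (D (V vO [+] V vt)) ;; cand ;; HIf (V vy [<] V vbest) (HSet vbest (V vy)) HSkip) st'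
          (\<lambda>u2. Q' (acost (V vt [<] V vN) + Suc (u + u2)))"
          unfolding st' wp_Seq[of _ "HSet vk _"] wp_Set using r ttb hk by (simp add: eval_nat_numeral)
      qed
      then show ?thesis unfolding wp_If using r ttb \<open>t < n\<close> by simp
    qed
    show ?thesis
    proof (rule 2)
      fix w :: nat assume "w \<le> 25"
      then show "wp W (cand ;; HIf (V vy [<] V vbest) (HSet vbest (V vy)) HSkip) (?R3, H) (\<lambda>u. ?P (w + u))"
        by (intro wp_mono[OF 1]) simp
    qed
  qed
  have eq: "wp W scan_body (R1, H) Q' \<longleftrightarrow> wp W (HIf (V vt [<] V vN) ?sel HSkip ;; incr vj) (?R2, H) (\<lambda>u. Q' (19 + u))" for Q'
  proof -
    have Fb: "\<bar>F\<bar> \<le> W" "\<bar>F + 2 * int i\<bar> \<le> W" "\<bar>F + 2 * int i + int x\<bar> \<le> W"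
      using lay R(3) x2 by linarith+
    have o: "2 * int i \<le> W" "int i \<le> W" "int x \<le> W" "2 \<le> W" "int p \<le> W" "int g * int s \<le> W" "int s \<le> W" "int t \<le> W" "int (p div 2) \<le> W"
      using lay R(3) x2 pe p2s tW gs ss Wb tb by linarith+
    show ?thesis
      unfolding scan_body_def wp_Seq[of _ "HSet vka _"] wp_Seq[of _ "HSet vt _"] wp_Set
      using r pj intp g(1) tW o by (simp add: Fb eval_nat_numeral)
  qed
  have main: "wp W (HIf (V vt [<] V vN) ?sel HSkip ;; incr vj) (?R2, H) (\<lambda>u st'. 19 + u \<le> 100 \<and> sinv R H s v ov i (Suc p) st')"
    unfolding wp_Seq[of _ _ "incr vj"]
  proof (rule wp_mono[OF sel], elim conjE)
    fix u :: nat and st'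
    assume u: "u \<le> 70" and h: "snd st' = H" and f: "\<forall>r. r \<notin> {vk, vy, vm, vbest, vka, vt} \<longrightarrow> fst st' r = R1 r"
      and b: "fst st' vbest \<le> R1 vbest" and e: "\<exists>k<n. fst st' vbest = max (M i k) (v k)"
      and n: "t < n \<longrightarrow> fst st' vbest \<le> max (M i (ksel ov i x t)) (v (ksel ov i x t))"
    obtain R4 where s': "st' = (R4, H)" using h by (cases st') auto
    have j: "R4 vj = int p" using f pj unfolding s' by simp
    have "sinv R H s v ov i (Suc p) (R4(vj := int p + 1), H)"
      unfolding sinv_def fst_conv snd_conv
    proof (intro conjI allI impI)
      show "(R4(vj := int p + 1)) r = R r" if "r \<notin> {vk, vy, vm, vbest, vj, vka, vt}" for r
        using f fr that unfolding s' by simp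
      show "\<exists>k<n. (R4(vj := int p + 1)) vbest = max (M i k) (v k)" using e unfolding s' by simp
      show "(R4(vj := int p + 1)) vbest \<le> max (M i (ksel ov i x' t')) (v (ksel ov i x' t'))"
        if "x' < 2" "t' < n" "H (F + 2 * int i + int x') = int (t' div s)" "2 * (t' mod s) + x' < Suc p" for x' t'
      proof (cases "2 * (t' mod s) + x' < p")
        case True
        then show ?thesis using bl[OF that(1-3)] b unfolding s' by simp
      next
        case False
        \<comment> \<open>The counter determines the kind and the place in the group, and the table
          determines the group, so the only new position is the one just examined.\<close>
        then have "2 * (t' mod s) + x' = p" using that(4) by simp
        then have "x' = x" "t' mod s = p div 2" using that(1) unfolding x_def by auto
        moreover have "t' div s = g" using that(3) g(1) \<open>x' = x\<close> by simp
        ultimately have "t' = t" using td by (metis div_mult_mod_eq)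
        then show ?thesis using n that(2) \<open>x' = x\<close> unfolding s' by simp
      qed
    qed auto
    moreover have "int p + 1 \<le> W" using pe p2s x2 ss gs Wb sizes by linarith
    ultimately show "wp W (incr vj) st' (\<lambda>t2 s2. 19 + (u + t2) \<le> 100 \<and> sinv R H s v ov i (Suc p) s2)"
      unfolding s' wp_Set using j u by simp
  qed
  show ?thesis unfolding st eq by (rule main)
qed

end

context omv2
begin

lemma finish_body:
  assumes R: "static R H" "R vi = int i" "i < n" "R vS = int s" "fstb H"
    and s: "q \<le> s" "s \<le> Smax"
    and v: "qstatic v ov rv H" "\<And>k. k < n \<Longrightarrow> \<bar>v k\<bar> \<le> int U" "sorted_rank n v ov rv" "found s v rv 0 H"
  shows "wp W finish_body (R, H) (\<lambda>t s'. t \<le> 400 * s \<and> snd s' = H(nn + int n + int i := min_max_OMv n M v i) \<and>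
     fst s' vi = int i + 1 \<and> (\<forall>r. r \<notin> {vk, vy, vm, vbest, vj, vka, vt, vi} \<longrightarrow> fst s' r = R r))"
    (is "wp _ _ _ ?post")
proof -
  have s0: "0 < s" using s q0 by simp
  have rr: "R vN = int n" "R vNN = nn" using R(1) by (auto simp: static_def regsok_def)
  have W: "1 \<le> W" "int i + 1 \<le> W" "nn + int n + int i \<le> W" "nn + int n \<le> W" "nn \<le> W" "0 \<le> nn" "int n \<le> W"
    using lay R(3) by linarith+
  have sW: "2 * int s + 2 * int n \<le> W" using level_sizes[OF s, of 0] by auto
  let ?w = "HWhile (V vj [<] V vS [+] V vS) scan_body"
  let ?tl = "HPut (V vNN [+] V vN [+] V vi) (V vbest) ;; incr vi"
  let ?R0 = "R(vk := 0)"
  have st0: "static ?R0 H" by (rule static_mono[OF R(1)]) auto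
  have c: "wp W cand (?R0, H) (\<lambda>t s'. t \<le> 30 \<and> snd s' = H \<and> fst s' vy = max (M i 0) (v 0) \<and>
     (\<forall>r. r \<notin> {vy, vm} \<longrightarrow> fst s' r = ?R0 r))"
    by (rule cand[OF st0 _ _ R(3) n0 v(1,2)]) (use R(2) in auto)
  have rest: "wp W (HSet vbest (V vy) ;; HSet vj (N 0) ;; ?w ;; ?tl) st (\<lambda>t. ?post (2 + (u + t)))"
    if u: "u \<le> 30" and h: "snd st = H" and y: "fst st vy = max (M i 0) (v 0)"
      and f: "\<forall>r. r \<notin> {vy, vm} \<longrightarrow> fst st r = ?R0 r" for u st
  proof -
    obtain R1 where st: "st = (R1, H)" using h by (cases st) auto
    have yb: "\<bar>R1 vy\<bar> \<le> W"
    proof -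
      have "\<bar>max (M i 0) (v 0)\<bar> \<le> int U" using MU[OF R(3) n0] v(2)[OF n0] by linarith
      then show ?thesis using y lay unfolding st by simp
    qed
    let ?R2 = "R1(vbest := R1 vy, vj := 0)"
    have loop: "wp W ?w (?R2, H) (\<lambda>t st'. t \<le> (2 * s + 1) * 106 \<and> sinv R H s v ov i (2 * s) st')"
    proof (rule wp_While_for[where Inv = "sinv R H s v ov i" and m = "2 * s" and b = 100])
      show "sinv R H s v ov i 0 (?R2, H)"
        unfolding sinv_def using f y n0 unfolding st by auto
      show "safe W (V vj [<] V vS [+] V vS) st' \<and> (aval (V vj [<] V vS [+] V vS) st' \<noteq> 0 \<longleftrightarrow> p < 2 * s)"
        if "p \<le> 2 * s" "sinv R H s v ov i p st'" for p st'
      proof -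
        have "fst st' vj = int p" "fst st' vS = int s" using that(2) R(4) unfolding sinv_def by auto
        then show ?thesis using that(1) sW W by auto
      qed
      show "wp W scan_body st' (\<lambda>t st'. t \<le> 100 \<and> sinv R H s v ov i (Suc p) st')"
        if "p < 2 * s" "sinv R H s v ov i p st'" for p st'
        by (rule scan_body[OF R s v(1,2,3) that])
    qed auto
    have tl: "wp W ?tl st' (\<lambda>t. ?post (2 + (u + (2 + (2 + (t1 + t))))))"
      if t1: "t1 \<le> (2 * s + 1) * 106" and inv: "sinv R H s v ov i (2 * s) st'" for t1 st'
    proof -
      obtain R3 where st': "st' = (R3, H)" using inv unfolding sinv_def by (cases st') auto
      have fr: "\<And>r. r \<notin> {vk, vy, vm, vbest, vj, vka, vt} \<Longrightarrow> R3 r = R r"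
        and bst: "\<exists>k<n. R3 vbest = max (M i k) (v k)"
        and bl: "\<And>x t. x < 2 \<Longrightarrow> t < n \<Longrightarrow> H (F + 2 * int i + int x) = int (t div s) \<Longrightarrow> 2 * (t mod s) + x < 2 * s \<Longrightarrow>
          R3 vbest \<le> max (M i (ksel ov i x t)) (v (ksel ov i x t))"
        using inv unfolding st' sinv_def fst_conv snd_conv by blast+
      obtain kb where kb: "kb < n" "R3 vbest = max (M i kb) (v kb)" using bst by blast
      obtain x t where xt: "x < 2" "t < n" "H (F + 2 * int i + int x) = int (t div s)"
        "\<forall>k<n. max (M i (ksel ov i x t)) (v (ksel ov i x t)) \<le> max (M i k) (v k)"
        using found_min[OF v(4) s(1) v(3) R(3)] by blast
      have "t mod s < s" using s0 by simp
      then have "2 * (t mod s) + x < 2 * s" using xt(1) by linarith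
      then have le: "R3 vbest \<le> max (M i k) (v k)" if "k < n" for k
        using bl[OF xt(1-3)] xt(4) that by fastforce
      \<comment> \<open>The value is attained, and it is at most that of every candidate in the two
        groups, one of which contains a minimizer.\<close>
      have best: "R3 vbest = min_max_OMv n M v i"
        unfolding min_max_OMv_def
      proof (rule sym, rule Min_eqI)
        show "R3 vbest \<in> (\<lambda>k. max (M i k) (v k)) ` {..<n}" using kb by auto
      qed (use le in auto)
      have bb: "\<bar>R3 vbest\<bar> \<le> W"
      proof -
        have "\<bar>max (M i kb) (v kb)\<bar> \<le> int U" using MU[OF R(3) kb(1)] v(2)[OF kb(1)] by linarith
        then show ?thesis using kb(2) lay by linarith
      qed
      have r3: "R3 vN = int n" "R3 vNN = nn" "R3 vi = int i" using fr rr R(2) by auto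
      have P: "?post (2 + (u + (2 + (2 + (t1 + 11))))) (R3(vi := int i + 1), H(nn + int n + int i := R3 vbest))"
        using u t1 s0 fr best by simp
      have eq: "wp W ?tl (R3, H) Q' \<longleftrightarrow> Q' 11 (R3(vi := int i + 1), H(nn + int n + int i := R3 vbest))" for Q'
        unfolding wp_Seq wp_Set wp_Put using r3 W by (simp add: bb) (simp add: eval_nat_numeral)
      show ?thesis unfolding st' eq by (rule P)
    qed
    have eq: "wp W (HSet vbest (V vy) ;; HSet vj (N 0) ;; ?w ;; ?tl) (R1, H) Q' \<longleftrightarrow>
        wp W ?w (?R2, H) (\<lambda>t1 s1. wp W ?tl s1 (\<lambda>t. Q' (2 + (2 + (t1 + t)))))" for Q'
      unfolding wp_Seq[of _ "HSet vbest _"] wp_Seq[of _ "HSet vj _"] wp_Seq[of _ ?w] wp_Set using W(1) by (simp add: yb)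
    show ?thesis unfolding st eq by (rule wp_mono[OF loop]) (use tl in blast)
  qed
  have main: "wp W (cand ;; HSet vbest (V vy) ;; HSet vj (N 0) ;; ?w ;; ?tl) (?R0, H) (\<lambda>t. ?post (2 + t))"
    unfolding wp_Seq[of _ cand] by (rule wp_mono[OF c]) (use rest in blast)
  have eq: "wp W finish_body (R, H) Q' \<longleftrightarrow>
      wp W (cand ;; HSet vbest (V vy) ;; HSet vj (N 0) ;; ?w ;; ?tl) (?R0, H) (\<lambda>t. Q' (2 + t))" for Q'
    unfolding finish_body_def wp_Seq[of _ "HSet vk _"] wp_Set using W(1) by simp
  show ?thesis unfolding eq by (rule main)
qed

lemma found_mono:
  assumes "found s v rv m H" "\<And>b. F \<le> b \<Longrightarrow> b < F + 2 * int n \<Longrightarrow> H' b = H b"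
  shows "found s v rv m H'"
proof -
  have "H' (F + 2 * int i + int x) = H (F + 2 * int i + int x)" if "i < n" "x < 2" for i x :: nat
    using that by (intro assms(2)) linarith+
  then show ?thesis using assms(1) unfolding found_def by simp
qed

lemma fstb_mono:
  assumes "fstb H" "\<And>b. F \<le> b \<Longrightarrow> b < F + 2 * int n \<Longrightarrow> H' b = H b"
  shows "fstb H'"
proof -
  have "H' (F + int i) = H (F + int i)" if "i < 2 * n" for i
    using that by (intro assms(2)) linarith+
  then show ?thesis using assms(1) unfolding fstb_def by simp
qed

lemma finish:
  assumes R: "static R H" "R vS = int s" "fstb H"
    and s: "q \<le> s" "s \<le> Smax"
    and v: "qstatic v ov rv H" "\<And>k. k < n \<Longrightarrow> \<bar>v k\<bar> \<le> int U" "sorted_rank n v ov rv" "found s v rv 0 H"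
  shows "wp W finish (R, H) (\<lambda>t s'. t \<le> 1000 * (n * s) \<and>
     (\<forall>i<n. snd s' (nn + int n + int i) = min_max_OMv n M v i) \<and>
     (\<forall>b. b < nn + int n \<or> nn + 2 * int n \<le> b \<longrightarrow> snd s' b = H b) \<and>
     (\<forall>r. r \<notin> {vk, vy, vm, vbest, vj, vka, vt, vi} \<longrightarrow> fst s' r = R r))"
    (is "wp _ _ _ ?post")
proof -
  have s0: "0 < s" using s q0 by simp
  have rr: "R vN = int n" using R(1) by (auto simp: static_def regsok_def)
  define Inv where "Inv i st \<longleftrightarrow> fst st vi = int i \<and>
     (\<forall>i'<i. snd st (nn + int n + int i') = min_max_OMv n M v i') \<and>
     (\<forall>b. b < nn + int n \<or> nn + 2 * int n \<le> b \<longrightarrow> snd st b = H b) \<and>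
     (\<forall>r. r \<notin> {vk, vy, vm, vbest, vj, vka, vt, vi} \<longrightarrow> fst st r = R r)" for i st
  have "wp W (HWhile (V vi [<] V vN) finish_body) (R(vi := 0), H) (\<lambda>t st. t \<le> (n + 1) * (400 * s + acost (V vi [<] V vN) + 1) \<and> Inv n st)"
  proof (rule wp_While_for[where Inv = Inv and m = n and b = "400 * s"])
    show "Inv 0 (R(vi := 0), H)" unfolding Inv_def by simp
    show "safe W (V vi [<] V vN) st \<and> (aval (V vi [<] V vN) st \<noteq> 0 \<longleftrightarrow> i < n)" if "i \<le> n" "Inv i st" for i st
      using that rr lay unfolding Inv_def by simp
    show "wp W finish_body st (\<lambda>t st'. t \<le> 400 * s \<and> Inv (Suc i) st')" if i: "i < n" and inv: "Inv i st" for i st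
    proof -
      have fr: "\<And>r. r \<notin> {vk, vy, vm, vbest, vj, vka, vt, vi} \<Longrightarrow> fst st r = R r" and vi: "fst st vi = int i"
        and h: "\<And>b. b < nn + int n \<or> nn + 2 * int n \<le> b \<Longrightarrow> snd st b = H b"
        and old: "\<forall>i'<i. snd st (nn + int n + int i') = min_max_OMv n M v i'"
        using inv unfolding Inv_def by blast+
      have st: "static (fst st) (snd st)" by (rule static_mono[OF R(1)]) (use h fr lay in auto)
      have qs: "qstatic v ov rv (snd st)" by (rule qstatic_mono[OF v(1)]) (use h lay in auto)
      have fb: "fstb (snd st)" by (rule fstb_mono[OF R(3)]) (use h lay in auto)
      have fo: "found s v rv 0 (snd st)" by (rule found_mono[OF v(4)]) (use h lay in auto)
      have vS: "fst st vS = int s" using fr R(2) by auto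
      show ?thesis
      proof (rule wp_mono[OF finish_body[OF st vi i vS fb s qs v(2,3) fo, unfolded prod.collapse]], assumption, elim conjE)
        fix t st'
        assume t: "t \<le> 400 * s" and h': "snd st' = (snd st)(nn + int n + int i := min_max_OMv n M v i)"
          and vi': "fst st' vi = int i + 1"
          and fr': "\<forall>r. r \<notin> {vk, vy, vm, vbest, vj, vka, vt, vi} \<longrightarrow> fst st' r = fst st r"
        have "Inv (Suc i) st'" unfolding Inv_def h'
          using vi' fr' fr h old i by (auto simp: less_Suc_eq)
        then show "t \<le> 400 * s \<and> Inv (Suc i) st'" using t by simp
      qed
    qed
    show "t \<le> (n + 1) * (400 * s + acost (V vi [<] V vN) + 1) \<and> Inv n st"
      if "Inv n st" "t \<le> (n + 1) * (400 * s + acost (V vi [<] V vN) + 1)" for t st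
      using that by blast
  qed
  then have main: "wp W (HWhile (V vi [<] V vN) finish_body) (R(vi := 0), H) (\<lambda>t. ?post (2 + t))"
  proof (rule wp_mono, elim conjE)
    fix t st assume t0: "t \<le> (n + 1) * (400 * s + acost (V vi [<] V vN) + 1)" and inv: "Inv n st"
    have "400 * s + acost (V vi [<] V vN) + 1 = 400 * s + 4" by simp
    then have t: "t \<le> (n + 1) * (400 * s + 4)" using t0 by presburger
    have "(n + 1) * (400 * s + 4) \<le> (2 * n) * (404 * s)" using n0 s0 by (intro mult_le_mono) auto
    moreover have "1 * 1 \<le> n * s" using n0 s0 by (intro mult_le_mono) auto
    moreover have "(2 * n) * (404 * s) = 808 * (n * s)" by simp
    ultimately have "2 + t \<le> 1000 * (n * s)" using t by linarith
    then show "?post (2 + t) st" using inv unfolding Inv_def by blast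
  qed
  have eq: "wp W finish (R, H) Q' \<longleftrightarrow> wp W (HWhile (V vi [<] V vN) finish_body) (R(vi := 0), H) (\<lambda>t. Q' (2 + t))" for Q'
    unfolding finish_def wp_Seq wp_Set using lay by simp
  show ?thesis unfolding eq by (rule main)
qed

text \<open>\<open>dyn\<close> depends only on the cells, which have negative addresses, on the
  table of first groups and on four registers.\<close>

lemma dyn_mono:
  assumes "dyn R H j s base fresh \<tau>" "\<And>b. b < 0 \<or> F \<le> b \<and> b < F + 2 * int n \<Longrightarrow> H' b = H b"
    "R' vS = R vS" "R' vbase = R vbase" "R' vFr = R vFr" "R' vC = R vC"
  shows "dyn R' H' j s base fresh \<tau>"
proof -
  have c: "H' (cell y a) = H (cell y a)" if "0 \<le> y" for y a using assms(2)[of "cell y a"] cell_neg[OF that, of a] by simp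
  have "zeroed (2 * i) H' = zeroed (2 * i) H" if "0 \<le> i" for i using that c unfolding zeroed_def by simp
  then have z: "zeroed (2 * int i) H' = zeroed (2 * int i) H"
    "zeroed (2 * (int base + int i)) H' = zeroed (2 * (int base + int i)) H" for i
    by (simp, metis add_nonneg_nonneg of_nat_0_le_iff)
  have i: "instx s base H' x j tt = instx s base H x j tt" for x tt
    using c unfolding instx_def inst_def rel_def by simp
  have fb: "fstb H'" using assms(1,2) fstb_mono[of H H'] unfolding dyn_def by blast
  show ?thesis using assms(1) fb unfolding dyn_def assms(3-6) z i by blast
qed

definition qinv :: "nat \<Rightarrow> int \<Rightarrow> (reg \<Rightarrow> int) \<Rightarrow> (int \<Rightarrow> int) \<Rightarrow> bool" where
  "qinv j Tot R H \<longleftrightarrow> static R H \<and> (\<exists>s base fresh \<tau> l. dyn R H j s base fresh \<tau> \<and> q * 2 ^ l = s \<and>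
     Tot \<le> pot j s l (R vC) fresh)"

text \<open>One more query adds \<open>10000 * (int n * int s)\<close> to the potential. This covers
  at most 3000 n s for sorting, 1000 n s for scanning the groups, and the 1500 n s by which the
  levels exceed their own share.\<close>

lemma pot_query:
  assumes "q \<le> s" "Tot + int t \<le> pot j s l C False + 1500 * (int n * int s)"
    and "u1 \<le> 500 * ((n + q + 1) * (q + 1))" "u2 \<le> 1000 * (n * s)"
  shows "Tot + int (2 + (u1 + (t + u2))) \<le> pot (Suc j) s l C False"
proof -
  have "(n + q + 1) * (q + 1) \<le> (3 * n) * (2 * s)" using qn n0 q0 assms(1) by (intro mult_le_mono) linarith+
  then have "u1 \<le> 3000 * (n * s)" using assms(3) by simp
  moreover have "1 * 1 \<le> n * s" using n0 q0 assms(1) by (intro mult_le_mono) auto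
  ultimately have "2 + u1 + u2 \<le> 5000 * (n * s)" using assms(4) by linarith
  then have "int (2 + u1 + u2) \<le> int (5000 * (n * s))" by (simp only: of_nat_le_iff)
  then have "2 + int u1 + int u2 \<le> 5000 * (int n * int s)" by simp
  moreover have "pot (Suc j) s l C False = pot j s l C False + 10000 * (int n * int s)"
    unfolding pot_def by (simp add: algebra_simps)
  moreover have "0 \<le> int n * int s" by simp
  ultimately show ?thesis using assms(2) by simp
qed

lemma query:
  assumes inv: "qinv j Tot R H" and j: "j < n" and v: "\<And>k. k < n \<Longrightarrow> \<bar>v k\<bar> \<le> int U"
    and Hq: "\<And>k. k < n \<Longrightarrow> Hq (nn + int k) = v k" "\<And>b. b < nn \<or> nn + int n \<le> b \<Longrightarrow> Hq b = H b"
  shows "wp W (query P Q) (R, Hq) (\<lambda>t s'. qinv (Suc j) (Tot + int t) (fst s') (snd s') \<and>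
    (\<forall>i<n. snd s' (nn + int n + int i) = min_max_OMv n M v i))"
    (is "wp _ _ _ ?post")
proof -
  obtain s0 base0 fresh0 \<tau>0 l0 where st: "static R H" and dy: "dyn R H j s0 base0 fresh0 \<tau>0" "q * 2 ^ l0 = s0"
      "Tot \<le> pot j s0 l0 (R vC) fresh0" using inv unfolding qinv_def by blast
  let ?R0 = "R(vB := nn)"
  have st0: "static ?R0 Hq" by (rule static_mono[OF st]) (use Hq(2) lay in auto)
  have sr: "wp W sortrow (?R0, Hq) (\<lambda>t s'. t \<le> 500 * ((n + q + 1) * (q + 1)) \<and>
     (\<forall>r. r \<notin> {vk, vy, vINF, vt, vp, vm, vj, vlen} \<longrightarrow> fst s' r = ?R0 r) \<and>
     0 \<le> fst s' vINF \<and> fst s' vINF \<le> cap \<and>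
     (\<exists>ord rnk. sorted_rank n v ord rnk \<and> (\<forall>j<n. snd s' (od + nn + int j) = int (ord j)) \<and>
        (\<forall>k<n. snd s' (rk + nn + int k) = int (rnk k))) \<and>
     (\<forall>x. (x < od + nn \<or> od + nn + int n \<le> x) \<longrightarrow> (x < rk + nn \<or> rk + nn + int n \<le> x) \<longrightarrow>
        (x < ky \<or> bm + int q \<le> x) \<longrightarrow> snd s' x = Hq x))"
    by (rule sortrow) (use st0 sizes Hq(1) v in \<open>auto simp: static_def\<close>)
  have main: "wp W (sortrow ;; levels P Q ;; finish) (?R0, Hq) (\<lambda>t. ?post (2 + t))"
    unfolding wp_Seq
  proof (rule wp_mono[OF sr], elim conjE exE)
    fix u1 s1 ov rv
    assume u1: "u1 \<le> 500 * ((n + q + 1) * (q + 1))"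
      and fr1: "\<forall>r. r \<notin> {vk, vy, vINF, vt, vp, vm, vj, vlen} \<longrightarrow> fst s1 r = ?R0 r"
      and inf: "0 \<le> fst s1 vINF" "fst s1 vINF \<le> cap" and so: "sorted_rank n v ov rv"
      and o1: "\<forall>j<n. snd s1 (od + nn + int j) = int (ov j)" and k1: "\<forall>k<n. snd s1 (rk + nn + int k) = int (rv k)"
      and h1: "\<forall>x. (x < od + nn \<or> od + nn + int n \<le> x) \<longrightarrow> (x < rk + nn \<or> rk + nn + int n \<le> x) \<longrightarrow>
        (x < ky \<or> bm + int q \<le> x) \<longrightarrow> snd s1 x = Hq x"
    \<comment> \<open>Sorting may have raised \<open>vINF\<close>, which \<open>static_mono\<close>
      requires to be unchanged. The old value is put back, and then replaced again since
      \<open>static\<close> only confines it to an interval.\<close>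
    have "static ((fst s1)(vINF := R vINF)) (snd s1)"
      by (rule static_mono[OF st0]) (use h1 fr1 lay in auto)
    then have st1: "static (fst s1) (snd s1)" using inf unfolding static_def regsok_def by simp
    have hv: "snd s1 (nn + int k) = v k" if "k < n" for k
      using h1[rule_format, of "nn + int k"] Hq(1)[OF that] that lay by auto
    have qs: "qstatic v ov rv (snd s1)" unfolding qstatic_def using o1 k1 hv by simp
    have dy1: "dyn (fst s1) (snd s1) j s0 base0 fresh0 \<tau>0"
      by (rule dyn_mono[OF dy(1)]) (use h1 Hq(2) fr1 lay in auto)
    have C1: "fst s1 vC = R vC" using fr1 by simp
    have rvn: "\<And>k. k < n \<Longrightarrow> rv k < n" using so unfolding sorted_rank_def by blast
    have dy3: "Tot \<le> pot j s0 l0 (fst s1 vC) fresh0" using dy(3) C1 by simp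
    show "wp W (levels P Q) s1 (\<lambda>t2 s2. wp W finish s2 (\<lambda>t3 s3. ?post (2 + (u1 + (t2 + t3))) s3))"
    proof (rule wp_mono[OF levels[OF st1 dy1 dy(2) dy3 qs v rvn j, unfolded prod.collapse]], assumption, assumption, elim conjE exE)
      fix t2 s2 s base \<tau> l
      assume fr2: "\<forall>r. r \<notin> tch \<union> {vG, vDone, vbase, vS, vFr} \<longrightarrow> fst s2 r = fst s1 r"
        and h2: "\<forall>b. 0 \<le> b \<longrightarrow> b < F \<or> F + 2 * int n \<le> b \<longrightarrow> snd s2 b = snd s1 b"
        and dy2: "dyn (fst s2) (snd s2) (Suc j) s base False \<tau>" and fo: "found s v rv 0 (snd s2)" and l: "q * 2 ^ l = s"
        and t2: "Tot + int t2 \<le> pot j s l (fst s2 vC) False + 1500 * (int n * int s)"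
      have st2: "static (fst s2) (snd s2)"
        by (rule static_mono[OF st1]) (use h2 fr2 lay in \<open>auto simp: tch_def\<close>)
      have qs2: "qstatic v ov rv (snd s2)" by (rule qstatic_mono[OF qs]) (use h2 lay in auto)
      have d2: "fst s2 vS = int s" "fstb (snd s2)" "q \<le> s" "s \<le> Smax" using dy2 unfolding dyn_def by blast+
      show "wp W finish s2 (\<lambda>t3 s3. ?post (2 + (u1 + (t2 + t3))) s3)"
      proof (rule wp_mono[OF finish[OF st2 d2 qs2 v so fo, unfolded prod.collapse]], assumption, elim conjE)
        fix t3 s3
        assume t3: "t3 \<le> 1000 * (n * s)" and ans: "\<forall>i<n. snd s3 (nn + int n + int i) = min_max_OMv n M v i"
          and h3: "\<forall>b. b < nn + int n \<or> nn + 2 * int n \<le> b \<longrightarrow> snd s3 b = snd s2 b"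
          and fr3: "\<forall>r. r \<notin> {vk, vy, vm, vbest, vj, vka, vt, vi} \<longrightarrow> fst s3 r = fst s2 r"
        have st3: "static (fst s3) (snd s3)" by (rule static_mono[OF st2]) (use h3 fr3 lay in auto)
        have dy3: "dyn (fst s3) (snd s3) (Suc j) s base False \<tau>"
          by (rule dyn_mono[OF dy2]) (use h3 fr3 lay in auto)
        have C3: "fst s3 vC = fst s2 vC" using fr3 by simp
        have "Tot + int (2 + (u1 + (t2 + t3))) \<le> pot (Suc j) s l (fst s3 vC) False"
          unfolding C3 by (rule pot_query[OF d2(3) t2 u1 t3])
        then have "qinv (Suc j) (Tot + int (2 + (u1 + (t2 + t3)))) (fst s3) (snd s3)"
          unfolding qinv_def using st3 dy3 l by blast
        then show "?post (2 + (u1 + (t2 + t3))) s3" using ans by blast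
      qed
    qed
  qed
  have eq: "wp W (query P Q) (R, Hq) Q' \<longleftrightarrow> wp W (sortrow ;; levels P Q ;; finish) (?R0, Hq) (\<lambda>t. Q' (2 + t))" for Q'
    unfolding query_def wp_Seq[of _ "HSet vB _"] wp_Set using st lay unfolding static_def regsok_def by simp
  show ?thesis unfolding eq by (rule main)
qed

end

subsection \<open>Preprocessing\<close>

definition rows :: hcom where
  "rows = HSet vi (N 0) ;; HWhile (V vi [<] V vN) (HSet vB (V vi [*] V vN) ;; sortrow ;; incr vi)"

text \<open>A linear search is affordable, as it takes O(sqrt n) steps.\<close>

definition isqrt :: hcom where
  "isqrt = HSet vq (N 1) ;; HWhile (V vq [*] V vq [<] V vN) (incr vq)"

definition bases :: hcom where
  "bases = HSet vO (V vNN [+] V vN [+] V vN) ;; HSet vRK (V vO [+] V vNN [+] V vN) ;;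
     HSet vF (V vRK [+] V vNN [+] V vN) ;; HSet vKy (V vF [+] V vN [+] V vN) ;;
     HSet vBm (V vKy [+] V vq [*] V vq) ;; HSet vlen (V vNN)"

text \<open>\<open>minrange\<close> runs while \<open>vp\<close> and \<open>vINF\<close> are still 0
  and \<open>vlen\<close> is n^2, so it yields the minimum of 0 and all entries of the matrix; this
  is L. No instance is built yet: those of the first level are only marked as fresh.\<close>

definition preprocess :: hcom where
  "preprocess = HSet vNN (V vN [*] V vN) ;; isqrt ;; bases ;; minrange ;; HSet vL (V vm) ;;
     rows ;; HSet vS (V vq) ;; HSet vFr (N 1)"

context layout
begin

lemma sort_cost:
  assumes "q \<le> n"
  shows "500 * ((n + q + 1) * (q + 1)) \<le> 3000 * (n * q)"
proof -
  have "(n + q + 1) * (q + 1) \<le> (3 * n) * (2 * q)" using assms n0 q0 by (intro mult_le_mono) linarith+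
  then show ?thesis by simp
qed

lemma rows:
  assumes R: "regsok R" "0 \<le> R vINF" "R vINF \<le> cap" and qn: "q \<le> n"
    and M: "\<And>i k. i < n \<Longrightarrow> k < n \<Longrightarrow> H (int (i * n + k)) = M i k" "\<And>i k. i < n \<Longrightarrow> k < n \<Longrightarrow> \<bar>M i k\<bar> \<le> int U"
  shows "wp W rows (R, H) (\<lambda>t s'. t \<le> 6100 * (n * n * q) \<and> 0 \<le> fst s' vINF \<and> fst s' vINF \<le> cap \<and>
     (\<forall>r. r \<notin> {vi, vB, vk, vy, vINF, vt, vp, vm, vj, vlen} \<longrightarrow> fst s' r = R r) \<and>
     (\<forall>b. b < od \<or> F \<le> b \<and> b < ky \<longrightarrow> snd s' b = H b) \<and>
     (\<exists>ord rnk. \<forall>i<n. sorted_rank n (M i) (ord i) (rnk i) \<and>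
        (\<forall>k<n. snd s' (od + int (i * n + k)) = int (ord i k) \<and> snd s' (rk + int (i * n + k)) = int (rnk i k))))"
    (is "wp _ _ _ ?post")
proof -
  define Inv where "Inv m st \<longleftrightarrow> fst st vi = int m \<and> 0 \<le> fst st vINF \<and> fst st vINF \<le> cap \<and>
     (\<forall>r. r \<notin> {vi, vB, vk, vy, vINF, vt, vp, vm, vj, vlen} \<longrightarrow> fst st r = R r) \<and>
     (\<forall>b. b < od \<or> F \<le> b \<and> b < ky \<longrightarrow> snd st b = H b) \<and>
     (\<exists>ord rnk. \<forall>i<m. sorted_rank n (M i) (ord i) (rnk i) \<and>
        (\<forall>k<n. snd st (od + int (i * n + k)) = int (ord i k) \<and> snd st (rk + int (i * n + k)) = int (rnk i k)))" for m st
  let ?body = "HSet vB (V vi [*] V vN) ;; sortrow ;; incr vi"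
  let ?b = "3000 * (n * q) + 8"
  have "wp W (HWhile (V vi [<] V vN) ?body) (R(vi := 0), H)
      (\<lambda>t st. t \<le> (n + 1) * (?b + acost (V vi [<] V vN) + 1) \<and> Inv n st)"
  proof (rule wp_While_for[where Inv = Inv and m = n and b = ?b])
    show "Inv 0 (R(vi := 0), H)" using R unfolding Inv_def by simp
    show "safe W (V vi [<] V vN) st \<and> (aval (V vi [<] V vN) st \<noteq> 0 \<longleftrightarrow> i < n)" if "i \<le> n" "Inv i st" for i st
    proof -
      have "fst st vi = int i" "fst st vN = int n" using that(2) R(1) unfolding Inv_def regsok_def by auto
      then show ?thesis using that(1) lay by simp
    qed
    show "wp W ?body st (\<lambda>t st'. t \<le> ?b \<and> Inv (Suc m) st')" if m: "m < n" and inv: "Inv m st" for m st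
    proof -
      obtain R1 H1 where st: "st = (R1, H1)" by (cases st)
      have vi: "R1 vi = int m" and inf: "0 \<le> R1 vINF" "R1 vINF \<le> cap"
        and fr: "\<And>r. r \<notin> {vi, vB, vk, vy, vINF, vt, vp, vm, vj, vlen} \<Longrightarrow> R1 r = R r"
        and h: "\<And>b. b < od \<or> F \<le> b \<and> b < ky \<Longrightarrow> H1 b = H b"
        and ex: "\<exists>ord rnk. \<forall>i<m. sorted_rank n (M i) (ord i) (rnk i) \<and>
        (\<forall>k<n. H1 (od + int (i * n + k)) = int (ord i k) \<and> H1 (rk + int (i * n + k)) = int (rnk i k))"
        using inv unfolding Inv_def st fst_conv snd_conv by blast+
      obtain ord rnk where old: "\<And>i. i < m \<Longrightarrow> sorted_rank n (M i) (ord i) (rnk i)"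
        "\<And>i k. i < m \<Longrightarrow> k < n \<Longrightarrow> H1 (od + int (i * n + k)) = int (ord i k)"
        "\<And>i k. i < m \<Longrightarrow> k < n \<Longrightarrow> H1 (rk + int (i * n + k)) = int (rnk i k)"
        using ex by blast
      let ?B = "int m * int n"
      have "(m + 1) * n \<le> n * n" using m by (intro mult_le_mono) auto
      then have "int ((m + 1) * n) \<le> int (n * n)" by (simp only: of_nat_le_iff)
      then have B: "?B + int n \<le> nn" "0 \<le> ?B" using nn by (simp_all add: algebra_simps)
      let ?R2 = "R1(vB := ?B)"
      have rok: "regsok ?R2" using R(1) fr unfolding regsok_def by simp
      have HM: "H1 (?B + int k) = M m k" if "k < n" for k
        using h[of "?B + int k"] M(1)[OF m that] B that lay by simp
      have sr: "wp W sortrow (?R2, H1) (\<lambda>t s'. t \<le> 500 * ((n + q + 1) * (q + 1)) \<and>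
         (\<forall>r. r \<notin> {vk, vy, vINF, vt, vp, vm, vj, vlen} \<longrightarrow> fst s' r = ?R2 r) \<and>
         0 \<le> fst s' vINF \<and> fst s' vINF \<le> cap \<and>
         (\<exists>ord rnk. sorted_rank n (M m) ord rnk \<and> (\<forall>j<n. snd s' (od + ?B + int j) = int (ord j)) \<and>
            (\<forall>k<n. snd s' (rk + ?B + int k) = int (rnk k))) \<and>
         (\<forall>x. (x < od + ?B \<or> od + ?B + int n \<le> x) \<longrightarrow> (x < rk + ?B \<or> rk + ?B + int n \<le> x) \<longrightarrow>
            (x < ky \<or> bm + int q \<le> x) \<longrightarrow> snd s' x = H1 x))"
        by (rule sortrow) (use rok B inf HM M(2)[OF m] lay in auto)
      have main: "wp W (sortrow ;; incr vi) (?R2, H1) (\<lambda>t st'. 4 + t \<le> ?b \<and> Inv (Suc m) st')"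
        unfolding wp_Seq
      proof (rule wp_mono[OF sr], elim conjE exE)
        fix t s' o1 r1
        assume t: "t \<le> 500 * ((n + q + 1) * (q + 1))"
          and f: "\<forall>r. r \<notin> {vk, vy, vINF, vt, vp, vm, vj, vlen} \<longrightarrow> fst s' r = ?R2 r"
          and i': "0 \<le> fst s' vINF" "fst s' vINF \<le> cap" and so: "sorted_rank n (M m) o1 r1"
          and ho: "\<forall>j<n. snd s' (od + ?B + int j) = int (o1 j)" and hr: "\<forall>k<n. snd s' (rk + ?B + int k) = int (r1 k)"
          and h': "\<forall>x. (x < od + ?B \<or> od + ?B + int n \<le> x) \<longrightarrow> (x < rk + ?B \<or> rk + ?B + int n \<le> x) \<longrightarrow>
            (x < ky \<or> bm + int q \<le> x) \<longrightarrow> snd s' x = H1 x"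
        obtain R3 H3 where s': "s' = (R3, H3)" by (cases s')
        have hh: "H3 x = H1 x" if "x < od + ?B \<or> od + ?B + int n \<le> x" "x < rk + ?B \<or> rk + ?B + int n \<le> x"
            "x < ky \<or> bm + int q \<le> x" for x using h' that unfolding s' snd_conv by blast
        have vi3: "R3 vi = int m" using f vi unfolding s' by simp
        have small: "int (i * n + k) < ?B \<and> 0 \<le> int (i * n + k)" if "i < m" "k < n" for i k
        proof -
          have "(i + 1) * n \<le> m * n" using that by (intro mult_le_mono) auto
          then have "i * n + k < m * n" using that by simp
          then have "int (i * n + k) < int (m * n)" by (simp only: of_nat_less_iff)
          then show ?thesis by simp
        qed
        have keep: "H3 (od + int (i * n + k)) = H1 (od + int (i * n + k))"
          "H3 (rk + int (i * n + k)) = H1 (rk + int (i * n + k))" if "i < m" "k < n" for i k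
          using small[OF that] B lay by (intro hh; linarith)+
        have new: "H3 (od + int (m * n + k)) = int (o1 k)" "H3 (rk + int (m * n + k)) = int (r1 k)" if "k < n" for k
          using ho hr that unfolding s' by (simp_all add: add.assoc)
        have rowsok: "\<exists>ord rnk. \<forall>i<Suc m. sorted_rank n (M i) (ord i) (rnk i) \<and>
          (\<forall>k<n. H3 (od + int (i * n + k)) = int (ord i k) \<and> H3 (rk + int (i * n + k)) = int (rnk i k))"
          using old keep new so
          by (intro exI[of _ "ord(m := o1)"] exI[of _ "rnk(m := r1)"]) (simp add: less_Suc_eq)
        have frame: "H3 b = H b" if "b < od \<or> F \<le> b \<and> b < ky" for b
        proof -
          have "H3 b = H1 b" using that B lay by (intro hh) linarith+
          then show ?thesis using h[OF that] by simp
        qed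
        have "Inv (Suc m) (R3(vi := int m + 1), H3)"
          unfolding Inv_def fst_conv snd_conv
        proof (intro conjI allI impI)
          show "(R3(vi := int m + 1)) r = R r" if "r \<notin> {vi, vB, vk, vy, vINF, vt, vp, vm, vj, vlen}" for r
            using f fr that unfolding s' by simp
        qed (use i' rowsok frame in \<open>simp_all add: s'\<close>)
        moreover have "t \<le> 3000 * (n * q)" using t sort_cost[OF qn] by linarith
        moreover have "int m + 1 \<le> W" using m lay by linarith
        ultimately show "wp W (incr vi) s' (\<lambda>t2 s2. 4 + (t + t2) \<le> ?b \<and> Inv (Suc m) s2)"
          unfolding s' wp_Set using vi3 by simp
      qed
      have eq: "wp W ?body (R1, H1) Q' \<longleftrightarrow> wp W (sortrow ;; incr vi) (?R2, H1) (\<lambda>t. Q' (4 + t))" for Q'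
      proof -
        have "R1 vN = int n" using fr R(1) unfolding regsok_def by simp
        moreover have "?B \<le> W" "int m \<le> W" "int n \<le> W" using B lay m by linarith+
        ultimately show ?thesis unfolding wp_Seq[of _ "HSet vB _"] wp_Set using vi by (simp add: eval_nat_numeral)
      qed
      show ?thesis unfolding st eq by (rule main)
    qed
    show "t \<le> (n + 1) * (?b + acost (V vi [<] V vN) + 1) \<and> Inv n st"
      if "Inv n st" "t \<le> (n + 1) * (?b + acost (V vi [<] V vN) + 1)" for t st
      using that by blast
  qed
  then have main: "wp W (HWhile (V vi [<] V vN) ?body) (R(vi := 0), H) (\<lambda>t. ?post (2 + t))"
  proof (rule wp_mono, elim conjE)
    fix t st assume t0: "t \<le> (n + 1) * (?b + acost (V vi [<] V vN) + 1)" and inv: "Inv n st"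
    have nq1: "1 * 1 \<le> n * q" using n0 q0 by (intro mult_le_mono) auto
    have "?b + acost (V vi [<] V vN) + 1 = 3000 * (n * q) + 12" by simp
    then have "t \<le> (n + 1) * (3000 * (n * q) + 12)" using t0 by presburger
    also have "\<dots> \<le> (2 * n) * (3012 * (n * q))" using n0 nq1 by (intro mult_le_mono) linarith+
    also have "\<dots> = 6024 * (n * n * q)" by simp
    finally have "t \<le> 6024 * (n * n * q)" .
    moreover have "1 * 1 \<le> n * (n * q)" using n0 nq1 by (intro mult_le_mono) auto
    then have "1 \<le> n * n * q" by (simp add: mult.assoc)
    ultimately have "2 + t \<le> 6100 * (n * n * q)" by linarith
    then show "?post (2 + t) st" using inv unfolding Inv_def by blast
  qed
  have eq: "wp W rows (R, H) Q' \<longleftrightarrow> wp W (HWhile (V vi [<] V vN) ?body) (R(vi := 0), H) (\<lambda>t. Q' (2 + t))" for Q'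
    unfolding rows_def wp_Seq[of _ "HSet vi _"] wp_Set using lay by simp
  show ?thesis unfolding eq by (rule main)
qed

lemma isqrt:
  assumes "R vN = int n" and qmin: "\<And>j. j < q \<Longrightarrow> j * j < n"
  shows "wp W isqrt (R, H) (\<lambda>t s'. t \<le> 12 * (q + 1) \<and> s' = (R(vq := int q), H))"
proof -
  define Inv where "Inv i st \<longleftrightarrow> st = (R(vq := int (Suc i)), H)" for i and st :: state
  have qq: "int i * int i \<le> int q * int q" if "i \<le> q" for i using that by (intro mult_mono) auto
  have qW: "int q * int q \<le> W" "int q \<le> W" "int n \<le> W" "1 \<le> W" "int q + 1 \<le> W" using lay by linarith+
  have "wp W (HWhile (V vq [*] V vq [<] V vN) (incr vq)) (R(vq := 1), H) (\<lambda>t st. t \<le> (q - 1 + 1) * 10 \<and> Inv (q - 1) st)"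
  proof (rule wp_While_for[where Inv = Inv and m = "q - 1" and b = 4])
    show "safe W (V vq [*] V vq [<] V vN) st \<and> (aval (V vq [*] V vq [<] V vN) st \<noteq> 0 \<longleftrightarrow> i < q - 1)"
      if "i \<le> q - 1" "Inv i st" for i st
    proof -
      have iq: "Suc i \<le> q" using that(1) q0 by simp
      have "int (Suc i) * int (Suc i) < int n \<longleftrightarrow> i < q - 1"
      proof (cases "Suc i = q")
        case True
        then show ?thesis using nq sizes(3) by simp
      next
        case False
        then have "Suc i < q" using iq by simp
        then have "Suc i * Suc i < n" by (rule qmin)
        then have "int (Suc i * Suc i) < int n" by (simp only: of_nat_less_iff)
        then show ?thesis using False iq by (simp only: of_nat_mult) simp
      qed
      moreover have "int (Suc i) * int (Suc i) \<le> W" "int (Suc i) \<le> W" using qq[OF iq] qW iq by linarith+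
      ultimately show ?thesis using that(2) assms(1) qW unfolding Inv_def by (simp del: of_nat_Suc)
    qed
    show "wp W (incr vq) st (\<lambda>t st'. t \<le> 4 \<and> Inv (Suc i) st')" if "i < q - 1" "Inv i st" for i st
    proof -
      have "int (Suc i) + 1 \<le> W" using that(1) qW by linarith
      then show ?thesis using that(2) qW unfolding Inv_def by (simp add: wp_Set)
    qed
  qed (auto simp: Inv_def)
  then have "wp W (HWhile (V vq [*] V vq [<] V vN) (incr vq)) (R(vq := 1), H)
     (\<lambda>t s'. 2 + t \<le> 12 * (q + 1) \<and> s' = (R(vq := int q), H))"
    by (rule wp_mono) (use q0 in \<open>auto simp: Inv_def\<close>)
  then show ?thesis unfolding isqrt_def using qW by (simp add: wp_Seq wp_Set)
qed

lemma bases: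
  assumes "R vN = int n" "R vNN = nn" "R vq = int q"
  shows "wp W bases (R, H) (\<lambda>t s'. t \<le> 40 \<and> snd s' = H \<and> regsok (fst s') \<and> fst s' vlen = nn \<and>
    (\<forall>r. r \<notin> {vO, vRK, vF, vKy, vBm, vlen} \<longrightarrow> fst s' r = R r))"
proof -
  have "int n \<le> W" "int q \<le> W" "int q * int q \<le> W" "nn \<le> W" "0 \<le> nn"
    using lay by linarith+
  then show ?thesis unfolding bases_def using assms
    by (simp add: wp_simps regsok_def) (use lay od rk F ky bm in \<open>intro conjI; linarith\<close>)
qed

lemma preprocess:
  assumes qmin: "\<And>j. j < q \<Longrightarrow> j * j < n" and qn: "q \<le> n"
    and M: "\<And>i k. i < n \<Longrightarrow> k < n \<Longrightarrow> \<bar>M i k\<bar> \<le> int U"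
  shows "wp W preprocess (initial_state n M) (\<lambda>t s'. t \<le> 7000 * (n * n * q) \<and> (\<exists>L ord rnk.
     - int U \<le> L \<and> L \<le> 0 \<and> (\<forall>i<n. \<forall>k<n. L \<le> M i k) \<and> (\<forall>i<n. sorted_rank n (M i) (ord i) (rnk i)) \<and>
     regsok (fst s') \<and> fst s' vL = L \<and> 0 \<le> fst s' vINF \<and> fst s' vINF \<le> cap \<and>
     (\<forall>i<n. \<forall>k<n. snd s' (int (i * n + k)) = M i k \<and> snd s' (od + int (i * n + k)) = int (ord i k) \<and>
        snd s' (rk + int (i * n + k)) = int (rnk i k)) \<and>
     fst s' vS = int q \<and> fst s' vFr = 1 \<and> fst s' vbase = 0 \<and> fst s' vC = 0 \<and>
     (\<forall>b. b < 0 \<or> F \<le> b \<and> b < ky \<longrightarrow> snd s' b = 0)))"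
    (is "wp _ _ _ ?post")
proof -
  obtain R0 H0 where ini: "initial_state n M = (R0, H0)" by (cases "initial_state n M")
  have R0: "R0 = (\<lambda>_. 0)(0 := int n)" and H0: "\<And>a. H0 a = (if 0 \<le> a \<and> a < int (n * n) then M (nat a div n) (nat a mod n) else 0)"
    using ini unfolding initial_state_def by auto
  have nnn: "int (n * n) = nn" using nn by simp
  have H0M: "H0 (int (i * n + k)) = M i k" if "i < n" "k < n" for i k
  proof -
    have "(i + 1) * n \<le> n * n" using that by (intro mult_le_mono) auto
    then have "i * n + k < n * n" using that by simp
    then have "int (i * n + k) < int (n * n)" by (simp only: of_nat_less_iff)
    then show ?thesis using that unfolding H0 by (simp only: nat_int of_nat_0_le_iff simp_thms if_True) simp
  qed
  have H0U: "\<bar>H0 (int p)\<bar> \<le> int U" if "p < n * n" for p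
  proof -
    have "p div n < n" "p mod n < n" using that n0 by (auto simp: less_mult_imp_div_less)
    then show ?thesis using H0M[of "p div n" "p mod n"] M by simp
  qed
  have UW: "int U \<le> W" "nn \<le> W" "0 \<le> nn" "int n \<le> W" "int q \<le> W" "1 \<le> W" using lay by linarith+
  let ?R1 = "R0(vNN := nn)"
  let ?c5 = "HSet vS (V vq) ;; HSet vFr (N 1)"
  let ?c4 = "rows ;; ?c5"
  let ?c3 = "HSet vL (V vm) ;; ?c4"
  let ?c2 = "minrange ;; ?c3"
  let ?c1 = "bases ;; ?c2"
  have nnq: "n * n \<le> n * n * q" "1 \<le> n * n * q" "q \<le> n * n * q"
  proof -
    show "n * n \<le> n * n * q" using q0 by simp
    have "1 * 1 \<le> n * q" using n0 q0 by (intro mult_le_mono) auto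
    then have "1 * 1 \<le> n * (n * q)" using n0 by (intro mult_le_mono) auto
    then show "1 \<le> n * n * q" by (simp add: mult.assoc)
    have "1 * q \<le> (n * n) * q" using n0 by (intro mult_le_mono) auto
    then show "q \<le> n * n * q" by simp
  qed
  have s4: "wp W ?c4 (R, H0) (\<lambda>t. ?post (u + t))"
    if r: "regsok R" "R vINF = 0" "R vbase = 0" "R vC = 0" "R vL = L"
      and L: "- int U \<le> L" "L \<le> 0" "\<And>i k. i < n \<Longrightarrow> k < n \<Longrightarrow> L \<le> M i k"
      and u: "u \<le> 12 * (q + 1) + 40 * (n * n + 1) + 60" for R L u
    unfolding wp_Seq[of _ rows]
  proof (rule wp_mono[OF rows[of R H0 M, OF r(1) _ _ qn H0M M]])
    show "0 \<le> R vINF" "R vINF \<le> cap" using r(2) unfolding cap_def by auto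
    fix t s'
    assume "t \<le> 6100 * (n * n * q) \<and> 0 \<le> fst s' vINF \<and> fst s' vINF \<le> cap \<and>
     (\<forall>r. r \<notin> {vi, vB, vk, vy, vINF, vt, vp, vm, vj, vlen} \<longrightarrow> fst s' r = R r) \<and>
     (\<forall>b. b < od \<or> F \<le> b \<and> b < ky \<longrightarrow> snd s' b = H0 b) \<and>
     (\<exists>ord rnk. \<forall>i<n. sorted_rank n (M i) (ord i) (rnk i) \<and>
        (\<forall>k<n. snd s' (od + int (i * n + k)) = int (ord i k) \<and> snd s' (rk + int (i * n + k)) = int (rnk i k)))"
    then obtain ord rnk where t: "t \<le> 6100 * (n * n * q)" and inf: "0 \<le> fst s' vINF" "fst s' vINF \<le> cap"
      and f: "\<And>r. r \<notin> {vi, vB, vk, vy, vINF, vt, vp, vm, vj, vlen} \<Longrightarrow> fst s' r = R r"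
      and h: "\<And>b. b < od \<or> F \<le> b \<and> b < ky \<Longrightarrow> snd s' b = H0 b"
      and so: "\<And>i. i < n \<Longrightarrow> sorted_rank n (M i) (ord i) (rnk i)"
      and a: "\<And>i k. i < n \<Longrightarrow> k < n \<Longrightarrow> snd s' (od + int (i * n + k)) = int (ord i k) \<and> snd s' (rk + int (i * n + k)) = int (rnk i k)"
      by blast
    obtain R5 H5 where s': "s' = (R5, H5)" by (cases s')
    let ?R6 = "R5(vS := int q, vFr := 1)"
    have rq: "R5 vq = int q" using f r(1) unfolding s' regsok_def by simp
    have rok: "regsok ?R6" using f r(1) unfolding s' regsok_def by simp
    have hM: "H5 (int (i * n + k)) = M i k" if "i < n" "k < n" for i k
    proof -
      have "(i + 1) * n \<le> n * n" using that by (intro mult_le_mono) auto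
      then have "i * n + k < n * n" using that by simp
      then have "int (i * n + k) < nn" using nnn by (metis of_nat_less_iff)
      then have "int (i * n + k) < od" using lay by linarith
      then show ?thesis using h H0M[OF that] unfolding s' by simp
    qed
    have z: "H5 b = 0" if "b < 0 \<or> F \<le> b \<and> b < ky" for b
    proof -
      have "b < od \<or> F \<le> b \<and> b < ky" "\<not> (0 \<le> b \<and> b < int (n * n))" using that lay nnn by linarith+
      then show ?thesis using h[of b] H0[of b] unfolding s' by (simp only: snd_conv if_False)
    qed
    \<comment> \<open>Stated for variables in place of the products, the estimate becomes
      linear.\<close>
    have "u + (t + 4) \<le> 7000 * x" if "t \<le> 6100 * x" "y \<le> x" "1 \<le> x" "q \<le> x" "u \<le> 12 * (q + 1) + 40 * (y + 1) + 60" for x y :: nat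
      using that by simp
    from this[OF t nnq u] have tm: "u + (t + 4) \<le> 7000 * (n * n * q)" .
    have P: "?post (u + (t + 4)) (?R6, H5)"
    proof (rule conjI[OF tm], rule exI[of _ L], rule exI[of _ ord], rule exI[of _ rnk], intro conjI allI impI)
      show "fst (?R6, H5) vL = L" using f r(5) unfolding s' by simp
      show "fst (?R6, H5) vbase = 0" using f r(3) unfolding s' by simp
      show "fst (?R6, H5) vC = 0" using f r(4) unfolding s' by simp
    qed (use L so rok inf hM z a in \<open>simp_all add: s'\<close>)
    have eq: "wp W ?c5 (R5, H5) Q' \<longleftrightarrow> Q' 4 (?R6, H5)" for Q'
      unfolding wp_Seq wp_Set using rq UW by (simp add: eval_nat_numeral)
    show "wp W ?c5 s' (\<lambda>t2 s2. ?post (u + (t + t2)) s2)" unfolding s' eq by (rule P)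
  qed
  have s2: "wp W ?c2 (R, H0) (\<lambda>t. ?post (u + t))"
    if r: "regsok R" "R vINF = 0" "R vbase = 0" "R vC = 0" "R vp = 0" "R vlen = nn"
      and u: "u \<le> 12 * (q + 1) + 50" for R u
  proof -
    have mr: "wp W minrange (R, H0) (\<lambda>t s'. t \<le> 40 * (n * n + 1) \<and> snd s' = H0 \<and>
      is_min 0 (\<lambda>j. H0 (0 + int j)) (n * n) (fst s' vm) \<and> (\<forall>r. r \<notin> {vm, vj} \<longrightarrow> fst s' r = R r))"
    proof (rule minrange)
      show "R vlen = int (n * n)" "0 + int (n * n) \<le> W" using r(6) nnn UW by linarith+
      show "\<bar>H0 (0 + int j)\<bar> \<le> W" if "j < n * n" for j using H0U[OF that] UW by simp
    qed (use r UW in auto)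
    show ?thesis unfolding wp_Seq[of _ minrange]
    proof (rule wp_mono[OF mr], elim conjE)
      fix t s'
      assume t: "t \<le> 40 * (n * n + 1)" and h: "snd s' = H0" and m: "is_min 0 (\<lambda>j. H0 (0 + int j)) (n * n) (fst s' vm)"
        and f: "\<forall>r. r \<notin> {vm, vj} \<longrightarrow> fst s' r = R r"
      obtain R3 where s': "s' = (R3, H0)" using h by (cases s') auto
      let ?L = "R3 vm"
      have L0: "?L \<le> 0" using m unfolding s' is_min_def by simp
      have LU: "- int U \<le> ?L" using m H0U unfolding s' is_min_def by fastforce
      have LM: "?L \<le> M i k" if "i < n" "k < n" for i k
      proof -
        have "(i + 1) * n \<le> n * n" using that by (intro mult_le_mono) auto
        then have "i * n + k < n * n" using that by simp
        then have "?L \<le> H0 (0 + int (i * n + k))" using m unfolding s' is_min_def by (simp only: fst_conv)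
        then show ?thesis using H0M[OF that] by simp
      qed
      let ?R4 = "R3(vL := ?L)"
      have "wp W ?c4 (?R4, H0) (\<lambda>w. ?post (u + (t + 2) + w))"
        by (rule s4[where L = ?L]) (use f r L0 LU LM t u in \<open>auto simp: s' regsok_def\<close>)
      moreover have "\<bar>?L\<bar> \<le> W" using L0 LU UW by linarith
      then have eq: "wp W ?c3 (R3, H0) Q' \<longleftrightarrow> wp W ?c4 (?R4, H0) (\<lambda>w. Q' (2 + w))" for Q'
        unfolding wp_Seq[of _ "HSet vL _"] wp_Set by simp
      ultimately show "wp W ?c3 s' (\<lambda>t2 s2. ?post (u + (t + t2)) s2)" unfolding s' eq by (simp add: add.assoc)
    qed
  qed
  have s1: "wp W ?c1 (?R1(vq := int q), H0) (\<lambda>t. ?post (u + t))" if u: "u \<le> 12 * (q + 1) + 10" for u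
    unfolding wp_Seq[of _ bases]
  proof (rule wp_mono[OF bases], goal_cases)
    case (4 t s')
    then have s': "s' = (fst s', H0)" by (cases s') auto
    have "wp W ?c2 (fst s', H0) (\<lambda>w. ?post (u + t + w))"
      by (rule s2) (use 4 u in \<open>auto simp: R0\<close>)
    then show ?case by (subst s') (simp add: add.assoc)
  qed (auto simp: R0)
  have s0: "wp W (isqrt ;; ?c1) (?R1, H0) (\<lambda>t. ?post (4 + t))"
    unfolding wp_Seq[of _ isqrt]
  proof (rule wp_mono[OF isqrt[OF _ qmin]], goal_cases)
    case (3 t s')
    have "wp W ?c1 (?R1(vq := int q), H0) (\<lambda>w. ?post (4 + t + w))" by (rule s1) (use 3 in auto)
    then show ?case using 3 by (simp add: add.assoc)
  qed (auto simp: R0)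
  have eq: "wp W preprocess (R0, H0) Q' \<longleftrightarrow> wp W (isqrt ;; ?c1) (?R1, H0) (\<lambda>t. Q' (4 + t))" for Q'
    unfolding preprocess_def wp_Seq[of _ "HSet vNN _"] wp_Set using UW nn by (simp add: R0 eval_nat_numeral)
  show ?thesis unfolding ini eq by (rule s0)
qed

end

subsection \<open>Running time\<close>

lemma exec_mono:
  assumes "exec W c s t s'" "W \<le> W'"
  shows "exec W' c s t s'"
  using assms(1)
proof (induction rule: exec.induct)
  case (Const k r R H)
  then show ?case using assms(2) by (intro exec.Const) simp
next
  case (Op x f R a b r H)
  then show ?case using assms(2) by (intro exec.Op) simp_all
qed (rule exec.intros; assumption)+

lemma solves_online_mono:
  assumes "solves_online prob alg W n M v T" "W \<le> W'"
  shows "solves_online prob alg W' n M v T"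
proof -
  obtain s t0 t where
    "exec W (fst alg) (initial_state n M) t0 (s 0)"
    "\<forall>j<n. exec W (snd alg) (receive_query n (v j) (s j)) (t j) (s (Suc j)) \<and>
       (\<forall>i<n. answer n (s (Suc j)) i = prob n M (v j) i)"
    "n * n + t0 + (\<Sum>j<n. n + t j) \<le> T"
    using assms(1) unfolding solves_online_def by blast
  then show ?thesis unfolding solves_online_def
    by (intro exI[of _ s] exI[of _ t0] exI[of _ t]) (simp add: exec_mono[OF _ assms(2)])
qed

lemmas program_defs = preprocess_def isqrt_def bases_def rows_def minrange_def sortrow_def keys_def pad_def
  blockmins_def select_all_def ext_body_def query_def levels_def attempt_def attempt_body_def runinst_def
  build_def writeq_def collect_def finish_def finish_body_def scan_body_def cand_def

lemma hvars_programs: "hvars preprocess \<subseteq> {..<40}" "hvars (query P Q) \<subseteq> {..<40}"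
proof -
  have tr: "hvars (tr c) \<subseteq> {..<40}" for c using hvars_tr[of c] by (rule order_trans) simp
  show "hvars preprocess \<subseteq> {..<40}" "hvars (query P Q) \<subseteq> {..<40}"
    by (simp_all add: program_defs avars_regE avars_heapE tr)
qed

text \<open>The bound is the potential after n queries, evaluated with group size at most
  \<open>Smax\<close> and at most \<open>lg\<close> doublings, plus the steps for receiving the
  input.\<close>

lemma online_solution:
  fixes v :: "nat \<Rightarrow> vector"
  assumes lay0: "layout n q U W nn od rk F ky bm" and cb: "cell_bounds Win W A Y"
    and solver: "\<And>X w. (\<forall>i<n. \<forall>k<n. \<bar>X i k\<bar> \<le> int U + 1) \<Longrightarrow> (\<forall>j<n. \<forall>k<n. \<bar>w j k\<bar> \<le> int U + 1) \<Longrightarrow>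
      solves_online exists_dominance_OMv (P, Q) Win n X w T"
    and regsA: "\<And>r. r \<in> regs P \<union> regs Q \<Longrightarrow> int r \<le> A"
    and Winb: "int n + int U + 1 \<le> Win" and Ab: "nn + 2 * int n \<le> A"
    and qmin: "\<And>j. j < q \<Longrightarrow> j * j < n" and qn: "q \<le> n" and qS: "q \<le> Smax"
    and lev: "\<And>s. q \<le> s \<Longrightarrow> n * n * s \<le> 2 * ((n + s - 1) div s) * T \<Longrightarrow> 2 * s \<le> Smax"
    and Yb: "8 * (int n * int Smax) \<le> Y" and Wb: "4 * (nn * int Smax) + int T + 9 \<le> W"
    and lg: "\<And>l. 2 ^ l \<le> Smax \<Longrightarrow> l \<le> lg"
    and M: "\<And>i k. i < n \<Longrightarrow> k < n \<Longrightarrow> \<bar>M i k\<bar> \<le> int U"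
    and v: "\<And>j k. j < n \<Longrightarrow> k < n \<Longrightarrow> \<bar>v j k\<bar> \<le> int U"
  shows "solves_online min_max_OMv (hcomp 40 preprocess, hcomp 40 (query P Q)) W n M v
     (24000 * (n * n * Smax) + 100 * (lg * T))"
proof -
  interpret layout n q U W nn od rk F ky bm by fact
  define Post where "Post = (\<lambda>t s'. t \<le> 7000 * (n * n * q) \<and> (\<exists>L ord rnk.
     - int U \<le> L \<and> L \<le> 0 \<and> (\<forall>i<n. \<forall>k<n. L \<le> M i k) \<and> (\<forall>i<n. sorted_rank n (M i) (ord i) (rnk i)) \<and>
     regsok (fst s') \<and> fst s' vL = L \<and> 0 \<le> fst s' vINF \<and> fst s' vINF \<le> cap \<and>
     (\<forall>i<n. \<forall>k<n. snd s' (int (i * n + k)) = M i k \<and> snd s' (od + int (i * n + k)) = int (ord i k) \<and>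
        snd s' (rk + int (i * n + k)) = int (rnk i k)) \<and>
     fst s' vS = int q \<and> fst s' vFr = 1 \<and> fst s' vbase = 0 \<and> fst s' vC = 0 \<and>
     (\<forall>b. b < 0 \<or> F \<le> b \<and> b < ky \<longrightarrow> snd s' b = 0)))"
  have "wp W preprocess (initial_state n M) Post"
    unfolding Post_def by (rule preprocess[of M, OF qmin qn M])
  then obtain t0 s0 where pre: "hexec W preprocess (initial_state n M) t0 s0" and post: "Post t0 s0"
    by (rule wpE)
  have t0: "t0 \<le> 7000 * (n * n * q)" using post unfolding Post_def by (rule conjunct1)
  have "\<exists>L ord rnk.
     - int U \<le> L \<and> L \<le> 0 \<and> (\<forall>i<n. \<forall>k<n. L \<le> M i k) \<and> (\<forall>i<n. sorted_rank n (M i) (ord i) (rnk i)) \<and>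
     regsok (fst s0) \<and> fst s0 vL = L \<and> 0 \<le> fst s0 vINF \<and> fst s0 vINF \<le> cap \<and>
     (\<forall>i<n. \<forall>k<n. snd s0 (int (i * n + k)) = M i k \<and> snd s0 (od + int (i * n + k)) = int (ord i k) \<and>
        snd s0 (rk + int (i * n + k)) = int (rnk i k)) \<and>
     fst s0 vS = int q \<and> fst s0 vFr = 1 \<and> fst s0 vbase = 0 \<and> fst s0 vC = 0 \<and>
     (\<forall>b. b < 0 \<or> F \<le> b \<and> b < ky \<longrightarrow> snd s0 b = 0)"
    using post unfolding Post_def by (rule conjunct2)
  then obtain L ord rnk where L: "- int U \<le> L" "L \<le> 0" "\<And>i k. i < n \<Longrightarrow> k < n \<Longrightarrow> L \<le> M i k"
    and so: "\<And>i. i < n \<Longrightarrow> sorted_rank n (M i) (ord i) (rnk i)"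
    and st: "regsok (fst s0)" "fst s0 vL = L" "0 \<le> fst s0 vINF" "fst s0 vINF \<le> cap"
      "\<And>i k. i < n \<Longrightarrow> k < n \<Longrightarrow> snd s0 (int (i * n + k)) = M i k \<and> snd s0 (od + int (i * n + k)) = int (ord i k) \<and>
        snd s0 (rk + int (i * n + k)) = int (rnk i k)"
    and r0: "fst s0 vS = int q" "fst s0 vFr = 1" "fst s0 vbase = 0" "fst s0 vC = 0"
    and z: "\<And>b. b < 0 \<or> F \<le> b \<and> b < ky \<Longrightarrow> snd s0 b = 0"
    by blast
  interpret cell_bounds Win W A Y by fact
  interpret omv2 n q U W nn od rk F ky bm Win A Y P Q T M L ord rnk Smax
    by unfold_locales (use solver regsA Winb Ab qn qS lev Yb Wb M L so in auto)
  have static0: "static (fst s0) (snd s0)"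
    unfolding static_def
  proof (intro conjI allI impI)
    fix p assume "p < n * n"
    then have "p div n < n" "p mod n < n" using idx by auto
    from st(5)[OF this] show "snd s0 (int p) = M (p div n) (p mod n)"
      "snd s0 (od + int p) = int (ord (p div n) (p mod n))" "snd s0 (rk + int p) = int (rnk (p div n) (p mod n))"
      by (simp_all only: div_mult_mod_eq)
  qed (use st in auto)
  have zr: "zeroed y (snd s0)" if "0 \<le> y" for y
    using z cell_neg[of y] cell_neg[of "y + 1"] that unfolding zeroed_def by simp
  have "fstb (snd s0)" unfolding fstb_def using z order by simp
  then have dyn0: "dyn (fst s0) (snd s0) 0 q 0 True (\<lambda>_. 0)"
    unfolding dyn_def using r0 qS zr sizes nn n0 q0 by simp
  have "int t0 \<le> int (7000 * (n * n * q))" using t0 by (simp only: of_nat_le_iff)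
  then have "int t0 \<le> pot 0 q 0 (fst s0 vC) True" unfolding pot_def r0(4) using nn by simp
  then have qinv0: "qinv 0 (int t0) (fst s0) (snd s0)"
    unfolding qinv_def using static0 dyn0 by (intro conjI exI[of _ q] exI[of _ 0] exI[of _ True] exI[of _ "\<lambda>_. 0"]) auto
  \<comment> \<open>A machine state agrees with a state of the structured program only on registers
    below 40. The scratch registers carry debris from query to query, so the invariant is stated up
    to them.\<close>
  define I where "I j sr Tot \<longleftrightarrow> (\<exists>\<sigma>. agree 40 (fst sr) \<sigma> \<and> qinv j Tot \<sigma> (snd sr))" for j sr Tot
  obtain R0 where pre': "exec W (hcomp 40 preprocess) (initial_state n M) t0 (R0, snd s0)" "agree 40 R0 (fst s0)"
    using hcomp_exec[OF pre hvars_programs(1), of "fst (initial_state n M)"] by (auto simp: agree_def)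
  have I0: "I 0 (R0, snd s0) (int t0)" unfolding I_def using pre'(2) qinv0 by auto
  have step: "\<exists>t sr'. exec W (hcomp 40 (query P Q)) (receive_query n (v j) sr) t sr' \<and>
      (\<forall>i<n. answer n sr' i = min_max_OMv n M (v j) i) \<and> I (Suc j) sr' (Tot + int t)"
    if j: "j < n" and inv: "I j sr Tot" for j sr Tot
  proof -
    obtain \<sigma> where ag: "agree 40 (fst sr) \<sigma>" and qi: "qinv j Tot \<sigma> (snd sr)" using inv unfolding I_def by blast
    let ?Hq = "snd (receive_query n (v j) sr)"
    have Hq: "?Hq (nn + int k) = v j k" if "k < n" for k
      using that nn_nat(2) unfolding receive_query_def by (simp add: nn nat_add_distrib nat_mult_distrib)
    have Hq2: "?Hq b = snd sr b" if "b < nn \<or> nn + int n \<le> b" for b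
      using that nn unfolding receive_query_def by auto
    obtain t s' where e: "hexec W (query P Q) (\<sigma>, ?Hq) t s'"
      and post: "qinv (Suc j) (Tot + int t) (fst s') (snd s')"
        "\<forall>i<n. snd s' (nn + int n + int i) = min_max_OMv n M (v j) i"
      using wpE[OF query[OF qi j v[OF j] Hq Hq2]] by blast
    have "fst (receive_query n (v j) sr) = fst sr" by (simp add: receive_query_def)
    then obtain R' where R': "exec W (hcomp 40 (query P Q)) (receive_query n (v j) sr) t (R', snd s')" "agree 40 R' (fst s')"
      using hcomp_exec[OF e hvars_programs(2), of "fst sr"] ag by (metis fst_conv prod.collapse snd_conv)
    have "I (Suc j) (R', snd s') (Tot + int t)" unfolding I_def using R'(2) post(1) by auto
    moreover have "\<forall>i<n. answer n (R', snd s') i = min_max_OMv n M (v j) i"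
      using post(2) nn unfolding answer_def by simp
    ultimately show ?thesis using R'(1) by blast
  qed
  \<comment> \<open>Each single query step is only known to exist; states and times are collected
    into sequences by extending them one query at a time.\<close>
  have seq: "\<exists>s t. s 0 = (R0, snd s0) \<and> (\<forall>j<m. exec W (hcomp 40 (query P Q)) (receive_query n (v j) (s j)) (t j) (s (Suc j)) \<and>
       (\<forall>i<n. answer n (s (Suc j)) i = min_max_OMv n M (v j) i)) \<and> I m (s m) (int t0 + int (\<Sum>j<m. t j))"
    if "m \<le> n" for m
    using that
  proof (induction m)
    case 0
    show ?case by (rule exI[of _ "\<lambda>_. (R0, snd s0)"], rule exI[of _ "\<lambda>_. 0"]) (simp add: I0)
  next
    case (Suc m)
    then obtain s t where s: "s 0 = (R0, snd s0)"
      "\<And>j. j < m \<Longrightarrow> exec W (hcomp 40 (query P Q)) (receive_query n (v j) (s j)) (t j) (s (Suc j)) \<and>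
       (\<forall>i<n. answer n (s (Suc j)) i = min_max_OMv n M (v j) i)"
      "I m (s m) (int t0 + int (\<Sum>j<m. t j))" by auto
    obtain u sr' where u: "exec W (hcomp 40 (query P Q)) (receive_query n (v m) (s m)) u sr'"
      "\<forall>i<n. answer n sr' i = min_max_OMv n M (v m) i" "I (Suc m) sr' (int t0 + int (\<Sum>j<m. t j) + int u)"
      using step[OF _ s(3)] Suc.prems by auto
    have "(\<Sum>j<Suc m. (t(m := u)) j) = (\<Sum>j<m. t j) + u" by simp
    then have "I (Suc m) sr' (int t0 + int (\<Sum>j<Suc m. (t(m := u)) j))" using u(3) by (simp add: add.assoc)
    moreover have "\<forall>j<Suc m. exec W (hcomp 40 (query P Q)) (receive_query n (v j) ((s(Suc m := sr')) j))
         ((t(m := u)) j) ((s(Suc m := sr')) (Suc j)) \<and>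
       (\<forall>i<n. answer n ((s(Suc m := sr')) (Suc j)) i = min_max_OMv n M (v j) i)"
      using s(2) u(1,2) by (auto simp: less_Suc_eq)
    ultimately show ?case using s(1)
      by (intro exI[of _ "s(Suc m := sr')"] exI[of _ "t(m := u)"]) simp
  qed
  obtain s t where s: "s 0 = (R0, snd s0)" "\<forall>j<n. exec W (hcomp 40 (query P Q)) (receive_query n (v j) (s j)) (t j) (s (Suc j)) \<and>
       (\<forall>i<n. answer n (s (Suc j)) i = min_max_OMv n M (v j) i)" and In: "I n (s n) (int t0 + int (\<Sum>j<n. t j))"
    using seq[OF order_refl] by blast
  have "n * n + t0 + (\<Sum>j<n. n + t j) \<le> 24000 * (n * n * Smax) + 100 * (lg * T)"
  proof -
    obtain \<sigma> where "qinv n (int t0 + int (\<Sum>j<n. t j)) \<sigma> (snd (s n))" using In unfolding I_def by blast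
    then obtain sz base fresh \<tau> l where d: "dyn \<sigma> (snd (s n)) n sz base fresh \<tau>" "q * 2 ^ l = sz"
      "int t0 + int (\<Sum>j<n. t j) \<le> pot n sz l (\<sigma> vC) fresh" unfolding qinv_def by blast
    have C: "\<sigma> vC < nn * int sz" "sz \<le> Smax" using d(1) unfolding dyn_def by blast+
    have "1 * 2 ^ l \<le> q * 2 ^ l" using q0 by (intro mult_le_mono) auto
    then have l: "l \<le> lg" using lg d(2) C(2) by simp
    have lT: "int l * int T \<le> int lg * int T" using l by (intro mult_right_mono) auto
    have nS: "nn * int sz \<le> nn * int Smax" using C(2) sizes by (intro mult_left_mono) auto
    have S1: "nn * 1 \<le> nn * int Smax" using qS q0 sizes by (intro mult_left_mono) auto
    have nns: "0 \<le> nn * int sz" using sizes by simp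
    \<comment> \<open>With the counter below \<open>nn * int sz\<close> and n queries made, the
      coefficients add up to 100 + 10000 + 10000 + 3000.\<close>
    have "pot n sz l (\<sigma> vC) fresh \<le> 100 * (nn * int sz) + 10000 * (nn * int sz) + 100 * (int l * int T) + 10000 * (nn * int sz) + 3000 * (nn * int sz)"
    proof -
      have e: "int n * (int n * int sz) = nn * int sz" using nn by simp
      show ?thesis unfolding pot_def e using C(1) nns by (cases fresh) simp_all
    qed
    then have "int t0 + int (\<Sum>j<n. t j) \<le> 23100 * (nn * int Smax) + 100 * (int lg * int T)"
      using d(3) lT nS by linarith
    moreover have "int (n * n + t0 + (\<Sum>j<n. n + t j)) = 2 * nn + (int t0 + int (\<Sum>j<n. t j))"
      using nn by (simp add: sum.distrib)
    ultimately have "int (n * n + t0 + (\<Sum>j<n. n + t j)) \<le> 24000 * (nn * int Smax) + 100 * (int lg * int T)"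
      using S1 sizes(1) by linarith
    also have "\<dots> = int (24000 * (n * n * Smax) + 100 * (lg * T))" using nn by simp
    finally show ?thesis by (simp only: of_nat_le_iff)
  qed
  then show ?thesis unfolding solves_online_def fst_conv snd_conv
    using s pre'(1) by (intro exI[of _ s] exI[of _ t0] exI[of _ t]) simp
qed

text \<open>Everything is at most \<open>k * X ^ 4\<close> for \<open>X = Nw ^ (2 * Suc c)\<close>
  and a constant k: A and Y are O(X), and cell addresses have degree 4 in A. The factor k disappears
  in the exponent because \<open>Nw\<close> is at least 2; \<open>K\<close> is a sum that dominates
  all such factors.\<close>

lemma nat_word_bounds:
  fixes n U q T C S \<rho> c :: nat
  defines "Nw \<equiv> n + U + 2"
  defines "Win \<equiv> (n + (U + 1) + 2) ^ Suc c"
  defines "A \<equiv> Win + \<rho> + n * n + 2 * n" and "Y \<equiv> 8 * (n * S)"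
  defines "K1 \<equiv> 2 * ((\<rho> + 4) * (\<rho> + 4)) + (\<rho> + 4) + 8 * (8 * C + 9) + 1"
  defines "K \<equiv> K1 * K1 + 8 * (8 * C + 9) + 2 + 22 + 4 * (8 * C + 9) + C + 9"
  assumes "q \<le> n" "T \<le> C * n ^ 3" "S \<le> (8 * C + 9) * n"
  shows "(2 * A * A + A + Y + 1) * (2 * A * A + A + Y + 1) + Y + 2 \<le> Nw ^ (8 * Suc c + K)"
    "3 * (n * n) + 6 * n + q * q + q + U * n + n + 9 \<le> Nw ^ (8 * Suc c + K)"
    "4 * (n * n * S) + T + 9 \<le> Nw ^ (8 * Suc c + K)"
proof -
  define X where "X = Nw ^ (2 * Suc c)"
  have N2: "2 \<le> Nw" unfolding Nw_def by simp
  have N0: "0 < Nw" using N2 by simp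
  have N_sq: "Nw + Nw \<le> Nw ^ 2" using mult_le_mono1[OF N2, of Nw] unfolding power2_eq_square by linarith
  have NX: "Nw ^ 2 \<le> X" unfolding X_def using N0 by (intro power_increasing) auto
  have X1: "1 \<le> X" using N0 unfolding X_def by simp
  have Xk: "X \<le> X ^ 2" "X ^ 2 \<le> X ^ 4" "X \<le> X ^ 4" using X1 power_increasing[of 1 2 X] power_increasing[of 2 4 X]
    power_increasing[of 1 4 X] by auto
  have nN: "n \<le> Nw" "U \<le> Nw" unfolding Nw_def by auto
  have nn: "n * n \<le> X" "U * n \<le> X" "q * q \<le> X" "n \<le> X" "2 * n \<le> X" "q \<le> X"
    using mult_le_mono[OF nN(1) nN(1)] mult_le_mono[OF nN(2) nN(1)] mult_le_mono[of q Nw q Nw] assms(7) nN N_sq NX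
    by (simp_all add: power2_eq_square)
  \<comment> \<open>The old word bound refers to n + U + 3, since the integers have grown to U + 1.
    Squaring n + U + 2 covers the difference, whence the 2 in the exponent of X.\<close>
  have "n + (U + 1) + 2 \<le> Nw ^ 2" using N_sq N2 unfolding Nw_def by linarith
  then have "Win \<le> (Nw ^ 2) ^ Suc c" unfolding Win_def by (intro power_mono) auto
  then have Win: "Win \<le> X" unfolding X_def by (simp only: power_mult)
  have "\<rho> * 1 \<le> \<rho> * X" using X1 by (intro mult_le_mono) auto
  then have A: "A \<le> (\<rho> + 4) * X" unfolding A_def distrib_right using Win nn by linarith
  have "n * S \<le> n * ((8 * C + 9) * n)" using assms(9) by (intro mult_le_mono) auto
  also have "\<dots> = (8 * C + 9) * (n * n)" by simp
  also have "\<dots> \<le> (8 * C + 9) * X" using nn by (intro mult_le_mono) auto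
  finally have nS: "n * S \<le> (8 * C + 9) * X" .
  then have Y: "Y \<le> (8 * (8 * C + 9)) * X" using mult_le_mono2[OF nS, of 8] unfolding Y_def by (simp only: mult.assoc)
  have AA: "A * A \<le> (\<rho> + 4) * (\<rho> + 4) * X ^ 2"
    using mult_le_mono[OF A A] by (simp only: power2_eq_square mult_ac)
  have A2: "A \<le> (\<rho> + 4) * X ^ 2" and Y2: "Y \<le> (8 * (8 * C + 9)) * X ^ 2"
    using A Y Xk(1) by (meson mult_le_mono2 order_trans)+
  have Z: "2 * A * A + A + Y + 1 \<le> K1 * X ^ 2" (is "?Z \<le> _")
  proof -
    have "2 * a + A + Y + 1 \<le> (2 * b + d + e + 1) * x" if "a \<le> b * x" "A \<le> d * x" "Y \<le> e * x" "1 \<le> x" for a b d e x :: nat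
      using that by (simp add: distrib_right)
    from this[OF AA A2 Y2] show ?thesis using X1 Xk(1) unfolding K1_def by (simp only: mult.assoc)
  qed
  have ZZ: "?Z * ?Z \<le> K1 * K1 * X ^ 4"
  proof -
    have "X ^ 4 = X ^ 2 * X ^ 2" by (simp only: power_add[symmetric]) simp
    moreover have "?Z * ?Z \<le> (K1 * X ^ 2) * (K1 * X ^ 2)" by (rule mult_le_mono[OF Z Z])
    ultimately show ?thesis by (simp only: mult_ac)
  qed
  have Y4: "Y \<le> (8 * (8 * C + 9)) * X ^ 4" using Y Xk(3) by (meson mult_le_mono2 order_trans)
  have fin: "k * X ^ 4 \<le> Nw ^ (8 * Suc c + K)" if "k \<le> K" for k
  proof -
    \<comment> \<open>A constant factor turns into a summand of the exponent.\<close>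
    have "k \<le> 2 ^ K" using that less_exp[of K] by linarith
    also have "\<dots> \<le> Nw ^ K" using N2 by (intro power_mono) auto
    finally have "k * X ^ 4 \<le> Nw ^ K * X ^ 4" by (rule mult_le_mono1)
    moreover have "X ^ 4 = Nw ^ (8 * Suc c)" unfolding X_def power_mult[symmetric] by (rule arg_cong) simp
    then have "Nw ^ (8 * Suc c + K) = Nw ^ K * X ^ 4" by (simp only: power_add mult.commute)
    ultimately show ?thesis by simp
  qed
  have X4: "1 \<le> X ^ 4" using X1 Xk(3) by linarith
  have "z * z + Y + 2 \<le> (k + d + 2) * x" if "z * z \<le> k * x" "Y \<le> d * x" "1 \<le> x" for z k d x :: nat
    using that by (simp add: distrib_right)
  from this[OF ZZ Y4 X4] have "?Z * ?Z + Y + 2 \<le> (K1 * K1 + 8 * (8 * C + 9) + 2) * X ^ 4" .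
  also have "\<dots> \<le> Nw ^ (8 * Suc c + K)" by (rule fin) (simp add: K_def)
  finally show "?Z * ?Z + Y + 2 \<le> Nw ^ (8 * Suc c + K)" .
  have "3 * (n * n) + 6 * n + q * q + q + U * n + n + 9 \<le> 22 * X" using nn X1 by linarith
  also have "\<dots> \<le> 22 * X ^ 4" using Xk(3) by (rule mult_le_mono2)
  also have "\<dots> \<le> Nw ^ (8 * Suc c + K)" by (rule fin) (simp add: K_def)
  finally show "3 * (n * n) + 6 * n + q * q + q + U * n + n + 9 \<le> Nw ^ (8 * Suc c + K)" .
  have n4: "n * X \<le> X ^ 4"
  proof -
    have "n * X \<le> X * X" using nn by (intro mult_le_mono) auto
    then show ?thesis using Xk(2) unfolding power2_eq_square by linarith
  qed
  have "n * (n * S) \<le> n * ((8 * C + 9) * X)" using nS by (rule mult_le_mono2)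
  also have "\<dots> = (8 * C + 9) * (n * X)" by simp
  also have "\<dots> \<le> (8 * C + 9) * X ^ 4" using n4 by (rule mult_le_mono2)
  finally have nnS: "n * n * S \<le> (8 * C + 9) * X ^ 4" by (simp only: mult.assoc)
  have TX: "T \<le> C * X ^ 4"
  proof -
    have "n ^ 3 = n * (n * n)" by (simp add: power3_eq_cube)
    also have "\<dots> \<le> n * X" using nn by (intro mult_le_mono2) auto
    finally have "n ^ 3 \<le> X ^ 4" using n4 by simp
    then show ?thesis using assms(8) by (meson mult_le_mono2 order_trans)
  qed
  have "4 * a + T + 9 \<le> (4 * k + d + 9) * x" if "a \<le> k * x" "T \<le> d * x" "1 \<le> x" for a k d x :: nat
    using that by (simp add: distrib_right)
  from this[OF nnS TX X4] have "4 * (n * n * S) + T + 9 \<le> (4 * (8 * C + 9) + C + 9) * X ^ 4" .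
  also have "\<dots> \<le> Nw ^ (8 * Suc c + K)" by (rule fin) (simp add: K_def)
  finally show "4 * (n * n * S) + T + 9 \<le> Nw ^ (8 * Suc c + K)" .
qed

section \<open>Group sizes that can be reached, and the final exponent\<close>

definition bsqrt :: "nat \<Rightarrow> nat" where
  "bsqrt n = (LEAST q. n \<le> q * q)"

lemma bsqrt:
  assumes "0 < n"
  shows "n \<le> bsqrt n * bsqrt n" "\<And>j. j < bsqrt n \<Longrightarrow> j * j < n" "0 < bsqrt n" "bsqrt n \<le> n"
    "real (bsqrt n) \<le> 2 * sqrt (real n)"
proof -
  have nn: "n \<le> n * n" using assms by simp
  show 1: "n \<le> bsqrt n * bsqrt n" unfolding bsqrt_def by (rule LeastI[of _ n]) (rule nn)
  show 2: "\<And>j. j < bsqrt n \<Longrightarrow> j * j < n" unfolding bsqrt_def using not_less_Least by fastforce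
  show 3: "0 < bsqrt n" using 1 assms by (cases "bsqrt n") auto
  show "bsqrt n \<le> n" unfolding bsqrt_def by (rule Least_le) (rule nn)
  have "(bsqrt n - 1) * (bsqrt n - 1) < n" using 2 3 by simp
  then have "real ((bsqrt n - 1) * (bsqrt n - 1)) \<le> real n" by (simp only: of_nat_le_iff less_imp_le)
  then have "(real (bsqrt n - 1))\<^sup>2 \<le> real n" by (simp add: power2_eq_square)
  then have "real (bsqrt n - 1) \<le> sqrt (real n)" by (rule real_le_rsqrt)
  moreover have "1 \<le> sqrt (real n)" using assms by simp
  moreover have "real (bsqrt n - 1) = real (bsqrt n) - 1" using 3 by (simp add: of_nat_diff)
  ultimately show "real (bsqrt n) \<le> 2 * sqrt (real n)" by linarith
qed

text \<open>If the instances for group size \<open>s\<close> exhaust their budget \<open>n\<^sup>2 s\<close>, then \<open>s\<close> is still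
  below the balanced choice \<open>sqrt (T / n)\<close>, up to a constant.\<close>
lemma abandoned_level:
  fixes n s T C :: nat
  assumes "0 < n" "0 < s" "T \<le> C * n ^ 3" "n * n * s \<le> 2 * ((n + s - 1) div s) * T"
  shows "n * (s * s) \<le> 16 * (C + 1) * T"
proof -
  have "(n + s - 1) div s * s \<le> n + s" using div_times_less_eq_dividend[of "n + s - 1" s] by linarith
  then have "2 * ((n + s - 1) div s * s) * T \<le> 2 * (n + s) * T" by (intro mult_le_mono) auto
  moreover have "n * n * s * s \<le> 2 * ((n + s - 1) div s) * T * s" using assms(4) by (rule mult_le_mono1)
  moreover have "2 * ((n + s - 1) div s) * T * s = 2 * ((n + s - 1) div s * s) * T" by simp
  ultimately have le: "n * n * s * s \<le> 2 * (n + s) * T" by linarith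
  show ?thesis
  \<comment> \<open>For \<open>s \<le> n\<close> a factor n cancels. Otherwise s cancels and leaves
    \<open>n * n * s \<le> 4 * T\<close>; with \<open>T \<le> C * n ^ 3\<close> this gives
    \<open>s \<le> 4 * C * n\<close>, and multiplying by n * s and using the first bound again
    yields the claim.\<close>
  proof (cases "s \<le> n")
    case True
    then have "2 * (n + s) \<le> 4 * n" by simp
    then have "2 * (n + s) * T \<le> 4 * n * T" by (rule mult_le_mono1)
    with le have "n * n * s * s \<le> 4 * n * T" by (rule order_trans)
    moreover have "n * n * s * s = n * (n * (s * s))" "4 * n * T = n * (4 * T)" by (simp_all only: mult_ac)
    ultimately have "n * (n * (s * s)) \<le> n * (4 * T)" by simp
    then have "n * (s * s) \<le> 4 * T" using assms(1) mult_le_cancel1 by blast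
    also have "\<dots> \<le> 16 * (C + 1) * T" by (rule mult_le_mono1) simp
    finally show ?thesis .
  next
    case False
    then have "2 * (n + s) \<le> 4 * s" by simp
    then have "2 * (n + s) * T \<le> 4 * s * T" by (rule mult_le_mono1)
    with le have "n * n * s * s \<le> 4 * s * T" by (rule order_trans)
    moreover have "n * n * s * s = s * (n * n * s)" "4 * s * T = s * (4 * T)" by (simp_all only: mult_ac)
    ultimately have "s * (n * n * s) \<le> s * (4 * T)" by simp
    then have 1: "n * n * s \<le> 4 * T" using assms(2) mult_le_cancel1 by blast
    also have "\<dots> \<le> 4 * (C * n ^ 3)" using assms(3) by simp
    finally have "(n * n) * s \<le> (n * n) * (4 * C * n)" by (simp add: power3_eq_cube algebra_simps)
    then have "s \<le> 4 * C * n" using assms(1) by simp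
    then have "n * s * s \<le> n * s * (4 * C * n)" by (rule mult_le_mono2)
    also have "\<dots> = 4 * C * (n * n * s)" by simp
    also have "\<dots> \<le> 4 * C * (4 * T)" using 1 by (rule mult_le_mono2)
    finally show ?thesis by (simp add: algebra_simps)
  qed
qed

text \<open>Occurs in the analysis only; the program never computes it.
  \<open>abandoned_level\<close> bounds s by 4 times the root, and the doubling makes it 8. The
  first summand is the initial group size.\<close>

definition smax :: "nat \<Rightarrow> (nat \<Rightarrow> nat) \<Rightarrow> nat \<Rightarrow> nat" where
  "smax C T n = bsqrt n + nat \<lfloor>8 * sqrt (real (C + 1) * real (T n) / real n)\<rfloor>"

lemma smax_level:
  assumes "0 < n" "0 < s" "T n \<le> C * n ^ 3" "n * n * s \<le> 2 * ((n + s - 1) div s) * T n"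
  shows "2 * s \<le> smax C T n"
proof -
  have "real (n * (s * s)) \<le> real (16 * (C + 1) * T n)"
    using abandoned_level[OF assms] by (simp only: of_nat_le_iff)
  then have "(real s)\<^sup>2 \<le> 16 * (real (C + 1) * real (T n) / real n)"
    using assms(1) by (simp add: field_simps power2_eq_square)
  then have "real s \<le> sqrt (16 * (real (C + 1) * real (T n) / real n))" by (rule real_le_rsqrt)
  also have "\<dots> = 4 * sqrt (real (C + 1) * real (T n) / real n)" by (simp only: real_sqrt_mult) simp
  finally have "real (2 * s) \<le> 8 * sqrt (real (C + 1) * real (T n) / real n)" by simp
  then have "2 * s \<le> nat \<lfloor>8 * sqrt (real (C + 1) * real (T n) / real n)\<rfloor>" by (simp only: le_nat_floor)
  then show ?thesis unfolding smax_def by simp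
qed

text \<open>T is at most cubic, so T / n is at most quadratic. Group sizes linear in n keep the
  instance numbers, and with them the cell addresses, polynomial.\<close>

lemma smax_le:
  assumes "0 < n" "T n \<le> C * n ^ 3"
  shows "smax C T n \<le> (8 * C + 9) * n"
proof -
  have "real (T n) \<le> real (C * n ^ 3)" using assms(2) by (simp only: of_nat_le_iff)
  then have "real (C + 1) * real (T n) / real n \<le> real (C + 1) * (real C * real n ^ 3) / real n"
    using assms(1) by (intro divide_right_mono mult_left_mono) auto
  also have "\<dots> = real (C + 1) * real C * (real n)\<^sup>2" using assms(1) by (simp add: power3_eq_cube power2_eq_square)
  also have "\<dots> \<le> real (C + 1) * real (C + 1) * (real n)\<^sup>2" by (intro mult_right_mono mult_left_mono) auto
  also have "\<dots> = (real (C + 1) * real n)\<^sup>2" by (simp add: power2_eq_square algebra_simps)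
  finally have "sqrt (real (C + 1) * real (T n) / real n) \<le> real (C + 1) * real n"
    by (intro real_le_lsqrt) auto
  then have "8 * sqrt (real (C + 1) * real (T n) / real n) \<le> real (8 * (C + 1) * n)"
    by (simp add: algebra_simps)
  then have "nat \<lfloor>8 * sqrt (real (C + 1) * real (T n) / real n)\<rfloor> \<le> 8 * (C + 1) * n" by linarith
  then show ?thesis using bsqrt(4)[OF assms(1)] unfolding smax_def by (simp add: algebra_simps)
qed

definition total_time :: "nat \<Rightarrow> (nat \<Rightarrow> nat) \<Rightarrow> nat \<Rightarrow> nat" where
  "total_time C T n = 24000 * (n * n * smax C T n) + 100 * (nat \<lfloor>log 2 (real (smax C T n))\<rfloor> * T n)"

text \<open>The first summand is of order n^2 * sqrt (T / n), which gives the exponent. In the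
  second one the logarithm is at most a constant times n powr (epsilon / 2), so its product with T
  has the same order.\<close>

lemma total_time_bigo:
  assumes eps: "\<epsilon> > 0" and T: "(\<lambda>n. real (T n)) \<in> O(\<lambda>n. real n powr (3 - \<epsilon>))"
    and lower: "\<And>n. 0 < n \<Longrightarrow> n * n \<le> T n" and upper: "\<And>n. 0 < n \<Longrightarrow> T n \<le> C * n ^ 3"
  shows "(\<lambda>n. real (total_time C T n)) \<in> O(\<lambda>n. real n powr (3 - \<epsilon> / 2))"
proof -
  obtain c where c: "c > 0" "eventually (\<lambda>n. norm (real (T n)) \<le> c * norm (real n powr (3 - \<epsilon>))) at_top"
    using landau_o.bigE[OF T] by blast
  define k1 where "k1 = 2 + 8 * sqrt (real (C + 1))"
  define k2 where "k2 = real (8 * C + 9) powr (\<epsilon> / 2) / (\<epsilon> / 2) / ln 2"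
  show ?thesis
  proof (rule bigoI)
    show "eventually (\<lambda>n. norm (real (total_time C T n)) \<le>
        (24000 * (k1 * sqrt c) + 100 * (k2 * c)) * norm (real n powr (3 - \<epsilon> / 2))) at_top"
      using c(2) eventually_gt_at_top[of 0]
    proof eventually_elim
      case (elim n)
      define x where "x = real n"
      have x1: "1 \<le> x" using elim(2) unfolding x_def by simp
      have x0: "0 < x" using x1 by simp
      have Tc: "real (T n) \<le> c * x powr (3 - \<epsilon>)" using elim(1) unfolding x_def by simp
      \<comment> \<open>T is at least quadratic, so sqrt n is at most sqrt (T / n), and the initial
        group size is absorbed.\<close>
      have "real (n * n) \<le> real (T n)" using lower[OF elim(2)] by (simp only: of_nat_le_iff)
      then have xT: "x \<le> real (T n) / x" using x0 unfolding x_def by (simp add: field_simps)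
      have "real (smax C T n) \<le> real (bsqrt n) + 8 * sqrt (real (C + 1) * real (T n) / x)"
        unfolding smax_def x_def by simp
      also have "\<dots> \<le> 2 * sqrt (real (T n) / x) + 8 * (sqrt (real (C + 1)) * sqrt (real (T n) / x))"
      proof (rule add_mono)
        have "sqrt x \<le> sqrt (real (T n) / x)" using xT by simp
        then show "real (bsqrt n) \<le> 2 * sqrt (real (T n) / x)" using bsqrt(5)[OF elim(2)] unfolding x_def by linarith
        show "8 * sqrt (real (C + 1) * real (T n) / x) \<le> 8 * (sqrt (real (C + 1)) * sqrt (real (T n) / x))"
          by (simp only: real_sqrt_mult[symmetric] times_divide_eq_right order_refl)
      qed
      also have "\<dots> = k1 * sqrt (real (T n) / x)" unfolding k1_def by (simp add: algebra_simps)
      finally have S: "real (smax C T n) \<le> k1 * sqrt (real (T n) / x)" .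
      have k1: "0 \<le> k1" unfolding k1_def by simp
      have "real (T n) / x \<le> c * x powr (3 - \<epsilon>) / x" using Tc x0 by (intro divide_right_mono) auto
      also have "\<dots> = c * x powr (2 - \<epsilon>)" using x0 powr_diff[of x "3 - \<epsilon>" 1] by simp
      finally have "sqrt (real (T n) / x) \<le> sqrt (c * x powr (2 - \<epsilon>))" by simp
      also have "\<dots> = sqrt c * x powr (1 - \<epsilon> / 2)"
      proof -
        have "sqrt (x powr (2 - \<epsilon>)) = x powr (1 - \<epsilon> / 2)"
          using x0 by (intro real_sqrt_unique) (simp_all add: power2_eq_square powr_add[symmetric])
        then show ?thesis by (simp add: real_sqrt_mult)
      qed
      finally have "k1 * sqrt (real (T n) / x) \<le> k1 * (sqrt c * x powr (1 - \<epsilon> / 2))" using k1 by (rule mult_left_mono)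
      then have S2: "real (smax C T n) \<le> k1 * sqrt c * x powr (1 - \<epsilon> / 2)" using S by (simp add: mult.assoc)
      have xx: "x * x = x powr 2" using x0 by (simp add: power2_eq_square)
      have "x * x * real (smax C T n) \<le> x powr 2 * (k1 * sqrt c * x powr (1 - \<epsilon> / 2))"
        unfolding xx using S2 by (intro mult_left_mono) auto
      also have "\<dots> = k1 * sqrt c * x powr (3 - \<epsilon> / 2)" by (simp add: powr_add[symmetric] algebra_simps)
      finally have part1: "x * x * real (smax C T n) \<le> k1 * sqrt c * x powr (3 - \<epsilon> / 2)" .
      have "1 \<le> smax C T n" using bsqrt(3)[OF elim(2)] unfolding smax_def by linarith
      then have S1: "1 \<le> real (smax C T n)" by simp
      have "real (smax C T n) \<le> real ((8 * C + 9) * n)" using smax_le[of n T C, OF elim(2) upper[OF elim(2)]] by (simp only: of_nat_le_iff)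
      then have S3: "real (smax C T n) \<le> real (8 * C + 9) * x" unfolding x_def by simp
      have "ln (real (smax C T n)) \<le> real (smax C T n) powr (\<epsilon> / 2) / (\<epsilon> / 2)"
        using S1 eps by (intro ln_powr_bound) auto
      also have "\<dots> \<le> (real (8 * C + 9) * x) powr (\<epsilon> / 2) / (\<epsilon> / 2)"
        using S3 S1 eps by (intro divide_right_mono powr_mono2) auto
      also have "\<dots> = real (8 * C + 9) powr (\<epsilon> / 2) / (\<epsilon> / 2) * x powr (\<epsilon> / 2)" using x0 by (simp add: powr_mult)
      finally have "ln (real (smax C T n)) / ln 2 \<le> real (8 * C + 9) powr (\<epsilon> / 2) / (\<epsilon> / 2) * x powr (\<epsilon> / 2) / ln 2"
        by (intro divide_right_mono) auto
      then have lgb: "log 2 (real (smax C T n)) \<le> k2 * x powr (\<epsilon> / 2)" unfolding log_def k2_def by simp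
      have "0 \<le> log 2 (real (smax C T n))" using S1 by simp
      then have "real (nat \<lfloor>log 2 (real (smax C T n))\<rfloor>) \<le> k2 * x powr (\<epsilon> / 2)" using lgb by linarith
      moreover have "0 \<le> k2" unfolding k2_def using eps by simp
      ultimately have "real (nat \<lfloor>log 2 (real (smax C T n))\<rfloor>) * real (T n) \<le> (k2 * x powr (\<epsilon> / 2)) * (c * x powr (3 - \<epsilon>))"
        using Tc by (intro mult_mono) auto
      also have "\<dots> = k2 * c * x powr (3 - \<epsilon> / 2)"
      proof -
        have "x powr (\<epsilon> / 2) * x powr (3 - \<epsilon>) = x powr (3 - \<epsilon> / 2)" by (simp add: powr_add[symmetric] algebra_simps)
        then show ?thesis by (metis (no_types, opaque_lifting) mult.assoc mult.commute)
      qed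
      finally have part2: "real (nat \<lfloor>log 2 (real (smax C T n))\<rfloor>) * real (T n) \<le> k2 * c * x powr (3 - \<epsilon> / 2)" .
      have "real (total_time C T n) = 24000 * (x * x * real (smax C T n)) +
          100 * (real (nat \<lfloor>log 2 (real (smax C T n))\<rfloor>) * real (T n))"
        unfolding total_time_def x_def by simp
      also have "\<dots> \<le> 24000 * (k1 * sqrt c * x powr (3 - \<epsilon> / 2)) + 100 * (k2 * c * x powr (3 - \<epsilon> / 2))"
        using part1 part2 by (intro add_mono mult_left_mono) auto
      also have "\<dots> = (24000 * (k1 * sqrt c) + 100 * (k2 * c)) * x powr (3 - \<epsilon> / 2)" by (simp add: algebra_simps)
      finally show ?case unfolding x_def by simp
    qed
  qed
qed

text \<open>The Landau bound holds from some \<open>N0\<close> on; the sum of the finitely many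
  earlier values is added to the constant. The exponent only drops to 3 when epsilon is given
  up.\<close>

lemma solver_bounds:
  assumes "\<epsilon> > 0" "(\<lambda>n. real (T n)) \<in> O(\<lambda>n. real n powr (3 - \<epsilon>))"
  shows "\<exists>C::nat. \<forall>n>0. T n \<le> C * n ^ 3"
proof -
  obtain c where c: "c > 0" "eventually (\<lambda>n. norm (real (T n)) \<le> c * norm (real n powr (3 - \<epsilon>))) at_top"
    using landau_o.bigE[OF assms(2)] by blast
  then obtain N0 where N0: "\<And>n. N0 \<le> n \<Longrightarrow> real (T n) \<le> c * real n powr (3 - \<epsilon>)"
    unfolding eventually_at_top_linorder by auto
  define C where "C = nat \<lceil>c\<rceil> + (\<Sum>n<N0. T n)"
  have "T n \<le> C * n ^ 3" if n: "0 < n" for n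
  proof (cases "N0 \<le> n")
    case True
    have "real n powr (3 - \<epsilon>) \<le> real n powr 3" using n assms(1) by (intro powr_mono) auto
    also have "\<dots> = real n ^ 3" using n by simp
    finally have "c * real n powr (3 - \<epsilon>) \<le> c * real n ^ 3" using c(1) by (intro mult_left_mono) auto
    also have "\<dots> \<le> real C * real n ^ 3"
    proof (rule mult_right_mono)
      have "c \<le> real (nat \<lceil>c\<rceil>)" by linarith
      moreover have "nat \<lceil>c\<rceil> \<le> C" unfolding C_def by simp
      then have "real (nat \<lceil>c\<rceil>) \<le> real C" by (simp only: of_nat_le_iff)
      ultimately show "c \<le> real C" by linarith
    qed simp
    finally have "real (T n) \<le> real (C * n ^ 3)" using N0[OF True] by simp
    then show ?thesis by (simp only: of_nat_le_iff)
  next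
    case False
    have "T n \<le> (\<Sum>n<N0. T n)" using False by (intro member_le_sum) auto
    then have "T n \<le> C" unfolding C_def by simp
    also have "C * 1 \<le> C * n ^ 3" using n by (intro mult_le_mono2) simp
    then have "C \<le> C * n ^ 3" by simp
    finally show ?thesis .
  qed
  then show ?thesis by blast
qed

theorem theorem4p1:
  fixes \<epsilon> :: real
  assumes "\<epsilon> > 0"
    and "solvable_in_time exists_dominance_OMv (\<lambda>n. real n powr (3 - \<epsilon>))"
  shows "solvable_in_time min_max_OMv (\<lambda>n. real n powr (3 - \<epsilon> / 2))"
proof -
  obtain alg c T where h: "(\<lambda>n. real (T n)) \<in> O(\<lambda>n. real n powr (3 - \<epsilon>)) \<and>
     (\<forall>n>0. \<forall>(U::nat) (M :: matrix) (v :: nat \<Rightarrow> vector).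
        (\<forall>i<n. \<forall>k<n. \<bar>M i k\<bar> \<le> int U) \<longrightarrow> (\<forall>j<n. \<forall>k<n. \<bar>v j k\<bar> \<le> int U) \<longrightarrow>
        solves_online exists_dominance_OMv alg (int ((n + U + 2) ^ c)) n M v (T n))"
    using assms(2) unfolding solvable_in_time_def by (elim exE)
  note T = h[THEN conjunct1]
  have alg: "solves_online exists_dominance_OMv alg (int ((n + U + 2) ^ c)) n M v (T n)"
    if "0 < n" "\<forall>i<n. \<forall>k<n. \<bar>M i k\<bar> \<le> int U" "\<forall>j<n. \<forall>k<n. \<bar>v j k\<bar> \<le> int U" for n U M v
    using h[THEN conjunct2] that by simp
  obtain P Q where PQ: "alg = (P, Q)" by (cases alg)
  obtain C where C: "\<And>n. 0 < n \<Longrightarrow> T n \<le> C * n ^ 3" using solver_bounds[OF assms(1) T] by blast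
  \<comment> \<open>Receiving the matrix and the queries is charged on every input, in particular on
    the zero matrix with zero queries.\<close>
  have lower: "n * n \<le> T n" if "0 < n" for n
  proof -
    have "solves_online exists_dominance_OMv alg (int ((n + 0 + 2) ^ c)) n (\<lambda>_ _. 0) (\<lambda>_ _. 0) (T n)"
      using that by (intro alg) auto
    then obtain t0 and t :: "nat \<Rightarrow> nat" where "n * n + t0 + (\<Sum>j<n. n + t j) \<le> T n"
      unfolding solves_online_def by (elim exE conjE)
    then show ?thesis by linarith
  qed
  \<comment> \<open>The largest register of the solver; \<open>A\<close> has to cover it, since
    registers become cells.\<close>
  define \<rho> where "\<rho> = Max (insert 0 (regs P \<union> regs Q))"
  have \<rho>: "r \<le> \<rho>" if "r \<in> regs P \<union> regs Q" for r
    unfolding \<rho>_def using that finite_regs by (intro Max_ge) auto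
  define K1 where "K1 = 2 * ((\<rho> + 4) * (\<rho> + 4)) + (\<rho> + 4) + 8 * (8 * C + 9) + 1"
  define K where "K = K1 * K1 + 8 * (8 * C + 9) + 2 + 22 + 4 * (8 * C + 9) + C + 9"
  have main: "solves_online min_max_OMv (hcomp 40 preprocess, hcomp 40 (query P Q))
      (int ((n + U + 2) ^ (8 * Suc c + K))) n M v (total_time C T n)"
    if n: "0 < n" and M: "\<forall>i<n. \<forall>k<n. \<bar>M i k\<bar> \<le> int U" and v: "\<forall>j<n. \<forall>k<n. \<bar>v j k\<bar> \<le> int U" for n U M v
  proof -
    let ?q = "bsqrt n" and ?S = "smax C T n"
    \<comment> \<open>The exponent \<open>Suc c\<close> makes \<open>Win\<close> at least n + U + 1
      also when c = 0; by \<open>solves_online_mono\<close> the solver works with this larger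
      bound.\<close>
    define Win where "Win = (n + (U + 1) + 2) ^ Suc c"
    define A where "A = Win + \<rho> + n * n + 2 * n"
    define Y where "Y = 8 * (n * ?S)"
    define W where "W = (n + U + 2) ^ (8 * Suc c + K)"
    define nn where "nn = int n * int n"
    define od where "od = nn + 2 * int n"
    define rk where "rk = od + nn + int n"
    define F where "F = rk + nn + int n"
    define ky where "ky = F + 2 * int n"
    define bm where "bm = ky + int ?q * int ?q"
    have b1: "(2 * A * A + A + Y + 1) * (2 * A * A + A + Y + 1) + Y + 2 \<le> W"
      and b2: "3 * (n * n) + 6 * n + ?q * ?q + ?q + U * n + n + 9 \<le> W"
      and b3: "4 * (n * n * ?S) + T n + 9 \<le> W"
      unfolding A_def Win_def Y_def W_def K_def K1_def
      by (rule nat_word_bounds[where U = U and c = c and \<rho> = \<rho>,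
            OF bsqrt(4)[OF n] C[OF n] smax_le[of n T C, OF n C[OF n]]])+
    have "int (3 * (n * n) + 6 * n + ?q * ?q + ?q + U * n + n + 9) \<le> int W" using b2 by (simp only: of_nat_le_iff)
    then have top: "bm + int ?q + int U * int n + int n + 9 \<le> int W"
      unfolding bm_def ky_def F_def rk_def od_def nn_def by simp
    have lay: "layout n ?q U (int W) nn od rk F ky bm"
      by unfold_locales (use n bsqrt[OF n] top in \<open>auto simp: nn_def od_def rk_def F_def ky_def bm_def\<close>)
    have "int ((2 * A * A + A + Y + 1) * (2 * A * A + A + Y + 1) + Y + 2) \<le> int W" using b1 by (simp only: of_nat_le_iff)
    then have cap: "(2 * int A * int A + int A + int Y + 1) * (2 * int A * int A + int A + int Y + 1) + int Y + 2 \<le> int W"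
      by (simp only: of_nat_add of_nat_mult of_nat_numeral of_nat_1)
    have cb: "cell_bounds (int Win) (int W) (int A) (int Y)"
      by unfold_locales (use cap in \<open>auto simp: A_def\<close>)
    have le_Win: "(n + (U + 1) + 2) ^ c \<le> Win" "n + U + 1 \<le> Win"
    proof -
      show "(n + (U + 1) + 2) ^ c \<le> Win" unfolding Win_def by (intro power_increasing) auto
      have "(n + (U + 1) + 2) ^ 1 \<le> Win" unfolding Win_def by (intro power_increasing) auto
      then show "n + U + 1 \<le> Win" by simp
    qed
    have "int (4 * (n * n * ?S) + T n + 9) \<le> int W" using b3 by (simp only: of_nat_le_iff)
    then have Wb: "4 * (nn * int ?S) + int (T n) + 9 \<le> int W" unfolding nn_def by simp
    have S1: "1 \<le> ?S" using bsqrt(3)[OF n] unfolding smax_def by simp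
    have "solves_online min_max_OMv (hcomp 40 preprocess, hcomp 40 (query P Q)) (int W) n M v
       (24000 * (n * n * ?S) + 100 * (nat \<lfloor>log 2 (real ?S)\<rfloor> * T n))"
    proof (rule online_solution[OF lay cb _ _ _ _ bsqrt(2)[OF n] bsqrt(4)[OF n] _ _ _ Wb])
      show "solves_online exists_dominance_OMv (P, Q) (int Win) n X w (T n)"
        if "\<forall>i<n. \<forall>k<n. \<bar>X i k\<bar> \<le> int U + 1" "\<forall>j<n. \<forall>k<n. \<bar>w j k\<bar> \<le> int U + 1" for X w
      proof -
        have "solves_online exists_dominance_OMv (P, Q) (int ((n + (U + 1) + 2) ^ c)) n X w (T n)"
          unfolding PQ[symmetric] by (rule alg[OF n]) (use that in \<open>simp_all only: of_nat_add of_nat_1\<close>)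
        moreover have "int ((n + (U + 1) + 2) ^ c) \<le> int Win" using le_Win(1) by (simp only: of_nat_le_iff)
        ultimately show ?thesis by (rule solves_online_mono)
      qed
      have intA: "int A = int Win + int \<rho> + nn + 2 * int n" unfolding A_def nn_def by simp
      have nn0: "0 \<le> nn" unfolding nn_def by simp
      show "int r \<le> int A" if "r \<in> regs P \<union> regs Q" for r using \<rho>[OF that] nn0 unfolding intA by linarith
      show "int n + int U + 1 \<le> int Win" using le_Win(2) by linarith
      show "nn + 2 * int n \<le> int A" unfolding intA by linarith
      show "?q \<le> ?S" unfolding smax_def by simp
      show "2 * s \<le> ?S" if "?q \<le> s" "n * n * s \<le> 2 * ((n + s - 1) div s) * T n" for s
        using smax_level[of n s T C, OF n _ C[OF n] that(2)] that(1) bsqrt(3)[OF n] by simp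
      show "8 * (int n * int ?S) \<le> int Y" unfolding Y_def by simp
      show "l \<le> nat \<lfloor>log 2 (real ?S)\<rfloor>" if "2 ^ l \<le> ?S" for l
      proof -
        have "real (2 ^ l) \<le> real ?S" using that by (simp only: of_nat_le_iff)
        then have "2 powr real l \<le> real ?S" by (simp add: powr_realpow)
        then have "real l \<le> log 2 (real ?S)" using S1 by (simp add: le_log_iff)
        then show ?thesis by (rule le_nat_floor)
      qed
    qed (use M v in auto)
    then show ?thesis unfolding W_def total_time_def .
  qed
  have "(\<lambda>n. real (total_time C T n)) \<in> O(\<lambda>n. real n powr (3 - \<epsilon> / 2))"
    by (rule total_time_bigo[OF assms(1) T lower C])
  then show ?thesis
    unfolding solvable_in_time_def
    by (intro exI[of _ "(hcomp 40 preprocess, hcomp 40 (query P Q))"] exI[of _ "8 * Suc c + K"]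
        exI[of _ "total_time C T"] conjI allI impI main) blast+
qed

end
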